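(* Let $T_0 \in \mathrm{Aut}(\nu)$ be a fixed (arbitrary) aperiodic transformation of $(I,\mathcal{B}_0,\nu)$. Then the collection $\mathcal{W}$ of those measure preserving transformations $T \in \mathcal{M}$ that are relatively weakly mixing over $T_0$ is a dense $G_\delta$ subset of $\mathcal{M}$.
   Context: Let $\nu$ be Lebesgue measure on the unit interval $I=[0,1]$ with its $\sigma$-algebra $\mathcal{B}_0$ of measurable sets, and let $\mu=\nu\times\nu$ be the product measure on $X=I\times I$. For a standard Lebesgue space, $\mathrm{Aut}(\cdot)$ denotes the group of (invertible) measure preserving automorphisms, identified when equal almost everywhere, with the weak topology ($T_n\to T$ iff the measure of $T_nA\,\triangle\,TA$ tends to $0$ for every measurable $A$), which makes it a Polish group. A transformation is aperiodic if its set of periodic points is null. Define $\mathcal{M}=\{T\in \mathrm{Aut}(\mu): T(A\times I)=T_0A\times I \text{ (mod null sets) for all } A\in\mathcal{B}_0\}$, a closed subset of $\mathrm{Aut}(\mu)$, with the subspace topology. Write $Z=I$ for the first coordinate space. Let $X\times_Z X=\{((z,y),(z,y')): z,y,y'\in I\}$ and let $\lambda=\int_{I}(\delta_z\times\nu)\times(\delta_z\times\nu)\,d\nu(z)$ be the relatively independent product measure, supported on $X\times_Z X$. An element $T\in\mathcal{M}$ is relatively weakly mixing over $T_0$ (weakly mixing relative to $T_0$) when the measure $\lambda$ is $T\times T$-ergodic.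
   Formalization: For non-ergodic T_0 no T makes λ T×T-ergodic, so the literal claim fails; it is proved for ergodic aperiodic T_0, and for arbitrary aperiodic T_0 with "T×T-ergodic" read as: every T×T-invariant set is, mod λ, measurable with respect to Z. *)

theory Defs
  imports "HOL-Probability.Probability"
begin

section \<open>Automorphisms modulo null sets and the weak topology\<close>

definition mp_bijections :: "'a measure \<Rightarrow> ('a \<Rightarrow> 'a) set" where
  "mp_bijections M = {T. bij_betw T (space M) (space M) \<and> T \<in> M \<rightarrow>\<^sub>M M \<and>
      the_inv_into (space M) T \<in> M \<rightarrow>\<^sub>M M \<and> distr M M T = M}"

definition ae_eq :: "'a measure \<Rightarrow> (('a \<Rightarrow> 'a) \<times> ('a \<Rightarrow> 'a)) set" where
  "ae_eq M = {(S, T). S \<in> mp_bijections M \<and> T \<in> mp_bijections M \<and> (AE x in M. S x = T x)}"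

definition Aut :: "'a measure \<Rightarrow> ('a \<Rightarrow> 'a) set set" where
  "Aut M = mp_bijections M // ae_eq M"

text \<open>Elements of \<^term>\<open>Aut M\<close> are equivalence classes of maps. Properties of a class below
  are required of all its representatives; each of them is insensitive to changing a
  representative on a null set.\<close>

text \<open>The generating sets are the pseudo-metric balls of
  \<open>(T, S) \<mapsto> M (T A \<triangle> S A)\<close>; lemma \<open>limitin_weak_topology\<close> identifies the convergent sequences.\<close>

definition weak_topology :: "'a measure \<Rightarrow> ('a \<Rightarrow> 'a) set topology" where
  "weak_topology M = topology_generated_by
     {{D \<in> Aut M. \<forall>T\<in>D. \<forall>S\<in>C. measure M (sym_diff (T ` A) (S ` A)) < e} |C A e.
        C \<in> Aut M \<and> A \<in> sets M \<and> 0 < e}"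

definition aperiodic :: "'a measure \<Rightarrow> ('a \<Rightarrow> 'a) set \<Rightarrow> bool" where
  "aperiodic M C \<longleftrightarrow> (\<forall>T\<in>C. {x \<in> space M. \<exists>n>0. (T ^^ n) x = x} \<in> null_sets M)"

definition dense_gdelta_in :: "'a topology \<Rightarrow> 'a set \<Rightarrow> bool" where
  "dense_gdelta_in X W \<longleftrightarrow> gdelta_in X W \<and> X closure_of W = topspace X"


section \<open>Ergodicity, absolute and relative\<close>

definition invariant_sets :: "'a measure \<Rightarrow> ('a \<Rightarrow> 'a) \<Rightarrow> 'a set set" where
  "invariant_sets M f = {E \<in> sets M. sym_diff (f -` E \<inter> space M) E \<in> null_sets M}"

definition measure_preserving :: "'a measure \<Rightarrow> ('a \<Rightarrow> 'a) \<Rightarrow> bool" where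
  "measure_preserving M f \<longleftrightarrow> f \<in> M \<rightarrow>\<^sub>M M \<and> distr M M f = M"

definition ergodic :: "'a measure \<Rightarrow> ('a \<Rightarrow> 'a) \<Rightarrow> bool" where
  "ergodic M f \<longleftrightarrow> measure_preserving M f \<and>
     (\<forall>E\<in>invariant_sets M f. E \<in> null_sets M \<or> space M - E \<in> null_sets M)"

text \<open>Ergodicity relative to a factor, given by a sub-\<open>\<sigma>\<close>-algebra \<open>F\<close>: every invariant set
  belongs to \<open>F\<close> up to a null set.\<close>

definition ergodic_relative :: "'a measure \<Rightarrow> 'a set set \<Rightarrow> ('a \<Rightarrow> 'a) \<Rightarrow> bool" where
  "ergodic_relative M F f \<longleftrightarrow> measure_preserving M f \<and>
     (\<forall>E\<in>invariant_sets M f. \<exists>B\<in>F. sym_diff E B \<in> null_sets M)"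


section \<open>Extensions of a transformation of the unit interval\<close>

definition nu :: "real measure" where
  "nu = lebesgue_on {0..1}"

text \<open>The product is completed, so that \<^term>\<open>mu\<close> is a standard Lebesgue space.\<close>

definition mu :: "(real \<times> real) measure" where
  "mu = completion (nu \<Otimes>\<^sub>M nu)"

definition extensions :: "(real \<Rightarrow> real) set \<Rightarrow> (real \<times> real \<Rightarrow> real \<times> real) set set" where
  "extensions C0 = {C \<in> Aut mu. \<forall>T\<in>C. \<forall>T0\<in>C0. \<forall>A\<in>sets nu.
      sym_diff (T ` (A \<times> {0..1})) ((T0 ` A) \<times> {0..1}) \<in> null_sets mu}"

definition extension_topology ::
    "(real \<Rightarrow> real) set \<Rightarrow> (real \<times> real \<Rightarrow> real \<times> real) set topology" where
  "extension_topology C0 = subtopology (weak_topology mu) (extensions C0)"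

text \<open>The relatively independent product \<open>\<integral> (\<delta>\<^sub>z \<times> \<nu>) \<times> (\<delta>\<^sub>z \<times> \<nu>) d\<nu>(z)\<close>; the integral of a
  measurable family of measures is the bind of the Giry monad. It is completed because
  \<open>T \<times> T\<close> is in general only measurable for the completed \<open>\<sigma>\<close>-algebra.\<close>

definition rel_product0 :: "((real \<times> real) \<times> (real \<times> real)) measure" where
  "rel_product0 = nu \<bind> (\<lambda>z. (return nu z \<Otimes>\<^sub>M nu) \<Otimes>\<^sub>M (return nu z \<Otimes>\<^sub>M nu))"

definition rel_product :: "((real \<times> real) \<times> (real \<times> real)) measure" where
  "rel_product = completion rel_product0"

text \<open>The \<open>\<sigma>\<close>-algebra of the factor \<open>Z\<close>. Almost everywhere with respect to \<^term>\<open>rel_product\<close> the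
  two base coordinates coincide, so it does not matter which one is used.\<close>

definition base_sets :: "((real \<times> real) \<times> (real \<times> real)) set set" where
  "base_sets = {{p \<in> space rel_product. fst (fst p) \<in> B} |B. B \<in> sets nu}"

text \<open>Relative weak mixing is ergodicity of \<open>T \<times> T\<close> for \<^term>\<open>rel_product\<close>. Since \<open>Z\<close> is a factor
  of this system, ergodicity in the absolute sense forces the base transformation to be ergodic:
  over a non-ergodic base the set \<open>absolute_W\<close> is empty. For an arbitrary base, the ergodicity
  has to be understood relative to \<open>Z\<close>, as in \<open>relative_W\<close>. Over an ergodic base both sets
  coincide. These two facts are lemmas \<open>absolute_W_imp_ergodic_base\<close> and
  \<open>absolute_W_eq_relative_W\<close>.\<close>

definition absolute_W :: "(real \<Rightarrow> real) set \<Rightarrow> (real \<times> real \<Rightarrow> real \<times> real) set set" where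
  "absolute_W C0 = {C \<in> extensions C0. \<forall>T\<in>C. ergodic rel_product (map_prod T T)}"

definition relative_W :: "(real \<Rightarrow> real) set \<Rightarrow> (real \<times> real \<Rightarrow> real \<times> real) set set" where
  "relative_W C0 = {C \<in> extensions C0. \<forall>T\<in>C. ergodic_relative rel_product base_sets (map_prod T T)}"


section \<open>Convergence in the weak topology\<close>

lemma mp_bijections_image:
  assumes T: "T \<in> mp_bijections M" and A: "A \<in> sets M"
  shows "T ` A \<in> sets M" "emeasure M (T ` A) = emeasure M A"
proof -
  have bij: "bij_betw T (space M) (space M)" and Tm: "T \<in> M \<rightarrow>\<^sub>M M" and d: "distr M M T = M"
    and inv: "the_inv_into (space M) T \<in> M \<rightarrow>\<^sub>M M"
    using T by (auto simp: mp_bijections_def)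
  have sub: "A \<subseteq> space M" using A sets.sets_into_space by auto
  have inj: "inj_on T (space M)" and im: "T ` space M = space M"
    using bij by (auto simp: bij_betw_def)
  have eq: "T ` A = the_inv_into (space M) T -` A \<inter> space M"
  proof (intro set_eqI iffI)
    fix x assume "x \<in> T ` A"
    then show "x \<in> the_inv_into (space M) T -` A \<inter> space M"
      using sub im the_inv_into_f_f[OF inj] by auto
  next
    fix x assume x: "x \<in> the_inv_into (space M) T -` A \<inter> space M"
    then have "T (the_inv_into (space M) T x) = x"
      using f_the_inv_into_f[OF inj] im by auto
    with x show "x \<in> T ` A" by (metis IntD1 imageI vimageD)
  qed
  show TA: "T ` A \<in> sets M"
    unfolding eq using inv A by (rule measurable_sets)
  have "T -` (T ` A) \<inter> space M = A"
    using sub inj by (auto simp: inj_on_def)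
  then show "emeasure M (T ` A) = emeasure M A"
    using emeasure_distr[OF Tm TA] d by simp
qed

lemma equiv_ae_eq: "equiv (mp_bijections M) (ae_eq M)"
proof (rule equivI)
  show "ae_eq M \<subseteq> mp_bijections M \<times> mp_bijections M"
    by (auto simp: ae_eq_def)
  show "refl_on (mp_bijections M) (ae_eq M)"
    by (auto simp: refl_on_def ae_eq_def)
  show "sym (ae_eq M)"
    by (auto simp: sym_def ae_eq_def eq_commute)
  show "trans (ae_eq M)"
    unfolding trans_def ae_eq_def by auto
qed

lemma topspace_weak_topology: "topspace (weak_topology M) = Aut M"
proof -
  have "C \<in> topspace (weak_topology M)" if "C \<in> Aut M" for C
    unfolding weak_topology_def topology_generated_by_topspace
    by (rule UnionI, rule CollectI, rule exI[of _ C], rule exI[of _ "{}"], rule exI[of _ 1])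
       (use that in auto)
  then show ?thesis
    unfolding weak_topology_def topology_generated_by_topspace by auto
qed


lemma null_image_cong:
  assumes S: "S \<in> mp_bijections M" and T: "T \<in> mp_bijections M" and ae: "AE x in M. S x = T x"
    and A: "A \<in> sets M"
  shows "sym_diff (S ` A) (T ` A) \<in> null_sets M"
proof -
  from ae obtain N where N: "N \<in> null_sets M" "{x\<in>space M. S x \<noteq> T x} \<subseteq> N"
    by (auto elim!: AE_E3 simp: subset_eq)
  have "S ` N \<in> null_sets M" "T ` N \<in> null_sets M"
    using mp_bijections_image[OF S, of N] mp_bijections_image[OF T, of N] N(1)
    by (auto simp: null_sets_def)
  then have n: "S ` N \<union> T ` N \<in> null_sets M" by auto
  have m: "sym_diff (S ` A) (T ` A) \<in> sets M"
    using mp_bijections_image(1)[OF S A] mp_bijections_image(1)[OF T A] by auto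
  have "sym_diff (S ` A) (T ` A) \<subseteq> S ` N \<union> T ` N"
  proof
    fix y assume y: "y \<in> sym_diff (S ` A) (T ` A)"
    have "x \<in> N" if "x \<in> A" "S x \<noteq> T x" for x
      using that N(2) sets.sets_into_space[OF A] by auto
    moreover have "S x \<noteq> T x" if "x \<in> A" "y = S x \<or> y = T x" for x
    proof
      assume "S x = T x"
      with that have "y = S x" "y = T x" by auto
      with that(1) have "y \<in> S ` A" "y \<in> T ` A" by (metis imageI)+
      with y show False by blast
    qed
    ultimately show "y \<in> S ` N \<union> T ` N" using y by blast
  qed
  with n m show ?thesis using null_sets_subset by blast
qed

lemma measure_sym_diff_triangle:
  assumes "finite_measure M" "A \<in> sets M" "B \<in> sets M" "C \<in> sets M"
  shows "measure M (sym_diff A C) \<le> measure M (sym_diff A B) + measure M (sym_diff B C)"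
proof -
  interpret finite_measure M by fact
  have "measure M (sym_diff A C) \<le> measure M (sym_diff A B \<union> sym_diff B C)"
    using assms by (intro finite_measure_mono) auto
  also have "\<dots> \<le> measure M (sym_diff A B) + measure M (sym_diff B C)"
    using assms by (intro measure_Un_le) auto
  finally show ?thesis .
qed

lemma measure_sym_diff_null:
  assumes "finite_measure M" "A \<in> sets M" "B \<in> sets M" "A' \<in> sets M" "B' \<in> sets M"
    "sym_diff A A' \<in> null_sets M" "sym_diff B B' \<in> null_sets M"
  shows "measure M (sym_diff A B) = measure M (sym_diff A' B')"
proof -
  have z: "measure M (sym_diff A A') = 0" "measure M (sym_diff B B') = 0"
    using assms(6,7) by (auto simp: null_sets_def measure_def)
  have z': "measure M (sym_diff A' A) = 0" "measure M (sym_diff B' B) = 0"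
    using z by (auto simp: Un_commute)
  show ?thesis
    using measure_sym_diff_triangle[OF assms(1), of A A' B] measure_sym_diff_triangle[OF assms(1), of A' B' B]
      measure_sym_diff_triangle[OF assms(1), of A' A B'] measure_sym_diff_triangle[OF assms(1), of A B B']
      z z' assms by auto
qed

text \<open>On \<open>Aut\<close> the class-wise definition of the balls can be read off from representatives.\<close>

lemma aut_ball_iff:
  assumes fin: "finite_measure M" and C: "C \<in> Aut M" and D: "D \<in> Aut M" and A: "A \<in> sets M"
    and S: "S \<in> C" and T: "T \<in> D"
  shows "(\<forall>T\<in>D. \<forall>S\<in>C. measure M (sym_diff (T ` A) (S ` A)) < e) \<longleftrightarrow>
     measure M (sym_diff (T ` A) (S ` A)) < e"
proof -
  have eq: "measure M (sym_diff (T' ` A) (S' ` A)) = measure M (sym_diff (T ` A) (S ` A))"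
    if "T' \<in> D" "S' \<in> C" for T' S'
  proof -
    have "(T', T) \<in> ae_eq M" "(S', S) \<in> ae_eq M"
      using quotient_eq_iff[OF equiv_ae_eq D[unfolded Aut_def] D[unfolded Aut_def] that(1) T]
        quotient_eq_iff[OF equiv_ae_eq C[unfolded Aut_def] C[unfolded Aut_def] that(2) S]
      by simp_all
    then have m: "T' \<in> mp_bijections M" "T \<in> mp_bijections M" "S' \<in> mp_bijections M"
        "S \<in> mp_bijections M" and ae: "AE x in M. T' x = T x" "AE x in M. S' x = S x"
      by (simp_all add: ae_eq_def)
    show ?thesis
      by (rule measure_sym_diff_null[OF fin m(1,3,2,4)[THEN mp_bijections_image(1), OF A]
            null_image_cong[OF m(1,2) ae(1) A] null_image_cong[OF m(3,4) ae(2) A]])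
  qed
  show ?thesis
  proof
    assume "\<forall>T\<in>D. \<forall>S\<in>C. measure M (sym_diff (T ` A) (S ` A)) < e"
    then show "measure M (sym_diff (T ` A) (S ` A)) < e" using S T by blast
  next
    assume "measure M (sym_diff (T ` A) (S ` A)) < e"
    then show "\<forall>T\<in>D. \<forall>S\<in>C. measure M (sym_diff (T ` A) (S ` A)) < e"
      by (intro ballI) (simp only: eq)
  qed
qed

lemma Aut_rep:
  assumes "C \<in> Aut M" "T \<in> C" shows "T \<in> mp_bijections M"
  using assms in_quotient_imp_subset[OF equiv_ae_eq] unfolding Aut_def by blast

lemma limitin_weak_topology:
  assumes fin: "finite_measure M" and D: "\<And>n. D n \<in> Aut M" "\<And>n. T n \<in> D n"
    and C: "C \<in> Aut M" "S \<in> C"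
  shows "limitin (weak_topology M) D C sequentially \<longleftrightarrow>
    (\<forall>A\<in>sets M. (\<lambda>n. measure M (sym_diff (T n ` A) (S ` A))) \<longlonglongrightarrow> 0)"
    (is "?L \<longleftrightarrow> ?R")
proof
  assume L: ?L
  show ?R
  proof (intro ballI tendstoI)
    fix A and e :: real assume A: "A \<in> sets M" and e: "0 < e"
    let ?U = "{D \<in> Aut M. \<forall>T\<in>D. \<forall>S\<in>C. measure M (sym_diff (T ` A) (S ` A)) < e}"
    have "openin (weak_topology M) ?U"
      unfolding weak_topology_def
      by (rule topology_generated_by_Basis) (use A C e in blast)
    moreover have "C \<in> ?U"
      using aut_ball_iff[OF fin C(1) C(1) A C(2) C(2), of e] C(1) e by simp
    ultimately have "\<forall>\<^sub>F n in sequentially. D n \<in> ?U"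
      using L by (simp only: limitin_def)
    then show "\<forall>\<^sub>F n in sequentially. dist (measure M (sym_diff (T n ` A) (S ` A))) 0 < e"
      by eventually_elim (use C(2) D(2) in auto)
  qed
next
  assume R: ?R
  have gen: "C \<in> U \<longrightarrow> (\<forall>\<^sub>F n in sequentially. D n \<in> U)"
    if "generate_topology_on {{D \<in> Aut M. \<forall>T\<in>D. \<forall>S\<in>C. measure M (sym_diff (T ` A) (S ` A)) < e} |C A e.
        C \<in> Aut M \<and> A \<in> sets M \<and> 0 < e} U" for U
    using that
  proof induction
    case Empty then show ?case by simp
  next
    case (Int a b) then show ?case by (auto elim: eventually_elim2)
  next
    case (UN K)
    show ?case
    proof
      assume "C \<in> \<Union>K"
      then obtain k where "k \<in> K" "C \<in> k" by auto
      with UN have "\<forall>\<^sub>F n in sequentially. D n \<in> k" by auto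
      then show "\<forall>\<^sub>F n in sequentially. D n \<in> \<Union>K"
        by eventually_elim (use \<open>k \<in> K\<close> in auto)
    qed
  next
    case (Basis U)
    then obtain B A e where U: "U = {D \<in> Aut M. \<forall>T\<in>D. \<forall>S\<in>B. measure M (sym_diff (T ` A) (S ` A)) < e}"
      and B: "B \<in> Aut M" and A: "A \<in> sets M" and e: "0 < e" by blast
    obtain R where R': "R \<in> B"
      using B in_quotient_imp_non_empty[OF equiv_ae_eq] unfolding Aut_def by blast
    show ?case
    proof
      assume "C \<in> U"
      then have lt: "measure M (sym_diff (S ` A) (R ` A)) < e"
        using C(2) R' unfolding U by auto
      from R A have "(\<lambda>n. measure M (sym_diff (T n ` A) (S ` A))) \<longlonglongrightarrow> 0" by auto
      then have "\<forall>\<^sub>F n in sequentially. measure M (sym_diff (T n ` A) (S ` A)) <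
          e - measure M (sym_diff (S ` A) (R ` A))"
        using lt by (intro order_tendstoD(2)) auto
      then show "\<forall>\<^sub>F n in sequentially. D n \<in> U"
      proof eventually_elim
        case (elim n)
        have "measure M (sym_diff (T n ` A) (R ` A)) < e"
          using measure_sym_diff_triangle[OF fin mp_bijections_image(1)[OF Aut_rep[OF D] A]
              mp_bijections_image(1)[OF Aut_rep[OF C] A] mp_bijections_image(1)[OF Aut_rep[OF B R'] A], of n] elim
          by simp
        then show ?case
          unfolding U using aut_ball_iff[OF fin B D(1) A R' D(2), where e = e] D(1) by simp
      qed
    qed
  qed
  show ?L
    unfolding limitin_def topspace_weak_topology
    using gen C(1) unfolding weak_topology_def openin_topology_generated_by_iff by blast
qed

section \<open>The relatively independent product and its base factor\<close>

interpretation nu: prob_space nu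
  by standard (simp add: nu_def emeasure_restrict_space)

lemma space_nu: "space nu = {0..1}" by (simp add: nu_def)
interpretation nn: pair_prob_space nu nu ..

lemma prob_space_return_pair: "z \<in> space nu \<Longrightarrow> prob_space (return nu z \<Otimes>\<^sub>M nu)"
  by (intro prob_space_pair prob_space_return nu.prob_space_axioms)

lemma measurable_rel_product_kernel: "(\<lambda>z. (return nu z \<Otimes>\<^sub>M nu) \<Otimes>\<^sub>M (return nu z \<Otimes>\<^sub>M nu)) \<in>
   nu \<rightarrow>\<^sub>M subprob_algebra ((nu \<Otimes>\<^sub>M nu) \<Otimes>\<^sub>M (nu \<Otimes>\<^sub>M nu))"
proof -
  have nuS: "nu \<in> space (subprob_algebra nu)"
    by (simp add: space_subprob_algebra nu.subprob_space_axioms prob_space_imp_subprob_space nu.prob_space_axioms)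
  show ?thesis
    by (intro measurable_pair_measure return_measurable measurable_const nuS)
qed

lemma sets_rel_product0: "sets rel_product0 = sets ((nu \<Otimes>\<^sub>M nu) \<Otimes>\<^sub>M (nu \<Otimes>\<^sub>M nu))"
  unfolding rel_product0_def by (rule sets_bind_measurable[OF measurable_rel_product_kernel]) (simp add: space_nu)

lemma space_rel_product0: "space rel_product0 = ({0..1} \<times> {0..1}) \<times> ({0..1} \<times> {0..1})"
  using sets_eq_imp_space_eq[OF sets_rel_product0] by (simp add: space_pair_measure space_nu)

lemma emeasure_rel_product0_rectangle:
  assumes P: "P \<in> sets (nu \<Otimes>\<^sub>M nu)" and Q: "Q \<in> sets (nu \<Otimes>\<^sub>M nu)"
  shows "emeasure rel_product0 (P \<times> Q) = (\<integral>\<^sup>+z. emeasure nu (Pair z -` P) * emeasure nu (Pair z -` Q) \<partial>nu)"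
proof -
  have "emeasure rel_product0 (P \<times> Q) =
    (\<integral>\<^sup>+z. emeasure ((return nu z \<Otimes>\<^sub>M nu) \<Otimes>\<^sub>M (return nu z \<Otimes>\<^sub>M nu)) (P \<times> Q) \<partial>nu)"
    unfolding rel_product0_def by (rule emeasure_bind[OF _ measurable_rel_product_kernel]) (use P Q in \<open>auto simp: space_nu\<close>)
  also have "\<dots> = (\<integral>\<^sup>+z. emeasure nu (Pair z -` P) * emeasure nu (Pair z -` Q) \<partial>nu)"
  proof (rule nn_integral_cong)
    fix z assume z: "z \<in> space nu"
    interpret r: prob_space "return nu z" using z by (rule prob_space_return)
    interpret rr: prob_space "return nu z \<Otimes>\<^sub>M nu" using z by (rule prob_space_return_pair)
    have s: "sets (return nu z \<Otimes>\<^sub>M nu) = sets (nu \<Otimes>\<^sub>M nu)" by (intro sets_pair_measure_cong) auto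
    have *: "emeasure (return nu z \<Otimes>\<^sub>M nu) P = emeasure nu (Pair z -` P)" if P: "P \<in> sets (nu \<Otimes>\<^sub>M nu)" for P
    proof -
      have "emeasure (return nu z \<Otimes>\<^sub>M nu) P = (\<integral>\<^sup>+x. emeasure nu (Pair x -` P) \<partial>return nu z)"
        by (rule nu.emeasure_pair_measure_alt) (simp add: s P)
      also have "\<dots> = emeasure nu (Pair z -` P)"
        by (rule nn_integral_return[OF z]) (rule nu.measurable_emeasure_Pair[OF P])
      finally show ?thesis .
    qed
    show "emeasure ((return nu z \<Otimes>\<^sub>M nu) \<Otimes>\<^sub>M (return nu z \<Otimes>\<^sub>M nu)) (P \<times> Q) =
        emeasure nu (Pair z -` P) * emeasure nu (Pair z -` Q)"
      by (subst rr.emeasure_pair_measure_Times) (auto simp: s P Q *)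
  qed
  finally show ?thesis .
qed

lemma emeasure_rel_product0_fst:
  assumes P: "P \<in> sets (nu \<Otimes>\<^sub>M nu)"
  shows "emeasure rel_product0 (P \<times> ({0..1}\<times>{0..1})) = emeasure (nu \<Otimes>\<^sub>M nu) P"
proof -
  have I: "{0..1}\<times>{0..1} = space (nu \<Otimes>\<^sub>M nu)" by (simp add: space_pair_measure space_nu)
  have I': "({0..1}::real set) \<in> sets nu" using sets.top[of nu] by (simp add: space_nu)
  have "emeasure rel_product0 (P \<times> ({0..1}\<times>{0..1})) = (\<integral>\<^sup>+z. emeasure nu (Pair z -` P) * emeasure nu (Pair z -` ({0..1}\<times>{0..1})) \<partial>nu)"
    by (rule emeasure_rel_product0_rectangle[OF P]) (simp add: I' )
  also have "\<dots> = (\<integral>\<^sup>+z. emeasure nu (Pair z -` P) \<partial>nu)"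
  proof (rule nn_integral_cong)
    fix z assume "z \<in> space nu"
    then have "Pair z -` ({0..1}\<times>{0..1}) = space nu" by (auto simp: space_nu)
    then show "emeasure nu (Pair z -` P) * emeasure nu (Pair z -` ({0..1}\<times>{0..1})) = emeasure nu (Pair z -` P)"
      by (simp add: nu.emeasure_space_1)
  qed
  also have "\<dots> = emeasure (nu \<Otimes>\<^sub>M nu) P" by (rule nu.emeasure_pair_measure_alt[OF P, symmetric])
  finally show ?thesis .
qed

lemma rel_product_fst:
  assumes P: "P \<in> sets mu"
  shows "P \<times> ({0..1}\<times>{0..1}) \<in> sets rel_product"
    "emeasure rel_product (P \<times> ({0..1}\<times>{0..1})) = emeasure mu P"
proof -
  let ?J = "({0..1::real}\<times>{0..1::real})"
  have J: "?J \<in> sets (nu \<Otimes>\<^sub>M nu)"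
    using sets.top[of "nu \<Otimes>\<^sub>M nu"] by (simp add: space_pair_measure space_nu)
  have P': "P \<in> sets (completion (nu \<Otimes>\<^sub>M nu))" using P by (simp add: mu_def)
  from P' obtain S N N' where d: "P = S \<union> N" "N \<subseteq> N'" "N' \<in> null_sets (nu \<Otimes>\<^sub>M nu)" "S \<in> sets (nu \<Otimes>\<^sub>M nu)"
    by (rule sets_completionE)
  have N'0: "N' \<times> ?J \<in> null_sets rel_product0"
    using emeasure_rel_product0_fst[of N'] d(3) J by (auto simp: null_sets_def sets_rel_product0)
  then have N0: "N \<times> ?J \<in> null_sets (completion rel_product0)"
    using d(2) unfolding null_sets_completion_iff2 by (intro bexI[of _ "N' \<times> ?J"]) auto
  have S0: "S \<times> ?J \<in> sets rel_product0" using d(4) J by (simp add: sets_rel_product0)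
  have e: "P \<times> ?J = (S \<times> ?J) \<union> (N \<times> ?J)" using d by auto
  show "P \<times> ?J \<in> sets rel_product" unfolding e rel_product_def using S0 N0 by auto
  have "emeasure rel_product (P \<times> ?J) = emeasure (completion rel_product0) (S \<times> ?J)"
    unfolding e rel_product_def using S0 N0 by (intro emeasure_Un_null_set) auto
  also have "\<dots> = emeasure rel_product0 (S \<times> ?J)" using S0 by simp
  also have "\<dots> = emeasure (nu \<Otimes>\<^sub>M nu) S" using emeasure_rel_product0_fst d(4) by simp
  also have "\<dots> = emeasure (completion (nu \<Otimes>\<^sub>M nu)) S" using d(4) by simp
  also have "\<dots> = emeasure (completion (nu \<Otimes>\<^sub>M nu)) P"
  proof -
    have "N \<in> null_sets (completion (nu \<Otimes>\<^sub>M nu))"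
      using d(2,3) by (auto simp: null_sets_completion_iff2)
    then show ?thesis unfolding d(1) using d(4) by (intro emeasure_Un_null_set[symmetric]) auto
  qed
  finally show "emeasure rel_product (P \<times> ?J) = emeasure mu P" by (simp add: mu_def)
qed

lemma mu_strip: assumes "B \<in> sets nu"
  shows "B \<times> {0..1} \<in> sets mu" "emeasure mu (B \<times> {0..1}) = emeasure nu B"
proof -
  have I: "{0..1} \<in> sets nu" "emeasure nu {0..1} = 1"
    using sets.top[of nu] nu.emeasure_space_1 by (simp_all add: space_nu)
  have m: "B \<times> {0..1} \<in> sets (nu \<Otimes>\<^sub>M nu)" using assms I by auto
  then show "B \<times> {0..1} \<in> sets mu" by (simp add: mu_def)
  show "emeasure mu (B \<times> {0..1}) = emeasure nu B"
    using m assms I by (simp add: mu_def nu.emeasure_pair_measure_Times)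
qed

lemma space_mu: "space mu = {0..1} \<times> {0..1}" by (simp add: mu_def space_pair_measure space_nu)

lemma sym_diff_null_cong:
  assumes "sym_diff A A' \<in> null_sets M" "A \<in> sets M" "A' \<in> sets M" "B \<in> sets M"
  shows "sym_diff A B \<in> null_sets M \<longleftrightarrow> sym_diff A' B \<in> null_sets M"
proof -
  have *: "sym_diff A B \<in> null_sets M" if "sym_diff A A' \<in> null_sets M" "A \<in> sets M" "A' \<in> sets M" "sym_diff A' B \<in> null_sets M" for A A'
  proof (rule null_sets_subset)
    show "sym_diff A A' \<union> sym_diff A' B \<in> null_sets M" by (rule null_sets.Un[OF that(1) that(4)])
  qed (use that assms in auto)
  have "sym_diff A' A \<in> null_sets M" using assms(1) by (simp only: Un_commute)
  then show ?thesis
    using *[OF assms(1-3)] *[OF _ assms(3,2)] by blast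
qed

lemma null_sets_iff_of_emeasure_eq:
  "\<lbrakk>emeasure M X = emeasure N Y; X \<in> sets M; Y \<in> sets N\<rbrakk> \<Longrightarrow> X \<in> null_sets M \<longleftrightarrow> Y \<in> null_sets N"
  by (simp add: null_sets_def)

lemma inv_image_null:
  assumes T: "T \<in> mp_bijections M" and E: "E \<in> sets M"
  shows "sym_diff (T -` E \<inter> space M) E \<in> null_sets M \<longleftrightarrow> sym_diff (T ` E) E \<in> null_sets M"
proof -
  have Tm: "T \<in> M \<rightarrow>\<^sub>M M" and im: "T ` space M = space M" and inj: "inj_on T (space M)"
    using T by (auto simp: mp_bijections_def bij_betw_def)
  have sub: "E \<subseteq> space M" using E sets.sets_into_space by auto
  let ?X = "sym_diff (T -` E \<inter> space M) E"
  have X: "?X \<in> sets M" using measurable_sets[OF Tm E] E by auto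
  have "T ` (T -` E \<inter> space M) = E"
  proof
    show "E \<subseteq> T ` (T -` E \<inter> space M)"
    proof
      fix y assume y: "y \<in> E"
      then obtain x where "x \<in> space M" "y = T x" using im sub by blast
      with y show "y \<in> T ` (T -` E \<inter> space M)" by auto
    qed
  qed auto
  moreover have "T ` ?X = sym_diff (T ` (T -` E \<inter> space M)) (T ` E)"
  proof -
    have "T ` (T -` E \<inter> space M - E) = T ` (T -` E \<inter> space M) - T ` E"
      by (rule inj_on_image_set_diff[OF inj]) (use sub in auto)
    moreover have "T ` (E - T -` E \<inter> space M) = T ` E - T ` (T -` E \<inter> space M)"
      by (rule inj_on_image_set_diff[OF inj]) (use sub in auto)
    ultimately show ?thesis by (simp only: image_Un)
  qed
  ultimately have "T ` ?X = sym_diff E (T ` E)" by (simp only:)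
  also have "\<dots> = sym_diff (T ` E) E" by (rule Un_commute)
  finally have TX: "T ` ?X = sym_diff (T ` E) E" .
  show ?thesis
    using null_sets_iff_of_emeasure_eq[OF mp_bijections_image(2)[OF T X] mp_bijections_image(1)[OF T X] X]
    unfolding TX by (rule sym)
qed

lemma base_set_invariant_iff:
  assumes C0: "C0 \<in> Aut nu" "T0 \<in> C0" and C: "C \<in> extensions C0" "T \<in> C" and B: "B \<in> sets nu"
  shows "{p \<in> space rel_product. fst (fst p) \<in> B} \<in> invariant_sets rel_product (map_prod T T)
    \<longleftrightarrow> B \<in> invariant_sets nu T0"
proof -
  let ?J = "({0..1::real}\<times>{0..1::real})" and ?S = "B \<times> {0..1::real}"
  have Bs: "B \<subseteq> {0..1}" using sets.sets_into_space[OF B] by (simp add: space_nu)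
  have CA: "C \<in> Aut mu" using C by (simp add: extensions_def)
  have T: "T \<in> mp_bijections mu" by (rule Aut_rep[OF CA C(2)])
  have T0: "T0 \<in> mp_bijections nu" by (rule Aut_rep[OF C0])
  have TJ: "x \<in> ?J \<Longrightarrow> T x \<in> ?J" for x
    using T measurable_space[of T mu mu x] by (simp add: mp_bijections_def space_mu)
  have sp: "space rel_product = ?J \<times> ?J" by (simp add: rel_product_def space_rel_product0)
  have S: "?S \<in> sets mu" using mu_strip B by simp
  have E: "{p \<in> space rel_product. fst (fst p) \<in> B} = ?S \<times> ?J"
    unfolding sp using Bs by auto
  have Es: "?S \<times> ?J \<in> sets rel_product" by (rule rel_product_fst(1)[OF S])
  let ?X = "sym_diff (T -` ?S \<inter> space mu) ?S"
  have X: "?X \<in> sets mu"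
  proof -
    have "T \<in> mu \<rightarrow>\<^sub>M mu" using T unfolding mp_bijections_def by blast
    from measurable_sets[OF this S] S show ?thesis by (intro sets.Un sets.Diff)
  qed
  have "sym_diff (map_prod T T -` (?S \<times> ?J) \<inter> space rel_product) (?S \<times> ?J) = ?X \<times> ?J"

  proof -
    have "?S \<subseteq> ?J" using Bs by blast
    moreover have "map_prod T T -` (?S \<times> ?J) \<inter> (?J \<times> ?J) = (T -` ?S \<inter> ?J) \<times> ?J"
      using TJ by (intro set_eqI; clarify; simp only: vimage_eq IntE Int_iff map_prod_simp mem_Sigma_iff) blast
    ultimately show ?thesis unfolding sp space_mu by blast
  qed
  then have "?S \<times> ?J \<in> invariant_sets rel_product (map_prod T T) \<longleftrightarrow> ?X \<times> ?J \<in> null_sets rel_product"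
    unfolding invariant_sets_def using Es by (simp only: mem_Collect_eq simp_thms)
  also have "\<dots> \<longleftrightarrow> ?X \<in> null_sets mu"
    by (rule null_sets_iff_of_emeasure_eq[OF rel_product_fst(2)[OF X] rel_product_fst(1)[OF X] X])
  also have "\<dots> \<longleftrightarrow> sym_diff (T ` ?S) ?S \<in> null_sets mu" by (rule inv_image_null[OF T S])
  also have "\<dots> \<longleftrightarrow> sym_diff ((T0 ` B) \<times> {0..1}) ?S \<in> null_sets mu"
    proof (rule sym_diff_null_cong)
    show "sym_diff (T ` ?S) ((T0 ` B) \<times> {0..1}) \<in> null_sets mu"
      using C C0(2) B unfolding extensions_def by blast
  qed (rule mp_bijections_image(1)[OF T S] mu_strip(1)[OF mp_bijections_image(1)[OF T0 B]] S)+
  also have "sym_diff ((T0 ` B) \<times> {0..1}) ?S = sym_diff (T0 ` B) B \<times> {0..1::real}" by auto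
  also have "sym_diff (T0 ` B) B \<times> {0..1::real} \<in> null_sets mu \<longleftrightarrow> sym_diff (T0 ` B) B \<in> null_sets nu"
  proof -
    have m: "sym_diff (T0 ` B) B \<in> sets nu" using mp_bijections_image(1)[OF T0 B] B by auto
    show ?thesis by (rule null_sets_iff_of_emeasure_eq[OF mu_strip(2,1)[OF m] m])
  qed
  also have "\<dots> \<longleftrightarrow> B \<in> invariant_sets nu T0"
    using inv_image_null[OF T0 B] B unfolding invariant_sets_def by blast
  finally show ?thesis unfolding E .
qed

lemma base_set_null_iff:
  assumes B: "B \<in> sets nu"
  shows "{p \<in> space rel_product. fst (fst p) \<in> B} \<in> null_sets rel_product \<longleftrightarrow> B \<in> null_sets nu"
    "{p \<in> space rel_product. fst (fst p) \<in> B} \<in> sets rel_product"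
proof -
  let ?J = "({0..1::real}\<times>{0..1::real})" and ?S = "B \<times> {0..1::real}"
  have Bs: "B \<subseteq> {0..1}" using sets.sets_into_space[OF B] by (simp add: space_nu)
  have E: "{p \<in> space rel_product. fst (fst p) \<in> B} = ?S \<times> ?J"
    using Bs by (auto simp: rel_product_def space_rel_product0)
  note m = rel_product_fst[OF mu_strip(1)[OF B]]
  show "{p \<in> space rel_product. fst (fst p) \<in> B} \<in> sets rel_product" unfolding E by (rule m)
  show "{p \<in> space rel_product. fst (fst p) \<in> B} \<in> null_sets rel_product \<longleftrightarrow> B \<in> null_sets nu"
    unfolding E
    by (rule null_sets_iff_of_emeasure_eq[OF trans[OF m(2) mu_strip(2)[OF B]] m(1) B])
qed

lemma mp_bijections_measure_preserving: "T \<in> mp_bijections M \<Longrightarrow> measure_preserving M T"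
  by (simp add: mp_bijections_def measure_preserving_def)

lemma base_set_compl: "space rel_product - {p \<in> space rel_product. fst (fst p) \<in> B} = {p \<in> space rel_product. fst (fst p) \<in> space nu - B}"
  by (auto simp: rel_product_def space_rel_product0 space_nu)

lemma absolute_W_imp_ergodic_base:
  assumes "C0 \<in> Aut nu" "absolute_W C0 \<noteq> {}" "T0 \<in> C0"
  shows "ergodic nu T0"
proof -
  obtain C where C: "C \<in> extensions C0" "\<forall>T\<in>C. ergodic rel_product (map_prod T T)"
    using assms by (auto simp: absolute_W_def)
  then have "C \<in> Aut mu" by (simp add: extensions_def)
  then obtain T where T: "T \<in> C" using in_quotient_imp_non_empty[OF equiv_ae_eq] unfolding Aut_def by blast
  with C have e: "ergodic rel_product (map_prod T T)" by auto
  show ?thesis unfolding ergodic_def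
  proof (intro conjI ballI)
    show "measure_preserving nu T0" by (rule mp_bijections_measure_preserving[OF Aut_rep[OF assms(1,3)]])
    fix B assume B: "B \<in> invariant_sets nu T0"
    then have Bm: "B \<in> sets nu" by (simp add: invariant_sets_def)
    have "{p \<in> space rel_product. fst (fst p) \<in> B} \<in> invariant_sets rel_product (map_prod T T)"
      using base_set_invariant_iff[OF assms(1,3) C(1) T Bm] B by simp
    then have "{p \<in> space rel_product. fst (fst p) \<in> B} \<in> null_sets rel_product \<or>
      {p \<in> space rel_product. fst (fst p) \<in> space nu - B} \<in> null_sets rel_product"
      using e unfolding ergodic_def base_set_compl[symmetric] by blast
    then show "B \<in> null_sets nu \<or> space nu - B \<in> null_sets nu"
      using base_set_null_iff(1)[OF Bm] base_set_null_iff(1)[of "space nu - B"] Bm by auto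
  qed
qed

lemma absolute_W_eq_relative_W:
  assumes "C0 \<in> Aut nu" "T0 \<in> C0" "ergodic nu T0"
  shows "absolute_W C0 = relative_W C0"
proof -
  have "ergodic rel_product (map_prod T T) \<longleftrightarrow> ergodic_relative rel_product base_sets (map_prod T T)"
    if C: "C \<in> extensions C0" and T: "T \<in> C" for C T
  proof
    assume e: "ergodic rel_product (map_prod T T)"
    have z: "{} \<in> base_sets" unfolding base_sets_def by (intro CollectI exI[of _ "{}"]) auto
    have "space rel_product = {p \<in> space rel_product. fst (fst p) \<in> space nu}"
      by (auto simp: rel_product_def space_rel_product0 space_nu)
    then have f: "space rel_product \<in> base_sets"
      unfolding base_sets_def by blast
    show "ergodic_relative rel_product base_sets (map_prod T T)"
      unfolding ergodic_relative_def
    proof (intro conjI ballI)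
      show "measure_preserving rel_product (map_prod T T)" using e by (simp add: ergodic_def)
      fix E assume E: "E \<in> invariant_sets rel_product (map_prod T T)"
      then have s: "E - space rel_product = {}"
        using sets.sets_into_space[of E rel_product] by (auto simp: invariant_sets_def)
      have "E \<in> null_sets rel_product \<or> space rel_product - E \<in> null_sets rel_product"
        using e E by (auto simp: ergodic_def)
      then show "\<exists>B\<in>base_sets. sym_diff E B \<in> null_sets rel_product"
      proof
        assume "E \<in> null_sets rel_product"
        then show ?thesis by (intro bexI[OF _ z]) simp
      next
        assume "space rel_product - E \<in> null_sets rel_product"
        then show ?thesis by (intro bexI[OF _ f]) (simp only: s Un_empty_left)
      qed
    qed
  next
    assume r: "ergodic_relative rel_product base_sets (map_prod T T)"
    show "ergodic rel_product (map_prod T T)"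
      unfolding ergodic_def
    proof (intro conjI ballI)
      show mp: "measure_preserving rel_product (map_prod T T)" using r by (simp add: ergodic_relative_def)
      fix E assume E: "E \<in> invariant_sets rel_product (map_prod T T)"
      then obtain B where B: "B \<in> sets nu"
        and n: "sym_diff E {p \<in> space rel_product. fst (fst p) \<in> B} \<in> null_sets rel_product"
        using r unfolding ergodic_relative_def base_sets_def by blast
      let ?F = "{p \<in> space rel_product. fst (fst p) \<in> B}"
      let ?P = "\<lambda>X. map_prod T T -` X \<inter> space rel_product"
      have Em: "E \<in> sets rel_product" and Ei: "sym_diff (?P E) E \<in> null_sets rel_product"
        using E by (auto simp: invariant_sets_def)
      have Fm: "?F \<in> sets rel_product" by (rule base_set_null_iff(2)[OF B])
      have mm: "map_prod T T \<in> rel_product \<rightarrow>\<^sub>M rel_product"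
         and dd: "distr rel_product rel_product (map_prod T T) = rel_product"
        using mp by (auto simp: measure_preserving_def)
      have Pn: "?P (sym_diff E ?F) \<in> null_sets rel_product"
        using emeasure_distr[OF mm, of "sym_diff E ?F"] n dd measurable_sets[OF mm, of "sym_diff E ?F"]
        by (auto simp: null_sets_def)
      have "?P (sym_diff E ?F) = sym_diff (?P E) (?P ?F)" by auto
      with Pn have Pn': "sym_diff (?P E) (?P ?F) \<in> null_sets rel_product" by simp
      have "sym_diff (?P ?F) ?F \<in> null_sets rel_product"
      proof (rule null_sets_subset)
        show "sym_diff (?P E) (?P ?F) \<union> sym_diff (?P E) E \<union> sym_diff E ?F \<in> null_sets rel_product"
          by (rule null_sets.Un[OF null_sets.Un[OF Pn' Ei] n])
        show "sym_diff (?P ?F) ?F \<in> sets rel_product" using Fm measurable_sets[OF mm Fm] by blast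
        show "sym_diff (?P ?F) ?F \<subseteq> sym_diff (?P E) (?P ?F) \<union> sym_diff (?P E) E \<union> sym_diff E ?F" by blast
      qed
      then have "?F \<in> invariant_sets rel_product (map_prod T T)" using Fm by (simp add: invariant_sets_def)
      then have "B \<in> invariant_sets nu T0" using base_set_invariant_iff[OF assms(1,2) C T B] by simp
      then have "B \<in> null_sets nu \<or> space nu - B \<in> null_sets nu" using assms by (auto simp: ergodic_def)
      then have d: "?F \<in> null_sets rel_product \<or> space rel_product - ?F \<in> null_sets rel_product"
        using base_set_null_iff(1)[OF B] base_set_null_iff(1)[of "space nu - B"] B by (auto simp: base_set_compl)
      then show "E \<in> null_sets rel_product \<or> space rel_product - E \<in> null_sets rel_product"
      proof
        assume "?F \<in> null_sets rel_product"
        then have "sym_diff E ?F \<union> ?F \<in> null_sets rel_product" by (rule null_sets.Un[OF n])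
        then have "E \<in> null_sets rel_product" by (rule null_sets_subset) (use Em in auto)
        then show ?thesis ..
      next
        assume "space rel_product - ?F \<in> null_sets rel_product"
        then have "sym_diff E ?F \<union> (space rel_product - ?F) \<in> null_sets rel_product" by (rule null_sets.Un[OF n])
        then have "space rel_product - E \<in> null_sets rel_product" by (rule null_sets_subset) (use Em in auto)
        then show ?thesis ..
      qed
    qed
  qed
  then show ?thesis unfolding absolute_W_def relative_W_def by blast
qed

end

theory Submission
  imports Defs
begin

text \<open>An extension \<open>T\<close> is relatively weakly mixing iff every \<open>T \<times> T\<close>-invariant set is orthogonal to the
  functions \<open>f = 1\<^sub>A(z) (1\<^sub>D(y) 1\<^bsub>D'\<^esub>(y') - \<nu>(D) \<nu>(D'))\<close> with \<open>A\<close>, \<open>D\<close>, \<open>D'\<close> in a countable determining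
  family. By the mean ergodic theorem this says that some convex combination of the translates of \<open>f\<close>
  has arbitrarily small norm, which is a \<open>G\<^sub>\<delta>\<close> condition because these norms depend continuously on
  \<open>T\<close>.

  For density, \<open>S = T\<^sub>0 \<times> \<beta>\<close> is relatively weakly mixing if \<open>\<beta>\<close> is mixing, and so are its conjugates
  by automorphisms over the identity. On the \<open>i\<close>-th level of a Rokhlin tower for \<open>T\<^sub>0\<close> take the
  conjugating map to be \<open>T\<^sup>i S\<^sup>-\<^sup>i\<close>; then the conjugate of \<open>S\<close> agrees with a given extension \<open>T\<close> off a
  set of small measure. The tower exists since \<open>T\<^sub>0\<close> is aperiodic, ergodic or not.\<close>

section \<open>The group of measure preserving bijections\<close>

text \<open>Since the base need not be ergodic, invariant sets of \<open>T \<times> T\<close> cannot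
  be forced to be trivial, only to come from the base. Hence the test functions have mean zero on
  every fibre and are cut down to base sets \<open>A\<close>: orthogonality to all of them makes a
  set independent of the fibre coordinates given \<open>z\<close>. The convex combination is not
  prescribed but only required to exist, so for each test function and tolerance one obtains a union
  of open sets. The tower works because \<open>(T^(i+1) S^-(i+1)) S (T^i S^-i)^-1 = T\<close>: the
  conjugate can differ from \<open>T\<close> only over the top level and outside the tower. A
  recurrent obstacle is that automorphisms are bijections everywhere while nearly all identities
  hold only almost everywhere. Cut-offs are therefore made along exactly invariant sets, and the
  model map is the identity on its exceptional points. The mixing map is a two-sided Bernoulli shift
  acting on binary digits. Sets given by finitely many digits become exactly independent of their
  far translates, so correlations vanish after finitely many steps and no limit of correlations is
  taken.\<close>

lemma mp_bijectionsI:
  assumes T: "T \<in> M \<rightarrow>\<^sub>M M" and T': "T' \<in> M \<rightarrow>\<^sub>M M" and d: "distr M M T = M"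
    and l: "\<And>x. x \<in> space M \<Longrightarrow> T' (T x) = x" and r: "\<And>x. x \<in> space M \<Longrightarrow> T (T' x) = x"
  shows "T \<in> mp_bijections M"
proof -
  have bij: "bij_betw T (space M) (space M)"
    by (rule bij_betw_byWitness[where f' = T'])
       (use l r measurable_space[OF T] measurable_space[OF T'] in auto)
  have "the_inv_into (space M) T x = T' x" if "x \<in> space M" for x
    using that r[OF that] measurable_space[OF T' that] bij
    by (intro the_inv_into_f_eq) (auto simp: bij_betw_def)
  then have "the_inv_into (space M) T \<in> M \<rightarrow>\<^sub>M M"
    using T' by (subst measurable_cong[where g = T']) auto
  then show ?thesis using bij T d by (auto simp: mp_bijections_def)
qed

abbreviation mp_inv :: "'a measure \<Rightarrow> ('a \<Rightarrow> 'a) \<Rightarrow> 'a \<Rightarrow> 'a" where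
  "mp_inv M T \<equiv> the_inv_into (space M) T"

lemma
  assumes "T \<in> mp_bijections M"
  shows mp_measurable: "T \<in> M \<rightarrow>\<^sub>M M"
    and mp_distr: "distr M M T = M"
    and mp_inv_measurable: "mp_inv M T \<in> M \<rightarrow>\<^sub>M M"
    and mp_inv_left: "x \<in> space M \<Longrightarrow> mp_inv M T (T x) = x"
    and mp_inv_right: "x \<in> space M \<Longrightarrow> T (mp_inv M T x) = x"
    and mp_space: "x \<in> space M \<Longrightarrow> T x \<in> space M"
    and mp_inv_space: "x \<in> space M \<Longrightarrow> mp_inv M T x \<in> space M"
proof -
  show m: "T \<in> M \<rightarrow>\<^sub>M M" "distr M M T = M" "mp_inv M T \<in> M \<rightarrow>\<^sub>M M"
    using assms by (auto simp: mp_bijections_def)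
  show "x \<in> space M \<Longrightarrow> mp_inv M T (T x) = x" "x \<in> space M \<Longrightarrow> T (mp_inv M T x) = x"
    using assms by (auto simp: mp_bijections_def bij_betw_def the_inv_into_f_f f_the_inv_into_f)
  show "x \<in> space M \<Longrightarrow> T x \<in> space M" "x \<in> space M \<Longrightarrow> mp_inv M T x \<in> space M"
    using m by (auto dest: measurable_space)
qed

lemma mp_comp:
  assumes S: "S \<in> mp_bijections M" and T: "T \<in> mp_bijections M"
  shows "(\<lambda>x. S (T x)) \<in> mp_bijections M"
proof (rule mp_bijectionsI[where T' = "\<lambda>x. mp_inv M T (mp_inv M S x)"])
  note [measurable] = mp_measurable[OF S] mp_measurable[OF T] mp_inv_measurable[OF S] mp_inv_measurable[OF T]
  show "(\<lambda>x. S (T x)) \<in> M \<rightarrow>\<^sub>M M" "(\<lambda>x. mp_inv M T (mp_inv M S x)) \<in> M \<rightarrow>\<^sub>M M" by measurable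
  have "distr M M (\<lambda>x. S (T x)) = distr (distr M M T) M S"
    by (subst distr_distr) (auto simp: comp_def)
  then show "distr M M (\<lambda>x. S (T x)) = M" using mp_distr[OF S] mp_distr[OF T] by simp
qed (use S T in \<open>auto simp: mp_inv_left mp_inv_right mp_space mp_inv_space\<close>)

lemma mp_id: "(\<lambda>x. x) \<in> mp_bijections M"
  by (rule mp_bijectionsI[where T' = "\<lambda>x. x"]) (auto simp: distr_id[unfolded id_def])

lemma mp_pow: "T \<in> mp_bijections M \<Longrightarrow> (T ^^ n) \<in> mp_bijections M"
proof (induction n)
  case 0 show ?case by (simp add: mp_id id_def)
next
  case (Suc n) then show ?case using mp_comp[of T M "T ^^ n"] by (simp add: comp_def)
qed

lemma mp_inv_mp:
  assumes T: "T \<in> mp_bijections M" shows "mp_inv M T \<in> mp_bijections M"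
proof (rule mp_bijectionsI[where T' = T])
  note [measurable] = mp_measurable[OF T] mp_inv_measurable[OF T]
  have "distr M M (mp_inv M T) = distr (distr M M T) M (mp_inv M T)" using mp_distr[OF T] by simp
  also have "\<dots> = distr M M (\<lambda>x. mp_inv M T (T x))" by (subst distr_distr) (auto simp: comp_def)
  also have "\<dots> = distr M M (\<lambda>x. x)" by (rule distr_cong) (auto simp: mp_inv_left[OF T])
  finally show "distr M M (mp_inv M T) = M" by (simp add: distr_id[unfolded id_def])
qed (use T in \<open>auto simp: mp_measurable mp_inv_measurable mp_inv_left mp_inv_right\<close>)

lemma mp_AE: "T \<in> mp_bijections M \<Longrightarrow> AE x in M. P x \<Longrightarrow> AE x in M. P (T x)"
  by (rule AE_distrD[OF mp_measurable]) (simp_all only: mp_distr)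

lemma mp_emeasure_vimage:
  "T \<in> mp_bijections M \<Longrightarrow> A \<in> sets M \<Longrightarrow> emeasure M (T -` A \<inter> space M) = emeasure M A"
  using emeasure_distr[of T M M A] by (simp add: mp_measurable mp_distr)

lemma mp_image_eq_vimage:
  assumes "T \<in> mp_bijections M" "A \<subseteq> space M"
  shows "T ` A = mp_inv M T -` A \<inter> space M"
proof (intro set_eqI iffI)
  fix y assume "y \<in> T ` A"
  then obtain x where "x \<in> A" "y = T x" by blast
  then show "y \<in> mp_inv M T -` A \<inter> space M"
    using assms(2) mp_space[OF assms(1), of x] mp_inv_left[OF assms(1), of x] by auto
next
  fix x assume "x \<in> mp_inv M T -` A \<inter> space M"
  then show "x \<in> T ` A" using mp_inv_right[OF assms(1), of x] by (metis IntE imageI vimageD)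
qed

lemma mp_pow_inv_left:
  assumes "T \<in> mp_bijections M" "x \<in> space M"
  shows "(mp_inv M T ^^ n) ((T ^^ n) x) = x"
proof (induction n)
  case (Suc n)
  have "(mp_inv M T ^^ Suc n) ((T ^^ Suc n) x) = (mp_inv M T ^^ n) (mp_inv M T (T ((T ^^ n) x)))"
    by (simp add: funpow_swap1)
  then show ?case using Suc mp_inv_left[OF assms(1) mp_space[OF mp_pow[OF assms(1)] assms(2)]] by simp
qed simp

lemma mp_pow_inv_right:
  assumes "T \<in> mp_bijections M" "x \<in> space M"
  shows "(T ^^ n) ((mp_inv M T ^^ n) x) = x"
proof (induction n)
  case (Suc n)
  have "(T ^^ Suc n) ((mp_inv M T ^^ Suc n) x) = (T ^^ n) (T (mp_inv M T ((mp_inv M T ^^ n) x)))"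
    by (simp add: funpow_swap1)
  then show ?case
    using Suc mp_inv_right[OF assms(1) mp_space[OF mp_pow[OF mp_inv_mp[OF assms(1)]] assms(2)]] by simp
qed simp

section \<open>Restricting and gluing automorphisms\<close>

text \<open>The invariance of \<open>E\<close> holds only almost everywhere, whereas
  \<open>R\<close> has to be a bijection everywhere. So \<open>Q\<close> is kept only at points
  whose whole two-sided orbit stays in \<open>E\<close>; they form an exactly invariant set that
  fills \<open>E\<close> up to a null set.\<close>

lemma mp_localize:
  assumes Q: "Q \<in> mp_bijections M" and E[measurable]: "E \<in> sets M"
    and inv: "AE x in M. Q x \<in> E \<longleftrightarrow> x \<in> E"
  obtains R where "R \<in> mp_bijections M" "AE x in M. x \<in> E \<longrightarrow> R x = Q x"
    "\<And>x. x \<notin> E \<Longrightarrow> R x = x" "\<And>x. x \<in> E \<Longrightarrow> R x \<in> E"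
proof -
  let ?Q' = "mp_inv M Q"
  note Q' = mp_inv_mp[OF Q]
  have [measurable]: "Q \<in> M \<rightarrow>\<^sub>M M" "?Q' \<in> M \<rightarrow>\<^sub>M M" "(Q ^^ n) \<in> M \<rightarrow>\<^sub>M M" "(?Q' ^^ n) \<in> M \<rightarrow>\<^sub>M M" for n
    using mp_measurable Q Q' mp_pow by blast+
  define G where "G = {x \<in> space M. \<forall>n. (Q ^^ n) x \<in> E \<and> (?Q' ^^ n) x \<in> E}"
  have G[measurable]: "G \<in> sets M" unfolding G_def by measurable
  have GE: "x \<in> E" if "x \<in> G" for x using that unfolding G_def by (auto dest: spec[of _ 0])
  have GD: "(Q ^^ n) x \<in> E" "(?Q' ^^ n) x \<in> E" if "x \<in> G" for x n using that unfolding G_def by auto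
  have QG: "Q x \<in> G \<longleftrightarrow> x \<in> G" if x: "x \<in> space M" for x
  proof -
    have a: "(Q ^^ n) (Q x) = (Q ^^ Suc n) x" for n by (simp add: funpow_swap1)
    have b: "(?Q' ^^ Suc n) (Q x) = (?Q' ^^ n) x" for n
      using mp_inv_left[OF Q x] by (simp add: funpow_swap1)
    show ?thesis
    proof
      assume Qx: "Q x \<in> G"
      show "x \<in> G" unfolding G_def
      proof (intro CollectI conjI allI x)
        fix n
        show bn: "(?Q' ^^ n) x \<in> E" for n using GD(2)[OF Qx, of "Suc n"] unfolding b .
        show "(Q ^^ n) x \<in> E" using GD(1)[OF Qx, of "n - 1"] bn[of 0] unfolding a by (cases n) auto
      qed
    next
      assume xG: "x \<in> G"
      show "Q x \<in> G" unfolding G_def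
      proof (intro CollectI conjI allI mp_space[OF Q x])
        fix n
        show an: "(Q ^^ n) (Q x) \<in> E" for n unfolding a by (rule GD(1)[OF xG])
        show "(?Q' ^^ n) (Q x) \<in> E" using GD(2)[OF xG, of "n - 1"] b[of "n - 1"] an[of 0] by (cases n) (simp_all del: funpow.simps(2))
      qed
    qed
  qed
  have Q'G: "?Q' x \<in> G \<longleftrightarrow> x \<in> G" if x: "x \<in> space M" for x
    using QG[OF mp_inv_space[OF Q x]] mp_inv_right[OF Q x] by simp
  define R where "R = (\<lambda>x. if x \<in> G then Q x else x)"
  define R' where "R' = (\<lambda>x. if x \<in> G then ?Q' x else x)"
  have GS: "x \<in> space M" if "x \<in> G" for x using that unfolding G_def by simp
  have "R \<in> mp_bijections M"
  proof (rule mp_bijectionsI[where T' = R'])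
    show Rm: "R \<in> M \<rightarrow>\<^sub>M M" unfolding R_def by measurable
    show "R' \<in> M \<rightarrow>\<^sub>M M" unfolding R'_def by measurable
    show "R' (R x) = x" "R (R' x) = x" if "x \<in> space M" for x
      using QG[OF that] Q'G[OF that] mp_inv_left[OF Q that] mp_inv_right[OF Q that] by (auto simp: R_def R'_def)
    show "distr M M R = M"
    proof (rule measure_eqI)
      fix A assume "A \<in> sets (distr M M R)"
      then have A[measurable]: "A \<in> sets M" by simp
      have "R -` A \<inter> space M = (Q -` (A \<inter> G) \<inter> space M) \<union> (A - G)"
        using sets.sets_into_space[OF A] by (auto simp: R_def GS QG split: if_splits)
      then have "emeasure (distr M M R) A = emeasure M ((Q -` (A \<inter> G) \<inter> space M) \<union> (A - G))"
        using Rm by (simp add: emeasure_distr)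
      also have "\<dots> = emeasure M (Q -` (A \<inter> G) \<inter> space M) + emeasure M (A - G)"
        by (rule plus_emeasure[symmetric]) (auto simp: QG)
      also have "\<dots> = emeasure M (A \<inter> G) + emeasure M (A - G)"
        by (subst mp_emeasure_vimage[OF Q]) auto
      also have "\<dots> = emeasure M ((A \<inter> G) \<union> (A - G))" by (rule plus_emeasure) auto
      also have "(A \<inter> G) \<union> (A - G) = A" by auto
      finally show "emeasure (distr M M R) A = emeasure M A" .
    qed simp
  qed
  moreover have "AE x in M. x \<in> E \<longrightarrow> R x = Q x"
  proof -
    have "AE x in M. \<forall>n. Q ((Q ^^ n) x) \<in> E \<longleftrightarrow> (Q ^^ n) x \<in> E"
      unfolding AE_all_countable using mp_AE[OF mp_pow[OF Q] inv] by blast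
    moreover have "AE x in M. \<forall>n. Q (?Q' ((?Q' ^^ n) x)) \<in> E \<longleftrightarrow> ?Q' ((?Q' ^^ n) x) \<in> E"
      unfolding AE_all_countable using mp_AE[OF mp_pow[OF Q'] mp_AE[OF Q' inv]] by blast
    ultimately show ?thesis using AE_space
    proof eventually_elim
      case (elim x)
      have "(Q ^^ n) x \<in> E \<longleftrightarrow> x \<in> E" for n by (induction n) (use elim(1) in auto)
      moreover have "Q (?Q' ((?Q' ^^ n) x)) = (?Q' ^^ n) x" for n
        using mp_inv_right[OF Q mp_space[OF mp_pow[OF Q'] elim(3)]] .
      then have "(?Q' ^^ n) x \<in> E \<longleftrightarrow> x \<in> E" for n by (induction n) (use elim(2) in auto)
      ultimately show ?case using elim(3) by (auto simp: R_def G_def)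
    qed
  qed
  ultimately show thesis
  proof (rule that)
    show "R x = x" if "x \<notin> E" for x using that GE by (auto simp: R_def)
    show "R x \<in> E" if "x \<in> E" for x using that GE GS QG by (auto simp: R_def)
  qed
qed

text \<open>Induction on \<open>k\<close>, composing the map already glued with a localised
  \<open>Q k\<close>. The latter maps \<open>E k\<close> into itself, where the former is the
  identity, and fixes the other pieces, so the two do not interfere.\<close>

lemma mp_glue:
  fixes Q :: "nat \<Rightarrow> 'a \<Rightarrow> 'a"
  assumes Q: "\<And>i. i < k \<Longrightarrow> Q i \<in> mp_bijections M" and E: "\<And>i. i < k \<Longrightarrow> E i \<in> sets M"
    and disj: "disjoint_family_on E {..<k}"
    and inv: "\<And>i. i < k \<Longrightarrow> AE x in M. Q i x \<in> E i \<longleftrightarrow> x \<in> E i"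
  obtains R where "R \<in> mp_bijections M" "AE x in M. \<forall>i<k. x \<in> E i \<longrightarrow> R x = Q i x"
    "\<And>x. (\<forall>i<k. x \<notin> E i) \<Longrightarrow> R x = x"
proof -
  have "\<exists>R. R \<in> mp_bijections M \<and> (AE x in M. \<forall>i<k. x \<in> E i \<longrightarrow> R x = Q i x) \<and>
     (\<forall>x. (\<forall>i<k. x \<notin> E i) \<longrightarrow> R x = x)"
    using assms
  proof (induction k)
    case 0 then show ?case using mp_id by auto
  next
    case (Suc k)
    have d: "disjoint_family_on E {..<k}"
      using Suc.prems(3) by (rule disjoint_family_on_mono[rotated]) auto
    obtain R where R: "R \<in> mp_bijections M" "AE x in M. \<forall>i<k. x \<in> E i \<longrightarrow> R x = Q i x"
       "\<And>x. (\<forall>i<k. x \<notin> E i) \<Longrightarrow> R x = x"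
      using Suc.IH[OF Suc.prems(1)[OF less_SucI] Suc.prems(2)[OF less_SucI] d Suc.prems(4)[OF less_SucI]] by blast
    obtain R2 where R2: "R2 \<in> mp_bijections M" "AE x in M. x \<in> E k \<longrightarrow> R2 x = Q k x"
    "\<And>x. x \<notin> E k \<Longrightarrow> R2 x = x" "\<And>x. x \<in> E k \<Longrightarrow> R2 x \<in> E k"
      by (rule mp_localize[OF Suc.prems(1)[OF lessI] Suc.prems(2)[OF lessI] Suc.prems(4)[OF lessI]], rule that)
    have dj: "x \<notin> E i" if "x \<in> E k" "i < k" for x i
      using disjoint_family_onD[OF Suc.prems(3), of k i] that by auto
    have a: "R (R2 x) = R2 x" if "x \<in> E k" for x
      using R(3) R2(4)[OF that] dj by blast
    have "AE x in M. \<forall>i<Suc k. x \<in> E i \<longrightarrow> R (R2 x) = Q i x"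
      using R(2) R2(2)
    proof eventually_elim
      case (elim x)
      show ?case
      proof (intro allI impI)
        fix i assume i: "i < Suc k" "x \<in> E i"
        show "R (R2 x) = Q i x"
        proof (cases "i = k")
          case True then show ?thesis using i a[of x] elim by auto
        next
          case False
          then have "x \<notin> E k" using dj i by auto
          then show ?thesis using False i elim R2(3) by simp
        qed
      qed
    qed
    moreover have "R (R2 x) = x" if "\<forall>i<Suc k. x \<notin> E i" for x
      using that R(3) R2(3) by auto
    ultimately show ?case using mp_comp[OF R(1) R2(1)] by (intro exI[of _ "\<lambda>x. R (R2 x)"]) auto
  qed
  then show thesis using that by blast
qed

section \<open>The Rokhlin lemma\<close>

text \<open>A set whose first \<open>K\<close> images are disjoint, but which every aperiodic orbit visits in each
  window of length \<open>2K + 1\<close>: greedily add, for all rational intervals, the points that do not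
  return to the interval too early.\<close>

lemma recurrent_separated_set:
  assumes T: "T \<in> mp_bijections nu"
  obtains F where "F \<in> sets nu"
    "\<And>x i. x \<in> F \<Longrightarrow> i \<in> {1..K} \<Longrightarrow> (T ^^ i) x \<notin> F"
    "\<And>x. x \<in> space nu \<Longrightarrow> \<forall>n>0. (T ^^ n) x \<noteq> x \<Longrightarrow>
      \<exists>i\<le>K. (T ^^ i) x \<in> F \<or> (mp_inv nu T ^^ i) x \<in> F"
proof -
  let ?T' = "mp_inv nu T"
  note T' = mp_inv_mp[OF T]
  note [measurable] = mp_measurable[OF T] mp_measurable[OF T']
  have Tn: "(T ^^ n) \<in> nu \<rightarrow>\<^sub>M nu" "(?T' ^^ n) \<in> nu \<rightarrow>\<^sub>M nu" for n
    using mp_measurable mp_pow[OF T] mp_pow[OF T'] by blast+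
  have "\<exists>c :: nat \<Rightarrow> rat \<times> rat. surj c"
    using uncountable_def[of "UNIV :: (rat \<times> rat) set"] by auto
  then obtain c :: "nat \<Rightarrow> rat \<times> rat" where c: "surj c" by blast
  define I where "I k = {of_rat (fst (c k)) <..< (of_rat (snd (c k)) :: real)}" for k
  \<comment> \<open>Points of \<open>V k\<close> lie in \<open>I k\<close> while their next
    \<open>K\<close> images do not, so two of them are never \<open>i\<close> steps apart with
    \<open>1 \<le> i \<le> K\<close>.\<close>
  define V where "V k = {x \<in> space nu. x \<in> I k \<and> (\<forall>i\<in>{1..K}. (T ^^ i) x \<notin> I k)}" for k
  have Im[measurable]: "Measurable.pred nu (\<lambda>x. x \<in> I k)" for k
  proof -
    have "(\<lambda>x. x) \<in> borel_measurable nu" unfolding nu_def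
      by (rule measurable_restrict_space1, rule measurable_completion) simp
    then show ?thesis unfolding I_def by measurable
  qed
  have V[measurable]: "V k \<in> sets nu" for k
    unfolding V_def using measurable_compose[OF Tn(1) Im] by measurable
  \<comment> \<open>A new point is refused if an accepted one lies within \<open>K\<close> steps in
    either direction of its orbit. Conflicts among the new points are already excluded by
    \<open>V k\<close>.\<close>
  define F where "F = rec_nat {} (\<lambda>k H. H \<union> {x \<in> V k. \<forall>i\<in>{1..K}. (T ^^ i) x \<notin> H \<and> (?T' ^^ i) x \<notin> H})"
  have F0: "F 0 = {}" and FS: "F (Suc k) = F k \<union> {x \<in> V k. \<forall>i\<in>{1..K}. (T ^^ i) x \<notin> F k \<and> (?T' ^^ i) x \<notin> F k}" for k
    by (simp_all add: F_def)
  have Fm[measurable]: "F k \<in> sets nu" for k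
  proof (induction k)
    case 0 then show ?case by (simp add: F0)
  next
    case (Suc k)
    note Suc[measurable]
    have "{x \<in> V k. \<forall>i\<in>{1..K}. (T ^^ i) x \<notin> F k \<and> (?T' ^^ i) x \<notin> F k} =
      {x \<in> space nu. x \<in> V k \<and> (\<forall>i\<in>{1..K}. (T ^^ i) x \<notin> F k \<and> (?T' ^^ i) x \<notin> F k)}"
      unfolding V_def by auto
    also have "\<dots> \<in> sets nu" by measurable
    finally show ?case unfolding FS by auto
  qed
  have Fmono: "F k \<subseteq> F l" if "k \<le> l" for k l
    using that by (rule lift_Suc_mono_le[rotated]) (auto simp: FS)
  have Fsp: "x \<in> space nu" if "x \<in> F k" for x k using sets.sets_into_space[OF Fm] that by blast
  have sep: "(T ^^ i) x \<notin> F k" if "x \<in> F k" "i \<in> {1..K}" for x i k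
    using that(1)
  proof (induction k)
    case (Suc k)
    have x: "x \<in> space nu" using Fsp Suc.prems by blast
    have b: "(?T' ^^ i) ((T ^^ i) x) = x" by (rule mp_pow_inv_left[OF T x])
    let ?N = "{x \<in> V k. \<forall>i\<in>{1..K}. (T ^^ i) x \<notin> F k \<and> (?T' ^^ i) x \<notin> F k}"
    show ?case
    proof (cases "x \<in> F k")
      case 1: True
      have "(T ^^ i) x \<notin> {x \<in> V k. \<forall>i\<in>{1..K}. (T ^^ i) x \<notin> F k \<and> (?T' ^^ i) x \<notin> F k}"
        using 1 that(2) b by (metis (no_types, lifting) mem_Collect_eq)
      then show ?thesis using Suc.IH[OF 1] unfolding FS by blast
    next
      case False
      then have "x \<in> ?N" using Suc.prems by (simp only: FS Un_iff simp_thms)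
      then have 2: "x \<in> V k" "(T ^^ i) x \<notin> F k" using that(2) by auto
      then have "(T ^^ i) x \<notin> V k" using that(2) unfolding V_def by auto
      then show ?thesis using 2 unfolding FS by blast
    qed
  qed (simp add: F0)
  show thesis
  proof (rule that[of "\<Union>k. F k"])
    show "(\<Union>k. F k) \<in> sets nu" by measurable
    show "(T ^^ i) x \<notin> (\<Union>k. F k)" if x: "x \<in> (\<Union>k. F k)" and i: "i \<in> {1..K}" for x i
    proof
      assume "(T ^^ i) x \<in> (\<Union>k. F k)"
      then obtain k l where kl: "x \<in> F k" "(T ^^ i) x \<in> F l" using x by auto
      then have "x \<in> F (max k l)" "(T ^^ i) x \<in> F (max k l)" using Fmono[of k "max k l"] Fmono[of l "max k l"] by auto
      then show False using sep i by blast
    qed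
    fix x assume x: "x \<in> space nu" and ap: "\<forall>n>0. (T ^^ n) x \<noteq> x"
    define S where "S = (\<lambda>i. (T ^^ i) x) ` {1..K}"
    have "finite S" unfolding S_def by simp
    have "x \<notin> S"
    proof
      assume "x \<in> S"
      then obtain i where "i \<in> {1..K}" "x = (T ^^ i) x" unfolding S_def by blast
      then show False using ap[rule_format, of i] by simp
    qed
    \<comment> \<open>The next \<open>K\<close> images form a finite set avoiding \<open>x\<close>,
      so some rational interval around \<open>x\<close> misses them all. At the stage of that
      interval \<open>x\<close> is accepted unless an earlier accepted point is within
      \<open>K\<close> steps.\<close>
    then have "open (- S)" "x \<in> - S" using \<open>finite S\<close> by (auto intro: finite_imp_closed)
    then obtain e where e: "e > 0" "ball x e \<subseteq> - S" by (auto simp: open_contains_ball)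
    obtain p where p: "x - e < of_rat p" "of_rat p < x" using of_rat_dense[of "x - e" x] e by auto
    obtain q where q: "x < of_rat q" "of_rat q < x + e" using of_rat_dense[of x "x + e"] e by auto
    obtain k where k: "c k = (p, q)" using c by (metis surjD)
    have "I k \<subseteq> ball x e" unfolding I_def k using p q by (auto simp: dist_real_def)
    with e(2) have "I k \<inter> S = {}" by blast
    then have "(T ^^ i) x \<notin> I k" if "i \<in> {1..K}" for i using that unfolding S_def by blast
    moreover have "x \<in> I k" unfolding I_def k using p q by simp
    ultimately have "x \<in> V k" using x unfolding V_def by simp
    then have "x \<in> F (Suc k) \<or> (\<exists>i\<in>{1..K}. (T ^^ i) x \<in> F k \<or> (?T' ^^ i) x \<in> F k)"
      unfolding FS by blast
    then show "\<exists>i\<le>K. (T ^^ i) x \<in> (\<Union>k. F k) \<or> (?T' ^^ i) x \<in> (\<Union>k. F k)"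
    proof
      assume "x \<in> F (Suc k)" then show ?thesis by (intro exI[of _ 0]) auto
    qed auto
  qed
qed

text \<open>Cut every orbit at its visits to the separated set \<open>F\<close> and split the
  stretches into blocks of length \<open>N\<close>, counted from the last visit. Only incomplete
  final blocks are lost; they lie fewer than \<open>N\<close> steps before a visit, so sparse visits
  make the loss small.\<close>

lemma rokhlin_tower:
  assumes T: "T \<in> mp_bijections nu"
    and ap: "{x \<in> space nu. \<exists>n>0. (T ^^ n) x = x} \<in> null_sets nu"
    and N: "N > 0" and e: "e > 0"
  obtains B where "B \<in> sets nu" "disjoint_family_on (\<lambda>i. (T ^^ i) ` B) {..<N}"
    "measure nu (space nu - (\<Union>i<N. (T ^^ i) ` B)) < e"
proof -
  let ?T' = "mp_inv nu T"
  note T' = mp_inv_mp[OF T]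
  note [measurable] = mp_measurable[OF T] mp_measurable[OF T']
  have Tn: "(T ^^ n) \<in> nu \<rightarrow>\<^sub>M nu" "(?T' ^^ n) \<in> nu \<rightarrow>\<^sub>M nu" for n
    using mp_measurable mp_pow[OF T] mp_pow[OF T'] by blast+
  \<comment> \<open>The \<open>K + 1\<close> preimages \<open>L 0, ..., L K\<close> of
    \<open>F\<close> are disjoint and have its measure, so \<open>nu F \<le> 1 / (K + 1)\<close>,
    and \<open>N\<close> preimages together have measure below \<open>e\<close>.\<close>
  obtain K where K: "real N / e < real K" using reals_Archimedean2 by blast
  obtain F where F[measurable]: "F \<in> sets nu"
    and sep: "\<And>x i. x \<in> F \<Longrightarrow> i \<in> {1..K} \<Longrightarrow> (T ^^ i) x \<notin> F"
    and rec: "\<And>x. x \<in> space nu \<Longrightarrow> \<forall>n>0. (T ^^ n) x \<noteq> x \<Longrightarrow>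
      \<exists>i\<le>K. (T ^^ i) x \<in> F \<or> (mp_inv nu T ^^ i) x \<in> F"
    using recurrent_separated_set[OF T, of K] by blast
  have sp: "(T ^^ i) x \<in> space nu" "(?T' ^^ i) x \<in> space nu" if "x \<in> space nu" for i x
    using mp_space[OF mp_pow[OF T] that] mp_space[OF mp_pow[OF T'] that] by auto
  have shift1: "(?T' ^^ j) ((T ^^ i) x) = (?T' ^^ (j - i)) x" if "x \<in> space nu" "i \<le> j" for x i j
  proof -
    have "(?T' ^^ j) ((T ^^ i) x) = (?T' ^^ (j - i)) ((?T' ^^ i) ((T ^^ i) x))"
      using that(2) by (metis comp_apply funpow_add le_add_diff_inverse2)
    then show ?thesis using mp_pow_inv_left[OF T that(1)] by simp
  qed
  have shift2: "(?T' ^^ j) ((T ^^ i) x) = (T ^^ (i - j)) x" if "x \<in> space nu" "j \<le> i" for x i j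
  proof -
    have "(T ^^ i) x = (T ^^ j) ((T ^^ (i - j)) x)"
      using that(2) by (metis comp_apply funpow_add le_add_diff_inverse)
    then show ?thesis using mp_pow_inv_left[OF T sp(1)[OF that(1)]] by simp
  qed
  have shift3: "(T ^^ i) ((?T' ^^ j) x) = (?T' ^^ (j - i)) x" if "x \<in> space nu" "i \<le> j" for x i j
  proof -
    have "(?T' ^^ j) x = (?T' ^^ i) ((?T' ^^ (j - i)) x)"
      using that(2) by (metis comp_apply funpow_add le_add_diff_inverse)
    then show ?thesis using mp_pow_inv_right[OF T sp(2)[OF that(1)]] by simp
  qed
  have shift4: "(T ^^ i) ((?T' ^^ j) x) = (T ^^ (i - j)) x" if "x \<in> space nu" "j \<le> i" for x i j
  proof -
    have "(T ^^ i) ((?T' ^^ j) x) = (T ^^ (i - j)) ((T ^^ j) ((?T' ^^ j) x))"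
      using that(2) by (metis comp_apply funpow_add le_add_diff_inverse2)
    then show ?thesis using mp_pow_inv_right[OF T that(1)] by simp
  qed
  \<comment> \<open>Points that have met \<open>F\<close> in the past, for which the time since the
    last visit makes sense.\<close>
  define Y where "Y = {x \<in> space nu. \<exists>j. (?T' ^^ j) x \<in> F}"
  have Y[measurable]: "Y \<in> sets nu"
  proof -
    have "Y = (\<Union>j. (?T' ^^ j) -` F \<inter> space nu)" unfolding Y_def by auto
    then show ?thesis using measurable_sets[OF Tn(2) F] by auto
  qed
  have Ycof: "space nu - Y \<in> null_sets nu"
  proof (rule null_sets_subset)
    let ?P = "{x \<in> space nu. \<exists>n>0. (T ^^ n) x = x}"
    show "(?T' ^^ K) -` ?P \<inter> space nu \<in> null_sets nu"
      by (rule null_setsI[OF trans[OF mp_emeasure_vimage[OF mp_pow[OF T']]] measurable_sets[OF Tn(2)]])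
        (use null_setsD1[OF ap] null_setsD2[OF ap] in blast)+
    show "space nu - Y \<subseteq> (?T' ^^ K) -` {x \<in> space nu. \<exists>n>0. (T ^^ n) x = x} \<inter> space nu"
    proof
      fix x assume x: "x \<in> space nu - Y"
      \<comment> \<open>Going back \<open>K\<close> steps places the window of length
        \<open>2 K + 1\<close> around \<open>?y\<close> entirely in the past of \<open>x\<close>. As
        \<open>F\<close> is not met there, \<open>?y\<close> must be periodic.\<close>
      let ?y = "(?T' ^^ K) x"
      have "\<not> (\<forall>n>0. (T ^^ n) ?y \<noteq> ?y)"
      proof
        assume "\<forall>n>0. (T ^^ n) ?y \<noteq> ?y"
        then obtain i where i: "i \<le> K" "(T ^^ i) ?y \<in> F \<or> (?T' ^^ i) ?y \<in> F"
          using rec[OF sp(2)] x by blast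
        moreover have "(T ^^ i) ?y = (?T' ^^ (K - i)) x" using shift3 i x by auto
        moreover have "(?T' ^^ i) ?y = (?T' ^^ (i + K)) x" by (simp add: funpow_add)
        ultimately show False using x unfolding Y_def by auto
      qed
      then show "x \<in> (?T' ^^ K) -` {x \<in> space nu. \<exists>n>0. (T ^^ n) x = x} \<inter> space nu" using x sp by auto
    qed
  qed measurable
  \<comment> \<open>Time elapsed since the last visit to \<open>F\<close>; it has this meaning on
    \<open>Y\<close>, where the minimum exists.\<close>
  define n where "n x = (LEAST j. (?T' ^^ j) x \<in> F)" for x
  have n_in: "(?T' ^^ n x) x \<in> F" if "x \<in> Y" for x
    using that unfolding Y_def n_def by (auto intro: LeastI)
  have n_le: "n x \<le> j" if "(?T' ^^ j) x \<in> F" for x j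
    using that unfolding n_def by (rule Least_le)
  have n_eq: "n x = k" if "(?T' ^^ k) x \<in> F" "\<And>j. j < k \<Longrightarrow> (?T' ^^ j) x \<notin> F" for x k
    unfolding n_def using that by (intro Least_equality) (auto simp: not_less[symmetric])
  have [measurable]: "n \<in> nu \<rightarrow>\<^sub>M count_space UNIV" unfolding n_def by measurable
  \<comment> \<open>Starting points of complete blocks: the elapsed time is a multiple of
    \<open>N\<close> and no visit interrupts the next \<open>N - 1\<close> steps. On level
    \<open>i\<close> the elapsed time is then congruent to \<open>i\<close> modulo \<open>N\<close>,
    which separates the levels.\<close>
  define B where "B = {x \<in> space nu. x \<in> Y \<and> N dvd n x \<and> (\<forall>i\<in>{1..<N}. (T ^^ i) x \<notin> F)}"
  have B[measurable]: "B \<in> sets nu" unfolding B_def by measurable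
  have BS: "x \<in> space nu" if "x \<in> B" for x using that unfolding B_def by simp
  have n_level: "n ((T ^^ i) x) = n x + i" if "x \<in> B" "i < N" for x i
  proof (rule n_eq)
    show "(?T' ^^ (n x + i)) ((T ^^ i) x) \<in> F" using shift1[OF BS[OF that(1)], of i "n x + i"] n_in that(1) unfolding B_def by simp
    fix j assume j: "j < n x + i"
    show "(?T' ^^ j) ((T ^^ i) x) \<notin> F"
    proof (cases "j < i")
      case True
      then show ?thesis using shift2[OF BS[OF that(1)], of j i] that bspec[of "{1..<N}" _ "i - j"] unfolding B_def by fastforce
    next
      case False
      then show ?thesis using shift1[OF BS[OF that(1)], of i j] n_le[of "j - i" x] j by auto
    qed
  qed
  have levels: "disjoint_family_on (\<lambda>i. (T ^^ i) ` B) {..<N}"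
    unfolding disjoint_family_on_def
  proof (intro ballI impI)
    fix i j assume ij: "i \<in> {..<N}" "j \<in> {..<N}" "i \<noteq> j"
    have md: "n y mod N = i" if y: "y \<in> (T ^^ i) ` B" and i: "i < N" for y i
    proof -
      obtain x where x: "x \<in> B" "y = (T ^^ i) x" using y by blast
      have "N dvd n x" using x(1) unfolding B_def by simp
      moreover have "n y = n x + i" using n_level[OF x(1) i] x(2) by simp
      ultimately show ?thesis using i mod_add_left_eq[of "n x" N i] by simp
    qed
    show "(T ^^ i) ` B \<inter> (T ^^ j) ` B = {}"
    proof (rule equals0I)
      fix y assume "y \<in> (T ^^ i) ` B \<inter> (T ^^ j) ` B"
      then have "n y mod N = i" "n y mod N = j" using md[of y] ij by (simp_all only: lessThan_iff Int_iff)
      then show False using ij by simp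
    qed
  qed
  define L where "L i = (T ^^ i) -` F \<inter> space nu" for i
  have L[measurable]: "L i \<in> sets nu" for i unfolding L_def using measurable_sets[OF Tn(1) F] .
  have Lm: "measure nu (L i) = measure nu F" for i
    unfolding L_def measure_def using mp_emeasure_vimage[OF mp_pow[OF T] F] by simp
  have "real (Suc K) * measure nu F \<le> 1"
  proof -
    have "disjoint_family_on L {..K}"
    proof -
      have "L i \<inter> L j = {}" if "i < j" "j \<le> K" for i j
      proof -
        have "(T ^^ (j - i)) ((T ^^ i) x) = (T ^^ j) x" for x
          using that by (metis comp_apply funpow_add le_add_diff_inverse2 less_imp_le)
        then have "(T ^^ j) x \<notin> F" if "(T ^^ i) x \<in> F" for x
        proof -
          have "j - i \<in> {1..K}" using \<open>i < j\<close> \<open>j \<le> K\<close> by auto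
          from sep[OF that this] show ?thesis using \<open>\<And>x. (T ^^ (j - i)) ((T ^^ i) x) = (T ^^ j) x\<close> by simp
        qed
        then show ?thesis unfolding L_def by blast
      qed
      then show ?thesis unfolding disjoint_family_on_def by (auto simp only: atMost_iff nat_neq_iff Int_commute)
    qed
    then have "measure nu (\<Union>i\<le>K. L i) = (\<Sum>i\<le>K. measure nu (L i))"
      by (intro nu.finite_measure_finite_Union) auto
    then show ?thesis using nu.prob_le_1[of "\<Union>i\<le>K. L i"] by (simp add: Lm)
  qed
  then have "real K * measure nu F \<le> 1" by (simp add: algebra_simps) (smt (verit) measure_nonneg)
  have "real K * e > real N" using K e by (simp add: field_simps)
  have small: "real N * measure nu F < e"
  proof (cases "measure nu F = 0")
    case False
    then have "measure nu F > 0" by (simp add: measure_nonneg order_less_le)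
    then have "real N * measure nu F < (real K * e) * measure nu F"
      using \<open>real K * e > real N\<close> by (intro mult_strict_right_mono)
    also have "\<dots> = e * (real K * measure nu F)" by simp
    also have "\<dots> \<le> e * 1" using \<open>real K * measure nu F \<le> 1\<close> e by (intro mult_left_mono) auto
    finally show ?thesis by simp
  qed (use e in simp)
  \<comment> \<open>A point of \<open>Y\<close> outside all levels is traced back
    \<open>s = n y mod N\<close> steps to the start of its block. That start is not in
    \<open>B\<close>, so a visit interrupts the block: a visit up to \<open>y\<close> contradicts
    the minimality of \<open>n y\<close>, a later one puts \<open>y\<close> into some
    \<open>L i\<close>.\<close>
  have cover: "space nu - (\<Union>i<N. (T ^^ i) ` B) \<subseteq> (space nu - Y) \<union> (\<Union>i<N. L i)"
  proof
    fix y assume y: "y \<in> space nu - (\<Union>i<N. (T ^^ i) ` B)"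
    show "y \<in> (space nu - Y) \<union> (\<Union>i<N. L i)"
    proof (rule ccontr)
      assume a: "y \<notin> (space nu - Y) \<union> (\<Union>i<N. L i)"
      with y have yY: "y \<in> Y" and ys: "y \<in> space nu" and yL: "\<And>i. i < N \<Longrightarrow> (T ^^ i) y \<notin> F"
        unfolding L_def by auto
      define s where "s = n y mod N"
      define x where "x = (?T' ^^ s) y"
      have s: "s < N" "s \<le> n y" using N unfolding s_def by auto
      have nx: "n x = n y - s"
      proof (rule n_eq)
        have *: "(?T' ^^ j) x = (?T' ^^ (j + s)) y" for j by (simp add: x_def funpow_add)
        show "(?T' ^^ (n y - s)) x \<in> F" unfolding * using n_in[OF yY] s by simp
        show "(?T' ^^ j) x \<notin> F" if "j < n y - s" for j unfolding * using n_le[of "j + s" y] that by auto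
      qed
      have xs: "x \<in> space nu" unfolding x_def using sp ys by auto
      have Tsx: "(T ^^ s) x = y" unfolding x_def by (rule mp_pow_inv_right[OF T ys])
      have "(?T' ^^ n x) x \<in> F" using n_in[OF yY] s nx unfolding x_def
        by (metis comp_apply funpow_add le_add_diff_inverse2)
      then have "x \<in> Y" using xs unfolding Y_def by auto
      moreover have "N dvd n x" unfolding nx s_def by (rule dvd_minus_mod)
      moreover have "x \<notin> B" using y s Tsx by auto
      ultimately obtain i where i: "i \<in> {1..<N}" "(T ^^ i) x \<in> F" using xs unfolding B_def by auto
      show False
      proof (cases "i \<le> s")
        case True
        have "(?T' ^^ (s - i)) y \<in> F" using shift3[OF ys True] i(2) unfolding x_def by simp
        from n_le[OF this] show False using s i(1) True by simp
      next
        case False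
        then have "(T ^^ (i - s)) y \<in> F" using shift4[OF ys, of s i] i(2) unfolding x_def by simp
        moreover have "i - s < N" using i(1) by auto
        ultimately show False using yL by blast
      qed
    qed
  qed
  have "measure nu (space nu - (\<Union>i<N. (T ^^ i) ` B)) \<le> measure nu ((space nu - Y) \<union> (\<Union>i<N. L i))"
    by (rule nu.finite_measure_mono[OF cover]) auto
  also have "\<dots> \<le> measure nu (space nu - Y) + measure nu (\<Union>i<N. L i)"
    by (rule measure_Un_le) auto
  also have "measure nu (space nu - Y) = 0" using Ycof by (rule measure_eq_0_null_sets)
  also have "measure nu (\<Union>i<N. L i) \<le> (\<Sum>i<N. measure nu (L i))"
    by (rule measure_UNION_le) auto
  finally have "measure nu (space nu - (\<Union>i<N. (T ^^ i) ` B)) < e" using small by (simp add: Lm)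
  then show thesis using that[OF B levels] by blast
qed

section \<open>Automorphisms over a base transformation\<close>

text \<open>Null sets of \<open>N\<close> pull back to subsets of null sets, which are measurable in
  a complete source. Hence measure preservation on \<open>nu\<close>, \<open>mu\<close> and
  \<open>rel_product\<close> needs to be checked only before completion.\<close>

lemma (in complete_measure) measure_preserving_completion:
  assumes f: "f \<in> M \<rightarrow>\<^sub>M N" and d: "distr M N f = N"
  shows "f \<in> M \<rightarrow>\<^sub>M completion N" "distr M (completion N) f = completion N"
  using measurable_completion2[OF f] completion_distr_eq[OF f] d by simp_all

lemma complete_rel_product: "complete_measure rel_product" and complete_mu: "complete_measure mu"
  unfolding rel_product_def mu_def by (rule completion.complete_measure_axioms)+

lemma sym_diff_null_iff_AE:
  assumes "A \<in> sets M" "B \<in> sets M"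
  shows "sym_diff A B \<in> null_sets M \<longleftrightarrow> (AE x in M. x \<in> A \<longleftrightarrow> x \<in> B)"
proof -
  have s: "sym_diff A B \<in> sets M" using assms by auto
  have "sym_diff A B = {x \<in> space M. \<not> (x \<in> A \<longleftrightarrow> x \<in> B)}"
    using sets.sets_into_space[OF assms(1)] sets.sets_into_space[OF assms(2)] by auto
  then show ?thesis using s AE_iff_null[of M "\<lambda>x. x \<in> A \<longleftrightarrow> x \<in> B"] by simp
qed

lemma invariant_sets_iff_AE:
  assumes f: "f \<in> M \<rightarrow>\<^sub>M M" and E: "E \<in> sets M"
  shows "E \<in> invariant_sets M f \<longleftrightarrow> (AE x in M. f x \<in> E \<longleftrightarrow> x \<in> E)"
proof -
  have "E \<in> invariant_sets M f \<longleftrightarrow> (AE x in M. x \<in> f -` E \<inter> space M \<longleftrightarrow> x \<in> E)"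
    unfolding invariant_sets_def using E sym_diff_null_iff_AE[OF measurable_sets[OF f E] E] by simp
  also have "\<dots> \<longleftrightarrow> (AE x in M. f x \<in> E \<longleftrightarrow> x \<in> E)"
    by (rule AE_cong) auto
  finally show ?thesis .
qed

section \<open>The coordinate projections of \<open>mu\<close> and of the relative product\<close>

lemma sets_nn_subset_mu: "sets (nu \<Otimes>\<^sub>M nu) \<subseteq> sets mu"
  by (auto simp: mu_def)

lemma measurable_mu_imp_nn: "f \<in> M \<rightarrow>\<^sub>M mu \<Longrightarrow> f \<in> M \<rightarrow>\<^sub>M (nu \<Otimes>\<^sub>M nu)"
  using sets_nn_subset_mu by (auto simp: measurable_def space_mu space_pair_measure space_nu)

lemma emeasure_mu_nn: "P \<in> sets (nu \<Otimes>\<^sub>M nu) \<Longrightarrow> emeasure mu P = emeasure (nu \<Otimes>\<^sub>M nu) P"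
  by (simp add: mu_def)

lemma prob_space_mu: "prob_space mu"
  unfolding mu_def using nn.emeasure_space_1 by (intro prob_spaceI) simp

lemma fst_mu: "fst \<in> mu \<rightarrow>\<^sub>M nu" "distr mu nu fst = nu"
proof -
  show f: "fst \<in> mu \<rightarrow>\<^sub>M nu" unfolding mu_def by (rule measurable_completion) simp
  show "distr mu nu fst = nu"
  proof (rule measure_eqI)
    fix A assume "A \<in> sets (distr mu nu fst)"
    then have A: "A \<in> sets nu" by simp
    have "fst -` A \<inter> space mu = A \<times> {0..1}"
      using sets.sets_into_space[OF A] by (auto simp: space_mu space_nu)
    then show "emeasure (distr mu nu fst) A = emeasure nu A"
      using mu_strip(2)[OF A] f A by (simp add: emeasure_distr)
  qed simp
qed

lemma AE_mu_fst: "AE z in nu. P z \<Longrightarrow> AE x in mu. P (fst x)"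
  by (rule AE_distrD[OF fst_mu(1)]) (simp only: fst_mu(2))

lemma rel_product_projections:
  shows fst_rel: "fst \<in> rel_product \<rightarrow>\<^sub>M mu" "distr rel_product mu fst = mu"
    and snd_rel: "snd \<in> rel_product \<rightarrow>\<^sub>M mu" "distr rel_product mu snd = mu"
proof -
  interpret complete_measure rel_product by (rule complete_rel_product)
  have m: "fst \<in> rel_product0 \<rightarrow>\<^sub>M (nu \<Otimes>\<^sub>M nu)" "snd \<in> rel_product0 \<rightarrow>\<^sub>M (nu \<Otimes>\<^sub>M nu)"
    by (simp_all add: measurable_cong_sets[OF sets_rel_product0 refl])
  have J: "{0..1} \<times> {0..1} \<in> sets (nu \<Otimes>\<^sub>M nu)"
    using sets.top[of "nu \<Otimes>\<^sub>M nu"] by (simp add: space_pair_measure space_nu)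
  have "distr rel_product0 (nu \<Otimes>\<^sub>M nu) fst = nu \<Otimes>\<^sub>M nu"
  proof (rule measure_eqI)
    fix P assume "P \<in> sets (distr rel_product0 (nu \<Otimes>\<^sub>M nu) fst)"
    then have P: "P \<in> sets (nu \<Otimes>\<^sub>M nu)" by simp
    have "fst -` P \<inter> space rel_product0 = P \<times> ({0..1} \<times> {0..1})"
      using sets.sets_into_space[OF P] by (auto simp: space_rel_product0 space_pair_measure space_nu)
    then show "emeasure (distr rel_product0 (nu \<Otimes>\<^sub>M nu) fst) P = emeasure (nu \<Otimes>\<^sub>M nu) P"
      using m P by (simp add: emeasure_distr emeasure_rel_product0_fst)
  qed simp
  then have 1: "distr rel_product (nu \<Otimes>\<^sub>M nu) fst = nu \<Otimes>\<^sub>M nu"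
    unfolding rel_product_def using distr_completion[OF m(1)] by simp
  have "distr rel_product0 (nu \<Otimes>\<^sub>M nu) snd = nu \<Otimes>\<^sub>M nu"
  proof (rule measure_eqI)
    fix P assume "P \<in> sets (distr rel_product0 (nu \<Otimes>\<^sub>M nu) snd)"
    then have P: "P \<in> sets (nu \<Otimes>\<^sub>M nu)" by simp
    have "snd -` P \<inter> space rel_product0 = ({0..1} \<times> {0..1}) \<times> P"
      using sets.sets_into_space[OF P] by (auto simp: space_rel_product0 space_pair_measure space_nu)
    then have "emeasure (distr rel_product0 (nu \<Otimes>\<^sub>M nu) snd) P =
       emeasure rel_product0 (({0..1} \<times> {0..1}) \<times> P)"
      using m P by (simp add: emeasure_distr)
    also have "\<dots> = (\<integral>\<^sup>+z. emeasure nu (Pair z -` P) * emeasure nu (Pair z -` ({0..1} \<times> {0..1})) \<partial>nu)"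
      by (subst emeasure_rel_product0_rectangle[OF J P]) (simp add: mult.commute)
    also have "\<dots> = emeasure rel_product0 (P \<times> ({0..1} \<times> {0..1}))"
      by (rule emeasure_rel_product0_rectangle[OF P J, symmetric])
    finally show "emeasure (distr rel_product0 (nu \<Otimes>\<^sub>M nu) snd) P = emeasure (nu \<Otimes>\<^sub>M nu) P"
      using P by (simp add: emeasure_rel_product0_fst)
  qed simp
  then have 2: "distr rel_product (nu \<Otimes>\<^sub>M nu) snd = nu \<Otimes>\<^sub>M nu"
    unfolding rel_product_def using distr_completion[OF m(2)] by simp
  have m': "fst \<in> rel_product \<rightarrow>\<^sub>M (nu \<Otimes>\<^sub>M nu)" "snd \<in> rel_product \<rightarrow>\<^sub>M (nu \<Otimes>\<^sub>M nu)"
    unfolding rel_product_def by (rule measurable_completion, rule m)+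
  show "fst \<in> rel_product \<rightarrow>\<^sub>M mu" "distr rel_product mu fst = mu"
    "snd \<in> rel_product \<rightarrow>\<^sub>M mu" "distr rel_product mu snd = mu"
    using measure_preserving_completion[OF m'(1) 1] measure_preserving_completion[OF m'(2) 2]
    unfolding mu_def by simp_all
qed

lemma AE_rel_fst: "AE x in mu. P x \<Longrightarrow> AE p in rel_product. P (fst p)"
  by (rule AE_distrD[OF fst_rel(1)]) (simp only: fst_rel(2))

lemma AE_rel_snd: "AE x in mu. P x \<Longrightarrow> AE p in rel_product. P (snd p)"
  by (rule AE_distrD[OF snd_rel(1)]) (simp only: snd_rel(2))

lemma space_rel_product: "space rel_product = ({0..1} \<times> {0..1}) \<times> ({0..1} \<times> {0..1})"
  by (simp add: rel_product_def space_rel_product0)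

lemma rel_product_times:
  assumes "P \<in> sets mu" "Q \<in> sets mu" shows "P \<times> Q \<in> sets rel_product"
proof -
  have "P \<times> Q = (fst -` P \<inter> space rel_product) \<inter> (snd -` Q \<inter> space rel_product)"
    using sets.sets_into_space[OF assms(1)] sets.sets_into_space[OF assms(2)]
    by (auto simp: space_mu space_rel_product)
  then show ?thesis using measurable_sets[OF fst_rel(1) assms(1)] measurable_sets[OF snd_rel(1) assms(2)] by simp
qed

lemma emeasure_rel_product:
  assumes "P \<in> sets (nu \<Otimes>\<^sub>M nu)" "Q \<in> sets (nu \<Otimes>\<^sub>M nu)"
  shows "emeasure rel_product (P \<times> Q) = (\<integral>\<^sup>+z. emeasure nu (Pair z -` P) * emeasure nu (Pair z -` Q) \<partial>nu)"
proof -
  have "P \<times> Q \<in> sets rel_product0" using assms by (simp add: sets_rel_product0)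
  then show ?thesis unfolding rel_product_def using emeasure_rel_product0_rectangle[OF assms] by simp
qed

lemma prob_space_rel_product: "prob_space rel_product"
proof (rule prob_spaceI)
  have "space rel_product = fst -` space mu \<inter> space rel_product"
    by (auto simp: space_rel_product space_mu)
  then have "emeasure rel_product (space rel_product) = emeasure (distr rel_product mu fst) (space mu)"
    using fst_rel(1) by (simp add: emeasure_distr)
  then show "emeasure rel_product (space rel_product) = 1"
    using prob_space.emeasure_space_1[OF prob_space_mu] by (simp add: fst_rel(2))
qed

lemma rectangle_measure_eqI:
  assumes fin: "finite_measure m1" and s1: "sets m1 = sets (N1 \<Otimes>\<^sub>M N2)" and s2: "sets m2 = sets (N1 \<Otimes>\<^sub>M N2)"
    and eq: "\<And>a b. a \<in> sets N1 \<Longrightarrow> b \<in> sets N2 \<Longrightarrow> emeasure m1 (a \<times> b) = emeasure m2 (a \<times> b)"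
  shows "m1 = m2"
proof (rule measure_eqI_generator_eq[OF Int_stable_pair_measure_generator[of N1 N2], where A = "\<lambda>_. space N1 \<times> space N2"])
  let ?E = "{a \<times> b | a b. a \<in> sets N1 \<and> b \<in> sets N2}"
  show "?E \<subseteq> Pow (space N1 \<times> space N2)" using sets.sets_into_space[of _ N1] sets.sets_into_space[of _ N2] by blast
  show "sets m1 = sigma_sets (space N1 \<times> space N2) ?E" "sets m2 = sigma_sets (space N1 \<times> space N2) ?E"
    using s1 s2 by (simp_all add: sets_pair_measure)
  show "emeasure m1 X = emeasure m2 X" if "X \<in> ?E" for X using that eq by auto
  show "emeasure m1 (space N1 \<times> space N2) \<noteq> \<infinity>"
    using finite_measure.emeasure_finite[OF fin] by simp
qed auto

text \<open>Rectangles generate the product and are stable under intersection, so the fibrewise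
  product formula characterises the relative product. It serves both for the invariance under
  \<open>T \<times> T\<close> and for the description by three coordinates.\<close>

lemma rel_product0_eqI:
  assumes s: "sets N = sets rel_product0"
    and e: "\<And>P Q. P \<in> sets (nu \<Otimes>\<^sub>M nu) \<Longrightarrow> Q \<in> sets (nu \<Otimes>\<^sub>M nu) \<Longrightarrow>
      emeasure N (P \<times> Q) = (\<integral>\<^sup>+z. emeasure nu (Pair z -` P) * emeasure nu (Pair z -` Q) \<partial>nu)"
  shows "N = rel_product0"
proof (rule rectangle_measure_eqI[symmetric])
  have "emeasure rel_product0 (space rel_product0) = emeasure rel_product (space rel_product0)"
    by (simp add: rel_product_def)
  then show "finite_measure rel_product0"
    using finite_measure.emeasure_finite[OF prob_space.finite_measure[OF prob_space_rel_product]]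
    by (intro finite_measureI) simp
  show "emeasure rel_product0 (P \<times> Q) = emeasure N (P \<times> Q)"
    if "P \<in> sets (nu \<Otimes>\<^sub>M nu)" "Q \<in> sets (nu \<Otimes>\<^sub>M nu)" for P Q
    unfolding e[OF that] by (rule emeasure_rel_product0_rectangle[OF that])
qed (simp_all add: s sets_rel_product0)

text \<open>Sections of a set of the completed product need not all be measurable; a product
  measurable version makes the fibre measures available.\<close>

lemma mu_set_nn_AE:
  assumes "P \<in> sets mu"
  obtains P' where "P' \<in> sets (nu \<Otimes>\<^sub>M nu)" "AE x in mu. x \<in> P \<longleftrightarrow> x \<in> P'"
proof -
  have P: "P \<in> sets (completion (nu \<Otimes>\<^sub>M nu))" using assms by (simp add: mu_def)
  have "AE x in mu. x \<in> P \<longleftrightarrow> x \<in> main_part (nu \<Otimes>\<^sub>M nu) P"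
    using AE_completion[OF AE_notin_null_part[OF P]] unfolding mu_def
    by eventually_elim (use main_part_null_part_Un[OF P] in blast)
  then show thesis using that main_part_sets[OF P] by blast
qed

section \<open>Extensions as maps commuting almost everywhere with the base map\<close>

text \<open>The pointwise form of membership in \<open>extensions\<close> for representatives; the
  equivalence is \<open>extensions_iff\<close>. Equality is asked only almost everywhere, so the
  notion passes to other representatives of both classes.\<close>

definition extends :: "(real \<times> real \<Rightarrow> real \<times> real) \<Rightarrow> (real \<Rightarrow> real) \<Rightarrow> bool" where
  "extends T T0 \<longleftrightarrow> T \<in> mp_bijections mu \<and> T0 \<in> mp_bijections nu \<and> (AE x in mu. fst (T x) = T0 (fst x))"

lemma extends_inv:
  assumes "extends T T0" shows "extends (mp_inv mu T) (mp_inv nu T0)"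
proof -
  have T: "T \<in> mp_bijections mu" and T0: "T0 \<in> mp_bijections nu" and ae: "AE x in mu. fst (T x) = T0 (fst x)"
    using assms by (auto simp: extends_def)
  have "AE x in mu. fst (mp_inv mu T x) = mp_inv nu T0 (fst x)"
    using mp_AE[OF mp_inv_mp[OF T] ae] AE_space
  proof eventually_elim
    case (elim x)
    have "mp_inv mu T x \<in> space mu" by (rule mp_inv_space[OF T elim(2)])
    then have "fst (mp_inv mu T x) \<in> space nu" by (auto simp: space_mu space_nu)
    then show ?case using elim mp_inv_left[OF T0] mp_inv_right[OF T elim(2)] by metis
  qed
  then show ?thesis using mp_inv_mp[OF T] mp_inv_mp[OF T0] by (simp add: extends_def)
qed

lemma extends_comp:
  assumes "extends S S0" "extends T T0" shows "extends (\<lambda>x. S (T x)) (\<lambda>z. S0 (T0 z))"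
proof -
  have "AE x in mu. fst (S (T x)) = S0 (T0 (fst x))"
    using mp_AE[of T mu "\<lambda>x. fst (S x) = S0 (fst x)"] assms unfolding extends_def
    by (auto elim: eventually_elim2)
  then show ?thesis using assms by (auto simp: extends_def mp_comp)
qed

text \<open>The functions \<open>z \<mapsto> nu (P\<^sub>z)\<close> are densities, which determines how they transform.\<close>

lemma extends_section:
  assumes ext: "extends T T0" and P: "P \<in> sets (nu \<Otimes>\<^sub>M nu)" and R: "R \<in> sets (nu \<Otimes>\<^sub>M nu)"
    and ae: "AE x in mu. T x \<in> P \<longleftrightarrow> x \<in> R"
  shows "AE z in nu. emeasure nu (Pair z -` R) = emeasure nu (Pair (T0 z) -` P)"
proof -
  let ?I = "{0..1::real}"
  have T: "T \<in> mp_bijections mu" and T0: "T0 \<in> mp_bijections nu" and fe: "AE x in mu. fst (T x) = T0 (fst x)"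
    using ext by (auto simp: extends_def)
  note [measurable] = mp_measurable[OF T0] nu.measurable_emeasure_Pair[OF P] nu.measurable_emeasure_Pair[OF R]
  have I: "?I \<in> sets nu" using sets.top[of nu] by (simp add: space_nu)
  have sec: "(\<integral>\<^sup>+z. emeasure nu (Pair z -` P) * indicator A z \<partial>nu) = emeasure mu (P \<inter> A \<times> ?I)"
    if P: "P \<in> sets (nu \<Otimes>\<^sub>M nu)" and A: "A \<in> sets nu" for P A
  proof -
    have m: "P \<inter> A \<times> ?I \<in> sets (nu \<Otimes>\<^sub>M nu)" using P A I by auto
    have "emeasure mu (P \<inter> A \<times> ?I) = (\<integral>\<^sup>+z. emeasure nu (Pair z -` (P \<inter> A \<times> ?I)) \<partial>nu)"
      unfolding emeasure_mu_nn[OF m] by (rule nu.emeasure_pair_measure_alt[OF m])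
    also have "\<dots> = (\<integral>\<^sup>+z. emeasure nu (Pair z -` P) * indicator A z \<partial>nu)"
    proof (rule nn_integral_cong)
      fix z
      have "Pair z -` (P \<inter> A \<times> ?I) = (if z \<in> A then Pair z -` P else {})"
        using sets.sets_into_space[OF P] by (auto simp: space_pair_measure space_nu)
      then show "emeasure nu (Pair z -` (P \<inter> A \<times> ?I)) = emeasure nu (Pair z -` P) * indicator A z"
        by (simp add: indicator_def)
    qed
    finally show ?thesis by simp
  qed
  show ?thesis
  proof (rule nu.density_unique2)
    fix A assume A[measurable]: "A \<in> sets nu"
    \<comment> \<open>This is the image of \<open>A\<close> under \<open>T0\<close>. Up to null
      sets, \<open>T\<close> carries the part of \<open>R\<close> over \<open>A\<close> to the part
      of \<open>P\<close> over \<open>?A'\<close>, so the two integrals over \<open>A\<close>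
      agree.\<close>
    let ?A' = "mp_inv nu T0 -` A \<inter> space nu"
    have A'[measurable]: "?A' \<in> sets nu" using mp_inv_measurable[OF T0] A by (rule measurable_sets)
    have A_iff: "T0 z \<in> ?A' \<longleftrightarrow> z \<in> A" if "z \<in> space nu" for z
      using that mp_inv_left[OF T0 that] mp_space[OF T0 that] by simp
    have mP: "P \<inter> ?A' \<times> ?I \<in> sets mu" and mR: "R \<inter> A \<times> ?I \<in> sets mu"
      using P R A A' I by (auto intro!: sets_nn_subset_mu[THEN subsetD])
    have "(\<integral>\<^sup>+z\<in>A. emeasure nu (Pair z -` R) \<partial>nu) = emeasure mu (R \<inter> A \<times> ?I)"
      by (rule sec[OF R A])
    also have "\<dots> = emeasure mu (T -` (P \<inter> ?A' \<times> ?I) \<inter> space mu)"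
    proof (rule emeasure_eq_AE[OF _ mR measurable_sets[OF mp_measurable[OF T] mP]])
      show "AE x in mu. x \<in> R \<inter> A \<times> ?I \<longleftrightarrow> x \<in> T -` (P \<inter> ?A' \<times> ?I) \<inter> space mu"
        using ae fe AE_space
      proof eventually_elim
        case (elim x)
        then have x: "fst x \<in> space nu" "snd x \<in> ?I" "snd (T x) \<in> ?I"
          using mp_space[OF T elim(3)] by (auto simp: space_mu space_nu)
        have "x \<in> R \<inter> A \<times> ?I \<longleftrightarrow> x \<in> R \<and> fst x \<in> A" using x by (cases x) auto
        also have "\<dots> \<longleftrightarrow> T x \<in> P \<and> fst (T x) \<in> ?A'" using elim A_iff[OF x(1)] by simp
        also have "\<dots> \<longleftrightarrow> x \<in> T -` (P \<inter> ?A' \<times> ?I) \<inter> space mu"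
          using x elim(3) by (cases "T x") auto
        finally show ?case .
      qed
    qed
    also have "\<dots> = emeasure mu (P \<inter> ?A' \<times> ?I)" by (rule mp_emeasure_vimage[OF T mP])
    also have "\<dots> = (\<integral>\<^sup>+z. emeasure nu (Pair z -` P) * indicator ?A' z \<partial>nu)"
      by (rule sec[OF P A', symmetric])
    also have "\<dots> = (\<integral>\<^sup>+z. emeasure nu (Pair z -` P) * indicator ?A' z \<partial>(distr nu nu T0))"
      by (simp only: mp_distr[OF T0])
    also have "\<dots> = (\<integral>\<^sup>+z. emeasure nu (Pair (T0 z) -` P) * indicator ?A' (T0 z) \<partial>nu)"
      by (rule nn_integral_distr) measurable
    also have "\<dots> = (\<integral>\<^sup>+z\<in>A. emeasure nu (Pair (T0 z) -` P) \<partial>nu)"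
      by (rule nn_integral_cong) (simp only: indicator_def A_iff)
    finally show "(\<integral>\<^sup>+z\<in>A. emeasure nu (Pair z -` R) \<partial>nu) = (\<integral>\<^sup>+z\<in>A. emeasure nu (Pair (T0 z) -` P) \<partial>nu)" .
  qed measurable
qed

text \<open>Preimages of product sets under \<open>T\<close> are replaced by product measurable
  sets, whose fibre measures at \<open>z\<close> are those of the original sets at
  \<open>T0 z\<close> by \<open>extends_section\<close>. The rectangle formula is then invariant
  because \<open>T0\<close> preserves \<open>nu\<close>.\<close>

lemma extends_map_prod:
  assumes ext: "extends T T0"
  shows "map_prod T T \<in> rel_product \<rightarrow>\<^sub>M rel_product" "distr rel_product rel_product (map_prod T T) = rel_product"
proof -
  interpret complete_measure rel_product by (rule complete_rel_product)
  let ?nn = "nu \<Otimes>\<^sub>M nu"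
  have T: "T \<in> mp_bijections mu" and T0: "T0 \<in> mp_bijections nu"
    using ext by (auto simp: extends_def)
  have "(\<lambda>p. (T (fst p), T (snd p))) \<in> rel_product \<rightarrow>\<^sub>M ?nn \<Otimes>\<^sub>M ?nn"
    using measurable_mu_imp_nn[OF measurable_compose[OF fst_rel(1) mp_measurable[OF T]]]
      measurable_mu_imp_nn[OF measurable_compose[OF snd_rel(1) mp_measurable[OF T]]]
    by (rule measurable_Pair)
  moreover have "(\<lambda>p. (T (fst p), T (snd p))) = map_prod T T" by (auto simp: fun_eq_iff)
  ultimately have m: "map_prod T T \<in> rel_product \<rightarrow>\<^sub>M rel_product0"
    by (simp add: measurable_cong_sets[OF refl sets_rel_product0])
  have "distr rel_product rel_product0 (map_prod T T) = rel_product0"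
  proof (rule rel_product0_eqI)
    fix P Q assume P: "P \<in> sets ?nn" and Q: "Q \<in> sets ?nn"
    have "\<exists>R. R \<in> sets ?nn \<and> (AE x in mu. T x \<in> P \<longleftrightarrow> x \<in> R)" if P: "P \<in> sets ?nn" for P
    proof -
      have "T -` P \<inter> space mu \<in> sets mu" using mp_measurable[OF T] P sets_nn_subset_mu by (auto intro: measurable_sets)
      then obtain R where R: "R \<in> sets ?nn" "AE x in mu. x \<in> T -` P \<inter> space mu \<longleftrightarrow> x \<in> R"
        by (rule mu_set_nn_AE)
      have "AE x in mu. T x \<in> P \<longleftrightarrow> x \<in> R" using R(2) AE_space by eventually_elim auto
      with R(1) show ?thesis by blast
    qed
    note ex = this
    obtain R where R: "R \<in> sets ?nn" "AE x in mu. T x \<in> P \<longleftrightarrow> x \<in> R" using ex[OF P] by blast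
    obtain S where S: "S \<in> sets ?nn" "AE x in mu. T x \<in> Q \<longleftrightarrow> x \<in> S" using ex[OF Q] by blast
    have PQ: "P \<times> Q \<in> sets rel_product0" using P Q by (simp add: sets_rel_product0)
    have RS: "R \<times> S \<in> sets rel_product" using R(1) S(1) sets_nn_subset_mu by (intro rel_product_times) auto
    have "emeasure (distr rel_product rel_product0 (map_prod T T)) (P \<times> Q) =
       emeasure rel_product (map_prod T T -` (P \<times> Q) \<inter> space rel_product)"
      using m PQ by (rule emeasure_distr)
    also have "\<dots> = emeasure rel_product (R \<times> S)"
    proof (rule emeasure_eq_AE[OF _ measurable_sets[OF m PQ] RS])
      show "AE x in rel_product. x \<in> map_prod T T -` (P \<times> Q) \<inter> space rel_product \<longleftrightarrow> x \<in> R \<times> S"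
        using AE_rel_fst[OF R(2)] AE_rel_snd[OF S(2)] AE_space
        by eventually_elim (auto simp: mem_Times_iff)
    qed
    also have "\<dots> = (\<integral>\<^sup>+z. emeasure nu (Pair z -` R) * emeasure nu (Pair z -` S) \<partial>nu)"
      by (rule emeasure_rel_product[OF R(1) S(1)])
    also have "\<dots> = (\<integral>\<^sup>+z. emeasure nu (Pair (T0 z) -` P) * emeasure nu (Pair (T0 z) -` Q) \<partial>nu)"
      using extends_section[OF ext P R] extends_section[OF ext Q S]
      by (intro nn_integral_cong_AE) (auto elim: eventually_elim2)
    also have "\<dots> = (\<integral>\<^sup>+z. emeasure nu (Pair z -` P) * emeasure nu (Pair z -` Q) \<partial>(distr nu nu T0))"
      using nu.measurable_emeasure_Pair[OF P] nu.measurable_emeasure_Pair[OF Q]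
      by (intro nn_integral_distr[symmetric] mp_measurable[OF T0]) simp
    finally show "emeasure (distr rel_product rel_product0 (map_prod T T)) (P \<times> Q) =
       (\<integral>\<^sup>+z. emeasure nu (Pair z -` P) * emeasure nu (Pair z -` Q) \<partial>nu)"
      by (simp only: mp_distr[OF T0])
  qed simp
  from measure_preserving_completion[OF m this]
  show "map_prod T T \<in> rel_product \<rightarrow>\<^sub>M rel_product" "distr rel_product rel_product (map_prod T T) = rel_product"
    unfolding rel_product_def by simp_all
qed

lemma extends_map_prod_mp:
  assumes ext: "extends T T0"
  shows "map_prod T T \<in> mp_bijections rel_product"
proof (rule mp_bijectionsI[where T' = "map_prod (mp_inv mu T) (mp_inv mu T)"])
  have T: "T \<in> mp_bijections mu" using ext by (auto simp: extends_def)
  fix p assume p: "p \<in> space rel_product"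
  then have "fst p \<in> space mu" "snd p \<in> space mu" by (auto simp: space_rel_product space_mu)
  then show "map_prod (mp_inv mu T) (mp_inv mu T) (map_prod T T p) = p"
    "map_prod T T (map_prod (mp_inv mu T) (mp_inv mu T) p) = p"
    using mp_inv_left[OF T] mp_inv_right[OF T] by (simp_all add: prod_eq_iff)
qed (rule extends_map_prod[OF ext] extends_map_prod(1)[OF extends_inv[OF ext]])+

section \<open>Passing between classes of automorphisms and their representatives\<close>

lemma Aut_class:
  assumes "T \<in> mp_bijections M"
  shows "ae_eq M `` {T} \<in> Aut M" "T \<in> ae_eq M `` {T}"
  using assms quotientI[OF assms] equiv_class_self[OF equiv_ae_eq assms] by (auto simp: Aut_def)

lemma Aut_nonempty: "C \<in> Aut M \<Longrightarrow> \<exists>T. T \<in> C"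
  using in_quotient_imp_non_empty[OF equiv_ae_eq] unfolding Aut_def by blast

lemma Aut_AE:
  assumes "C \<in> Aut M" "S \<in> C" "T \<in> C" shows "AE x in M. S x = T x"
  using quotient_eq_iff[OF equiv_ae_eq assms(1)[unfolded Aut_def] assms(1)[unfolded Aut_def] assms(2,3)]
  by (simp add: ae_eq_def)

lemma extends_cong:
  assumes "extends T T0" "T' \<in> mp_bijections mu" "T0' \<in> mp_bijections nu"
    "AE x in mu. T' x = T x" "AE z in nu. T0' z = T0 z"
  shows "extends T' T0'"
proof -
  have "AE x in mu. fst (T x) = T0 (fst x)" using assms(1) by (simp add: extends_def)
  then have "AE x in mu. fst (T' x) = T0' (fst x)"
    using assms(4) AE_mu_fst[OF assms(5)] by eventually_elim simp
  then show ?thesis using assms(2,3) by (simp add: extends_def)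
qed

lemma image_strip:
  assumes T0: "T0 \<in> mp_bijections nu" and T: "T \<in> mp_bijections mu" and A: "A \<in> sets nu" and y: "y \<in> space mu"
  shows "y \<in> T ` (A \<times> {0..1}) \<longleftrightarrow> fst (mp_inv mu T y) \<in> A"
    "y \<in> (T0 ` A) \<times> {0..1} \<longleftrightarrow> mp_inv nu T0 (fst y) \<in> A"
proof -
  have As: "A \<subseteq> space nu" using A by (rule sets.sets_into_space)
  then have "A \<times> {0..1} \<subseteq> space mu" by (auto simp: space_mu space_nu)
  from mp_image_eq_vimage[OF T this] show "y \<in> T ` (A \<times> {0..1}) \<longleftrightarrow> fst (mp_inv mu T y) \<in> A"
    using y mp_inv_space[OF T y] by (auto simp: space_mu mem_Times_iff)
  show "y \<in> (T0 ` A) \<times> {0..1} \<longleftrightarrow> mp_inv nu T0 (fst y) \<in> A"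
    using y mp_image_eq_vimage[OF T0 As] by (auto simp: space_mu space_nu mem_Times_iff)
qed

lemma extends_imp_strip:
  assumes ext: "extends T T0" and A: "A \<in> sets nu"
  shows "sym_diff (T ` (A \<times> {0..1})) ((T0 ` A) \<times> {0..1}) \<in> null_sets mu"
proof -
  have T: "T \<in> mp_bijections mu" and T0: "T0 \<in> mp_bijections nu"
    using ext by (auto simp: extends_def)
  have s: "T ` (A \<times> {0..1}) \<in> sets mu" "(T0 ` A) \<times> {0..1} \<in> sets mu"
    by (rule mp_bijections_image(1)[OF T mu_strip(1)[OF A]] mu_strip(1)[OF mp_bijections_image(1)[OF T0 A]])+
  have "AE x in mu. fst (mp_inv mu T x) = mp_inv nu T0 (fst x)"
    using extends_inv[OF ext] by (simp add: extends_def)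
  then show ?thesis
    unfolding sym_diff_null_iff_AE[OF s] using AE_space
    by eventually_elim (simp add: image_strip[OF T0 T A])
qed

lemma measurable_nu_less: assumes "f \<in> nu \<rightarrow>\<^sub>M nu" shows "{z \<in> space nu. f z < (q::real)} \<in> sets nu"
proof -
  have "(\<lambda>x. x) \<in> borel_measurable nu" unfolding nu_def
    by (rule measurable_restrict_space1, rule measurable_completion) simp
  then have [measurable]: "f \<in> borel_measurable nu" using measurable_compose[OF assms] by blast
  show ?thesis by measurable
qed

text \<open>Membership in an image strip is a condition on the inverse maps, so the inverses are
  compared. Half-lines with rational end points are countably many and separate any two different
  base coordinates.\<close>

lemma strip_imp_extends:
  assumes T: "T \<in> mp_bijections mu" and T0: "T0 \<in> mp_bijections nu"
    and strip: "\<And>A. A \<in> sets nu \<Longrightarrow> sym_diff (T ` (A \<times> {0..1})) ((T0 ` A) \<times> {0..1}) \<in> null_sets mu"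
  shows "extends T T0"
proof -
  have "AE x in mu. fst (mp_inv mu T x) < of_rat q \<longleftrightarrow> mp_inv nu T0 (fst x) < of_rat q" for q :: rat
  proof -
    let ?A = "{z \<in> space nu. z < of_rat q}"
    have A: "?A \<in> sets nu" using measurable_nu_less[of "\<lambda>z. z"] by simp
    have s: "T ` (?A \<times> {0..1}) \<in> sets mu" "(T0 ` ?A) \<times> {0..1} \<in> sets mu"
      by (rule mp_bijections_image(1)[OF T mu_strip(1)[OF A]] mu_strip(1)[OF mp_bijections_image(1)[OF T0 A]])+
    have "AE x in mu. x \<in> T ` (?A \<times> {0..1}) \<longleftrightarrow> x \<in> (T0 ` ?A) \<times> {0..1}"
      using strip[OF A] unfolding sym_diff_null_iff_AE[OF s] .
    then show ?thesis using AE_space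
    proof eventually_elim
      case (elim x)
      have "fst x \<in> space nu" "fst (mp_inv mu T x) \<in> space nu"
        using elim(2) mp_inv_space[OF T elim(2)] by (auto simp: space_mu space_nu)
      then show ?case
        using elim mp_inv_space[OF T0, of "fst x"] by (simp add: image_strip[OF T0 T A elim(2)])
    qed
  qed
  then have "AE x in mu. \<forall>q. fst (mp_inv mu T x) < of_rat q \<longleftrightarrow> mp_inv nu T0 (fst x) < of_rat q"
    by (simp add: AE_all_countable)
  then have "AE x in mu. fst (mp_inv mu T x) = mp_inv nu T0 (fst x)"
  proof eventually_elim
    case (elim x)
    show ?case
    proof (rule ccontr)
      assume "fst (mp_inv mu T x) \<noteq> mp_inv nu T0 (fst x)"
      then obtain q where "(fst (mp_inv mu T x) < of_rat q \<and> of_rat q < mp_inv nu T0 (fst x)) \<or>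
         (mp_inv nu T0 (fst x) < of_rat q \<and> of_rat q < fst (mp_inv mu T x))"
        using of_rat_dense by (metis linorder_neqE_linordered_idom)
      then show False using elim by (metis less_asym)
    qed
  qed
  then have "AE x in mu. fst (mp_inv mu T (T x)) = mp_inv nu T0 (fst (T x))" by (rule mp_AE[OF T])
  then have "AE x in mu. fst (T x) = T0 (fst x)" using AE_space
  proof eventually_elim
    case (elim x)
    have "fst (T x) \<in> space nu" using mp_space[OF T elim(2)] by (auto simp: space_mu space_nu)
    then show ?case using elim(1) mp_inv_left[OF T elim(2)] mp_inv_right[OF T0] by metis
  qed
  then show ?thesis using T T0 by (simp add: extends_def)
qed

lemma extensions_iff:
  assumes "C0 \<in> Aut nu" "T0 \<in> C0" "C \<in> Aut mu" "T \<in> C"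
  shows "C \<in> extensions C0 \<longleftrightarrow> extends T T0"
proof
  assume "C \<in> extensions C0"
  then show "extends T T0"
    using assms Aut_rep[OF assms(1,2)] Aut_rep[OF assms(3,4)]
    by (intro strip_imp_extends) (auto simp: extensions_def)
next
  assume e: "extends T T0"
  have "extends T' T0'" if "T' \<in> C" "T0' \<in> C0" for T' T0'
    using e Aut_rep[OF assms(3) that(1)] Aut_rep[OF assms(1) that(2)]
      Aut_AE[OF assms(3) that(1) assms(4)] Aut_AE[OF assms(1) that(2) assms(2)]
    by (rule extends_cong)
  then show "C \<in> extensions C0"
    unfolding extensions_def using extends_imp_strip assms(3) by simp
qed

section \<open>Relative weak mixing of a single map\<close>

text \<open>Ergodicity relative to the base in almost everywhere form; measure preservation is
  supplied by \<open>extends_map_prod\<close>. In this form it visibly depends only on the class of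
  the map.\<close>

definition rel_weak_mixing :: "(real \<times> real \<Rightarrow> real \<times> real) \<Rightarrow> bool" where
  "rel_weak_mixing T \<longleftrightarrow> (\<forall>E\<in>sets rel_product. (AE p in rel_product. map_prod T T p \<in> E \<longleftrightarrow> p \<in> E) \<longrightarrow>
     (\<exists>b\<in>sets nu. AE p in rel_product. p \<in> E \<longleftrightarrow> fst (fst p) \<in> b))"

lemma base_set_AE:
  assumes E: "E \<in> sets rel_product"
  shows "(\<exists>B\<in>base_sets. sym_diff E B \<in> null_sets rel_product) \<longleftrightarrow>
     (\<exists>b\<in>sets nu. AE p in rel_product. p \<in> E \<longleftrightarrow> fst (fst p) \<in> b)"
proof -
  have "sym_diff E {p \<in> space rel_product. fst (fst p) \<in> b} \<in> null_sets rel_product \<longleftrightarrow>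
     (AE p in rel_product. p \<in> E \<longleftrightarrow> fst (fst p) \<in> b)" if "b \<in> sets nu" for b
    unfolding sym_diff_null_iff_AE[OF E base_set_null_iff(2)[OF that]] by (rule AE_cong) auto
  then show ?thesis unfolding base_sets_def by blast
qed

lemma rel_weak_mixing_cong:
  assumes "AE x in mu. S x = T x" shows "rel_weak_mixing S \<longleftrightarrow> rel_weak_mixing T"
proof -
  have eq: "AE p in rel_product. map_prod S S p = map_prod T T p"
    using AE_rel_fst[OF assms] AE_rel_snd[OF assms] by eventually_elim (simp add: prod_eq_iff)
  have "(AE p in rel_product. map_prod S S p \<in> E \<longleftrightarrow> p \<in> E) \<longleftrightarrow>
      (AE p in rel_product. map_prod T T p \<in> E \<longleftrightarrow> p \<in> E)" for E
  proof
    assume "AE p in rel_product. map_prod S S p \<in> E \<longleftrightarrow> p \<in> E"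
    with eq show "AE p in rel_product. map_prod T T p \<in> E \<longleftrightarrow> p \<in> E" by eventually_elim simp
  next
    assume "AE p in rel_product. map_prod T T p \<in> E \<longleftrightarrow> p \<in> E"
    with eq show "AE p in rel_product. map_prod S S p \<in> E \<longleftrightarrow> p \<in> E" by eventually_elim simp
  qed
  then show ?thesis unfolding rel_weak_mixing_def by simp
qed

lemma relative_W_iff:
  assumes "C0 \<in> Aut nu" "T0 \<in> C0" "C \<in> extensions C0" "T \<in> C"
  shows "C \<in> relative_W C0 \<longleftrightarrow> rel_weak_mixing T"
proof -
  have C: "C \<in> Aut mu" using assms(3) by (simp add: extensions_def)
  have "ergodic_relative rel_product base_sets (map_prod T T) \<longleftrightarrow> rel_weak_mixing T" if "T \<in> C" for T
  proof -
    have "extends T T0" using extensions_iff[OF assms(1,2) C that] assms(3) by simp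
    note mp = extends_map_prod[OF this]
    have inv: "E \<in> invariant_sets rel_product (map_prod T T) \<longleftrightarrow>
        E \<in> sets rel_product \<and> (AE p in rel_product. map_prod T T p \<in> E \<longleftrightarrow> p \<in> E)" for E
      using invariant_sets_iff_AE[OF mp(1), of E] by (auto simp: invariant_sets_def)
    show ?thesis
    proof
      assume e: "ergodic_relative rel_product base_sets (map_prod T T)"
      show "rel_weak_mixing T"
        unfolding rel_weak_mixing_def
      proof (intro ballI impI)
        fix E assume E: "E \<in> sets rel_product" "AE p in rel_product. map_prod T T p \<in> E \<longleftrightarrow> p \<in> E"
        then have "\<exists>B\<in>base_sets. sym_diff E B \<in> null_sets rel_product"
          using e inv[of E] by (simp add: ergodic_relative_def)
        then show "\<exists>b\<in>sets nu. AE p in rel_product. p \<in> E \<longleftrightarrow> fst (fst p) \<in> b"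
          unfolding base_set_AE[OF E(1)] .
      qed
    next
      assume w: "rel_weak_mixing T"
      show "ergodic_relative rel_product base_sets (map_prod T T)"
        unfolding ergodic_relative_def measure_preserving_def
      proof (intro conjI ballI mp)
        fix E assume "E \<in> invariant_sets rel_product (map_prod T T)"
        then have E: "E \<in> sets rel_product" "AE p in rel_product. map_prod T T p \<in> E \<longleftrightarrow> p \<in> E"
          using inv by auto
        then show "\<exists>B\<in>base_sets. sym_diff E B \<in> null_sets rel_product"
          unfolding base_set_AE[OF E(1)] using w by (simp add: rel_weak_mixing_def)
      qed
    qed
  qed
  moreover have "rel_weak_mixing T' \<longleftrightarrow> rel_weak_mixing T" if "T' \<in> C" for T'
    by (rule rel_weak_mixing_cong[OF Aut_AE[OF C that assms(4)]])
  ultimately show ?thesis using assms(3,4) unfolding relative_W_def by blast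
qed

lemma extends_id_inv:
  assumes "extends R (\<lambda>z. z)" shows "extends (mp_inv mu R) (\<lambda>z. z)"
proof -
  have R: "R \<in> mp_bijections mu" and id: "(\<lambda>z. z) \<in> mp_bijections nu" and ae: "AE x in mu. fst (R x) = fst x"
    using assms by (auto simp: extends_def)
  have "AE x in mu. fst (R (mp_inv mu R x)) = fst (mp_inv mu R x)" by (rule mp_AE[OF mp_inv_mp[OF R] ae])
  then have "AE x in mu. fst (mp_inv mu R x) = fst x" using AE_space
    by eventually_elim (simp add: mp_inv_right[OF R])
  then show ?thesis using mp_inv_mp[OF R] id by (simp add: extends_def)
qed

text \<open>\<open>R \<times> R\<close> pulls an invariant set of the conjugate back to one of
  \<open>S \<times> S\<close>, and since \<open>R\<close> fixes the first coordinate almost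
  everywhere it does not move sets of the base.\<close>

lemma rel_weak_mixing_conj:
  assumes R: "extends R (\<lambda>z. z)" and S: "extends S S0" and wm: "rel_weak_mixing S"
  shows "rel_weak_mixing (\<lambda>x. R (S (mp_inv mu R x)))"
  unfolding rel_weak_mixing_def
proof (intro ballI impI)
  let ?R' = "mp_inv mu R"
  let ?T = "\<lambda>x. R (S (?R' x))"
  let ?r = "map_prod R R" and ?r' = "map_prod ?R' ?R'"
  have Rm: "R \<in> mp_bijections mu" and Sm: "S \<in> mp_bijections mu" using R S by (auto simp: extends_def)
  note r = extends_map_prod_mp[OF R] and r' = extends_map_prod_mp[OF extends_id_inv[OF R]]
  note s = extends_map_prod_mp[OF S]
  fix E assume E: "E \<in> sets rel_product" and inv: "AE p in rel_product. map_prod ?T ?T p \<in> E \<longleftrightarrow> p \<in> E"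
  let ?E = "?r -` E \<inter> space rel_product"
  have E': "?E \<in> sets rel_product" by (rule measurable_sets[OF mp_measurable[OF r] E])
  have "AE p in rel_product. map_prod S S p \<in> ?E \<longleftrightarrow> p \<in> ?E"
    using mp_AE[OF r inv] AE_space
  proof eventually_elim
    case (elim p)
    then have "fst p \<in> space mu" "snd p \<in> space mu" by (auto simp: space_rel_product space_mu)
    from this[THEN mp_inv_left[OF Rm]] have "map_prod ?T ?T (?r p) = ?r (map_prod S S p)"
      by (cases p) simp
    then show ?case using elim mp_space[OF s elim(2)] by simp
  qed
  then obtain b where b: "b \<in> sets nu" "AE p in rel_product. p \<in> ?E \<longleftrightarrow> fst (fst p) \<in> b"
    using wm E' unfolding rel_weak_mixing_def by blast
  have "AE x in mu. fst (?R' x) = fst x" using extends_id_inv[OF R] by (simp add: extends_def)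
  from mp_AE[OF r' b(2)] AE_rel_fst[OF this] AE_space
  have "AE p in rel_product. p \<in> E \<longleftrightarrow> fst (fst p) \<in> b"
  proof eventually_elim
    case (elim p)
    then have "fst p \<in> space mu" "snd p \<in> space mu" by (auto simp: space_rel_product space_mu)
    from this[THEN mp_inv_right[OF Rm]] have "?r (?r' p) = p" by (cases p) simp
    then show ?case using elim mp_space[OF r' elim(3)] by simp
  qed
  then show "\<exists>b\<in>sets nu. AE p in rel_product. p \<in> E \<longleftrightarrow> fst (fst p) \<in> b" using b(1) by blast
qed

lemma extends_pow: "extends T T0 \<Longrightarrow> extends (T ^^ n) (T0 ^^ n)"
proof (induction n)
  case 0
  have "extends (\<lambda>x. x) (\<lambda>z. z)" by (simp add: extends_def mp_id)
  then show ?case by (simp add: id_def)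
next
  case (Suc n) then show ?case using extends_comp[of T T0 "T ^^ n" "T0 ^^ n"] by (simp add: comp_def)
qed

section \<open>Density\<close>

text \<open>Any two extensions of an aperiodic transformation are almost conjugate by an automorphism
  over the identity: on the \<open>i\<close>-th level of a Rokhlin tower of the base conjugate by
  \<open>T\<^sup>i S\<^sup>-\<^sup>i\<close>.\<close>

lemma almost_conjugate:
  assumes T: "extends T T0" and S: "extends S T0"
    and ap: "{x \<in> space nu. \<exists>n>0. (T0 ^^ n) x = x} \<in> null_sets nu" and e: "e > 0"
  obtains R D where "extends R (\<lambda>z. z)" "D \<in> sets mu" "measure mu D < e"
    "\<And>x. x \<in> space mu - D \<Longrightarrow> R (S (mp_inv mu R x)) = T x"
proof -
  interpret mu: prob_space mu by (rule prob_space_mu)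
  let ?S' = "mp_inv mu S" and ?T0' = "mp_inv nu T0"
  have Tm: "T \<in> mp_bijections mu" and Sm: "S \<in> mp_bijections mu" and T0: "T0 \<in> mp_bijections nu"
    and Sae: "AE x in mu. fst (S x) = T0 (fst x)"
    using T S by (auto simp: extends_def)
  \<comment> \<open>Half of \<open>e\<close> is reserved for the top level, of measure at most
    \<open>1 / N\<close>, and half for the part outside the tower.\<close>
  obtain N where N: "2 / e < real N" using reals_Archimedean2 by blast
  have "0 < 2 / e" using e by simp
  with N have N0: "N > 0" by (cases N) auto
  have N1: "1 / real N < e / 2" using N N0 e by (simp add: field_simps)
  obtain B where B: "B \<in> sets nu" and disj: "disjoint_family_on (\<lambda>i. (T0 ^^ i) ` B) {..<N}"
    and rest: "measure nu (space nu - (\<Union>i<N. (T0 ^^ i) ` B)) < e / 2"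
    using rokhlin_tower[OF T0 ap N0, of "e / 2"] e by auto
  have Bi: "(T0 ^^ i) ` B \<in> sets nu" and mBi: "measure nu ((T0 ^^ i) ` B) = measure nu B" for i
    using mp_bijections_image[OF mp_pow[OF T0] B] by (auto simp: measure_def)
  have "(\<Sum>i<N. measure nu ((T0 ^^ i) ` B)) = measure nu (\<Union>i<N. (T0 ^^ i) ` B)"
    using Bi disj by (intro nu.finite_measure_finite_Union[symmetric]) auto
  also have "\<dots> \<le> 1" by (rule nu.prob_le_1)
  finally have mB: "measure nu B \<le> 1 / real N" using N0 by (simp add: mBi field_simps)
  define E where "E i = ((T0 ^^ i) ` B) \<times> {0..1::real}" for i
  have Em: "E i \<in> sets mu" for i unfolding E_def by (rule mu_strip(1)[OF Bi])
  have E_iff: "x \<in> E i \<longleftrightarrow> fst x \<in> (T0 ^^ i) ` B" if "x \<in> space mu" for x i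
    using that unfolding E_def by (cases x) (auto simp: space_mu)
  \<comment> \<open>The base parts of the two powers cancel, so every \<open>Q i\<close> preserves
    fibres and leaves the strips invariant up to null sets, as \<open>mp_glue\<close>
    requires.\<close>
  define Q where "Q i = (\<lambda>x. (T ^^ i) ((?S' ^^ i) x))" for i
  have Qm: "Q i \<in> mp_bijections mu" for i
    unfolding Q_def by (rule mp_comp[OF mp_pow[OF Tm] mp_pow[OF mp_inv_mp[OF Sm]]])
  have Qf: "AE x in mu. fst (Q i x) = fst x" for i
  proof -
    have "extends (Q i) (\<lambda>z. (T0 ^^ i) ((?T0' ^^ i) z))"
      unfolding Q_def by (rule extends_comp[OF extends_pow[OF T] extends_pow[OF extends_inv[OF S]]])
    then have "AE x in mu. fst (Q i x) = (T0 ^^ i) ((?T0' ^^ i) (fst x))" by (simp add: extends_def)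
    then show ?thesis using AE_space
    proof eventually_elim
      case (elim x)
      then have "fst x \<in> space nu" by (auto simp: space_mu space_nu)
      then show ?case using elim mp_pow_inv_right[OF T0] by simp
    qed
  qed
  have Qinv: "AE x in mu. Q i x \<in> E i \<longleftrightarrow> x \<in> E i" for i
    using Qf[of i] AE_space by eventually_elim (simp add: E_iff mp_space[OF Qm])
  have dE: "disjoint_family_on E {..<N}"
    using disj unfolding disjoint_family_on_def E_def by blast
  obtain R where Rm: "R \<in> mp_bijections mu" and RQ: "AE x in mu. \<forall>i<N. x \<in> E i \<longrightarrow> R x = Q i x"
    and Rid: "\<And>x. (\<forall>i<N. x \<notin> E i) \<Longrightarrow> R x = x"
    by (rule mp_glue[of N Q mu E, OF Qm Em dE Qinv]) (rule that)
  have "AE x in mu. \<forall>i. fst (Q i x) = fst x" using Qf by (simp add: AE_all_countable)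
  then have "AE x in mu. fst (R x) = fst x" using RQ
  proof eventually_elim
    case (elim x)
    show ?case
    proof (cases "\<exists>i<N. x \<in> E i")
      case True
      then obtain i where "i < N" "x \<in> E i" by blast
      then show ?thesis using elim by simp
    next
      case False
      then show ?thesis using Rid[of x] by simp
    qed
  qed
  then have R: "extends R (\<lambda>z. z)" using Rm by (simp add: extends_def mp_id)
  let ?R' = "mp_inv mu R"
  have R'f: "AE x in mu. fst (?R' x) = fst x" using extends_id_inv[OF R] by (simp add: extends_def)
  \<comment> \<open>The top level is discarded together with the uncovered part: above it there is
    no further level on which \<open>R\<close> is prescribed.\<close>
  define L where "L = (space nu - (\<Union>i<N. (T0 ^^ i) ` B)) \<union> (T0 ^^ (N - 1)) ` B"
  have L: "L \<in> sets nu" unfolding L_def using Bi by auto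
  have mL: "measure nu L < e"
  proof -
    have "measure nu L \<le> measure nu (space nu - (\<Union>i<N. (T0 ^^ i) ` B)) + measure nu ((T0 ^^ (N - 1)) ` B)"
      unfolding L_def using Bi by (intro measure_Un_le) auto
    then show ?thesis using rest mBi[of "N - 1"] mB N1 by simp
  qed
  have good: "AE x in mu. fst x \<notin> L \<longrightarrow> R (S (?R' x)) = T x"
    using mp_AE[OF mp_inv_mp[OF Rm] RQ] mp_AE[OF mp_inv_mp[OF Rm] mp_AE[OF Sm RQ]]
      mp_AE[OF mp_inv_mp[OF Rm] Sae] R'f AE_space
  proof eventually_elim
    case (elim x)
    define y where "y = ?R' x"
    have y: "y \<in> space mu" unfolding y_def by (rule mp_inv_space[OF Rm elim(5)])
    have Ry: "R y = x" unfolding y_def by (rule mp_inv_right[OF Rm elim(5)])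
    show ?case
    proof
      assume "fst x \<notin> L"
      moreover have "fst x \<in> space nu" using elim(5) by (auto simp: space_mu space_nu)
      ultimately obtain i where i: "i < N" "fst x \<in> (T0 ^^ i) ` B" "i \<noteq> N - 1" unfolding L_def by blast
      then have iN: "Suc i < N" by auto
      have fy: "fst y = fst x" using elim(4) unfolding y_def .
      have "y \<in> E i" using i E_iff[OF y] fy by simp
      then have x: "x = Q i y" using elim(1) i(1) Ry unfolding y_def by metis
      have "fst (S y) = T0 (fst y)" using elim(3) unfolding y_def .
      then have "fst (S y) \<in> (T0 ^^ Suc i) ` B" using i(2) fy by auto
      then have "S y \<in> E (Suc i)" using E_iff[OF mp_space[OF Sm y]] by simp
      \<comment> \<open>With \<open>x = Q i y\<close> and \<open>S y\<close> on level
        \<open>i + 1\<close>, one factor \<open>S\<close> cancels: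
        \<open>T^(i+1) S^-(i+1) S y = T (Q i y) = T x\<close>.\<close>
      then have "R (S y) = Q (Suc i) (S y)" using elim(2) iN unfolding y_def by blast
      also have "\<dots> = T ((T ^^ i) ((?S' ^^ i) (?S' (S y))))" unfolding Q_def by (simp add: funpow_swap1)
      also have "\<dots> = T (Q i y)" unfolding Q_def using mp_inv_left[OF Sm y] by simp
      finally show "R (S (?R' x)) = T x" using x unfolding y_def by simp
    qed
  qed
  then obtain Z where Z: "{x \<in> space mu. \<not> (fst x \<notin> L \<longrightarrow> R (S (?R' x)) = T x)} \<subseteq> Z" "Z \<in> null_sets mu"
    by (auto elim!: AE_E simp: null_sets_def)
  let ?D = "L \<times> {0..1} \<union> Z"
  have "R (S (?R' x)) = T x" if "x \<in> space mu - ?D" for x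
  proof -
    have "fst x \<notin> L" using that by (cases x) (auto simp: space_mu)
    then show ?thesis using that Z(1) by blast
  qed
  moreover have "?D \<in> sets mu" using mu_strip(1)[OF L] Z(2) by auto
  moreover have "measure mu ?D < e"
  proof -
    have "emeasure mu ?D = emeasure nu L"
      using emeasure_Un_null_set[OF mu_strip(1)[OF L] Z(2)] mu_strip(2)[OF L] by simp
    then show ?thesis using mL by (simp add: measure_def)
  qed
  ultimately show thesis by (intro that[OF R])
qed

text \<open>The conjugates of \<open>S\<close> from \<open>almost_conjugate\<close> are again
  relatively weakly mixing. Agreeing with \<open>T\<close> off ever smaller sets, they converge to
  its class, and a convergent sequence is enough to reach the closure.\<close>

lemma relative_W_dense:
  assumes C0: "C0 \<in> Aut nu" "T0 \<in> C0" and ap: "aperiodic nu C0"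
    and S: "extends S T0" and wm: "rel_weak_mixing S"
  shows "extension_topology C0 closure_of relative_W C0 = topspace (extension_topology C0)"
proof -
  interpret mu: prob_space mu by (rule prob_space_mu)
  have ts: "topspace (extension_topology C0) = extensions C0"
    unfolding extension_topology_def topspace_subtopology topspace_weak_topology extensions_def by blast
  have aps: "{x \<in> space nu. \<exists>n>0. (T0 ^^ n) x = x} \<in> null_sets nu" using ap C0(2) by (simp add: aperiodic_def)
  have "C \<in> extension_topology C0 closure_of relative_W C0" if C: "C \<in> extensions C0" for C
    unfolding in_closure_of ts
  proof (intro conjI allI impI)
    show "C \<in> extensions C0" by (rule C)
    have CA: "C \<in> Aut mu" using C by (simp add: extensions_def)
    obtain T where T: "T \<in> C" using Aut_nonempty[OF CA] by blast
    have eT: "extends T T0" using extensions_iff[OF C0 CA T] C by simp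
    have Tm: "T \<in> mp_bijections mu" by (rule Aut_rep[OF CA T])
    have "\<exists>U D. extends U T0 \<and> rel_weak_mixing U \<and> D \<in> sets mu \<and> measure mu D < 1 / real (Suc n) \<and>
       (\<forall>x\<in>space mu - D. U x = T x)" for n
    proof -
      obtain R D where R: "extends R (\<lambda>z. z)" and D: "D \<in> sets mu" "measure mu D < 1 / real (Suc n)"
        "\<And>x. x \<in> space mu - D \<Longrightarrow> R (S (mp_inv mu R x)) = T x"
        using almost_conjugate[OF eT S aps, of "1 / real (Suc n)"] by auto
      have "extends (\<lambda>x. R (S (mp_inv mu R x))) (\<lambda>z. T0 z)"
        by (rule extends_comp[OF R extends_comp[OF S extends_id_inv[OF R]]])
      then show ?thesis using rel_weak_mixing_conj[OF R S wm] D by blast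
    qed
    then obtain U D where U: "\<And>n. extends (U n) T0" "\<And>n. rel_weak_mixing (U n)"
      and D: "\<And>n. D n \<in> sets mu" "\<And>n. measure mu (D n) < 1 / real (Suc n)"
        "\<And>n x. x \<in> space mu - D n \<Longrightarrow> U n x = T x" by metis
    define K where "K n = ae_eq mu `` {U n}" for n
    have Um: "U n \<in> mp_bijections mu" for n using U(1) by (simp add: extends_def)
    have KA: "K n \<in> Aut mu" and UK: "U n \<in> K n" for n unfolding K_def using Aut_class[OF Um] by auto
    have KE: "K n \<in> extensions C0" for n using extensions_iff[OF C0 KA UK] U(1) by simp
    have KW: "K n \<in> relative_W C0" for n using relative_W_iff[OF C0 KE UK] U(2) by simp
    have "limitin (weak_topology mu) K C sequentially"
      unfolding limitin_weak_topology[OF mu.finite_measure_axioms KA UK CA T]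
    proof
      fix A assume A: "A \<in> sets mu"
      have "measure mu (sym_diff (U n ` A) (T ` A)) \<le> 2 * (1 / real (Suc n))" for n
      proof -
        note im = mp_bijections_image[OF Um[of n] D(1)[of n]] mp_bijections_image[OF Tm D(1)[of n]]
        have "y \<in> U n ` D n \<union> T ` D n" if y: "y \<in> sym_diff (U n ` A) (T ` A)" for y
        proof -
          consider x where "x \<in> A" "y = U n x" "y \<notin> T ` A" | x where "x \<in> A" "y = T x" "y \<notin> U n ` A"
            using y by blast
          then show ?thesis
          proof cases
            case 1
            then have "U n x \<noteq> T x" by blast
            then have "x \<in> D n" using D(3)[of x n] 1(1) sets.sets_into_space[OF A] by blast
            then show ?thesis using 1 by blast
          next
            case 2
            then have "U n x \<noteq> T x" by (metis imageI)
            then have "x \<in> D n" using D(3)[of x n] 2(1) sets.sets_into_space[OF A] by blast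
            then show ?thesis using 2 by blast
          qed
        qed
        \<comment> \<open>The images of \<open>A\<close> can differ only through points of
          \<open>D n\<close>, and both maps preserve the measure of \<open>D n\<close>; this gives
          the factor 2.\<close>
        then have "sym_diff (U n ` A) (T ` A) \<subseteq> U n ` D n \<union> T ` D n" by (rule subsetI)
        then have "measure mu (sym_diff (U n ` A) (T ` A)) \<le> measure mu (U n ` D n \<union> T ` D n)"
          by (rule mu.finite_measure_mono) (use im in blast)
        also have "\<dots> \<le> measure mu (U n ` D n) + measure mu (T ` D n)"
          using im by (intro measure_Un_le) auto
        also have "\<dots> = 2 * measure mu (D n)" using im by (simp add: measure_def)
        finally show ?thesis using D(2)[of n] by simp
      qed
      moreover have "(\<lambda>n. 2 * (1 / real (Suc n))) \<longlonglongrightarrow> 2 * 0"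
        by (intro tendsto_mult tendsto_const LIMSEQ_Suc[OF lim_1_over_n])
      ultimately show "(\<lambda>n. measure mu (sym_diff (U n ` A) (T ` A))) \<longlonglongrightarrow> 0"
        using tendsto_sandwich[of "\<lambda>_. 0" "\<lambda>n. measure mu (sym_diff (U n ` A) (T ` A))" sequentially
          "\<lambda>n. 2 * (1 / real (Suc n))" 0] by (simp add: always_eventually)
    qed
    note lim = this
    fix V assume V: "C \<in> V \<and> openin (extension_topology C0) V"
    then have "openin (extension_topology C0) V" by simp
    then obtain V' where V': "openin (weak_topology mu) V'" "V = V' \<inter> extensions C0"
      unfolding extension_topology_def openin_subtopology by blast
    have "C \<in> V'" using V V'(2) by simp
    then have "\<forall>\<^sub>F n in sequentially. K n \<in> V'" using lim V'(1) by (simp add: limitin_def)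
    then obtain n where "K n \<in> V'" unfolding eventually_sequentially by blast
    then have "K n \<in> V" using KE V'(2) by simp
    then show "\<exists>y. y \<in> relative_W C0 \<and> y \<in> V" using KW[of n] by (intro exI[of _ "K n"] conjI)
  qed
  then show ?thesis
    using closure_of_subset_topspace[of "extension_topology C0" "relative_W C0"] unfolding ts
    by (intro equalityI subsetI) auto
qed

section \<open>A mixing automorphism of the unit interval\<close>

text \<open>For \<open>x\<close> in \<open>{0..<1}\<close> this is the digit of weight
  \<open>1 / 2^(n+1)\<close>; taking the floor selects, at dyadic points, the expansion ending in
  zeros.\<close>

definition dig :: "nat \<Rightarrow> real \<Rightarrow> bool" where
  "dig n x \<longleftrightarrow> odd \<lfloor>x * 2 ^ Suc n\<rfloor>"

lemma dig_Suc: "dig (Suc n) x = dig n (2 * x)"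
  by (simp add: dig_def mult_ac)

lemma dig_shift: "dig n (x + 1) = dig n x"
proof -
  have "(x + 1) * 2 ^ Suc n = x * 2 ^ Suc n + of_int (2 ^ Suc n)" by (simp add: algebra_simps)
  then have "\<lfloor>(x + 1) * 2 ^ Suc n\<rfloor> = \<lfloor>x * 2 ^ Suc n\<rfloor> + 2 ^ Suc n" by (simp only: floor_add_int)
  then show ?thesis by (simp add: dig_def)
qed

lemma measurable_dig[measurable]: "Measurable.pred borel (dig n)"
proof -
  have "(\<lambda>x::real. \<lfloor>x * 2 ^ Suc n\<rfloor>) \<in> borel \<rightarrow>\<^sub>M count_space UNIV" by measurable
  then show ?thesis unfolding dig_def by measurable
qed

abbreviation coin :: "bool measure" where "coin \<equiv> measure_pmf (bernoulli_pmf (1/2))"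
abbreviation coins :: "(nat \<Rightarrow> bool) measure" where "coins \<equiv> PiM UNIV (\<lambda>_. coin)"

lemma coin_sum: "measure coin A = (if False \<in> A then 1/2 else 0) + (if True \<in> A then 1/2 else 0)"
proof -
  have "A = (if False \<in> A then {False} else {}) \<union> (if True \<in> A then {True} else {})"
    by (auto split: if_splits) (metis (full_types))+
  then show ?thesis
    by (subst measure_measure_pmf_finite) (auto split: if_splits)
qed

lemma dig_0: "x \<in> {0..<1/2} \<Longrightarrow> \<not> dig 0 x" "x \<in> {1/2..<1} \<Longrightarrow> dig 0 x"
proof -
  assume "x \<in> {0..<1/2}"
  then have "\<lfloor>x * 2\<rfloor> = 0" by (intro floor_unique) auto
  then show "\<not> dig 0 x" by (simp add: dig_def)
next
  assume "x \<in> {1/2..<1}"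
  then have "\<lfloor>x * 2\<rfloor> = 1" by (intro floor_unique) auto
  then show "dig 0 x" by (simp add: dig_def)
qed

text \<open>For \<open>t = 0\<close> and \<open>t = 1\<close> these sets are the two branches of the
  preimage of \<open>S\<close> under the doubling map, each carrying half of its measure.\<close>

lemma measure_lborel_double:
  assumes "S \<in> sets borel" "S \<subseteq> {0..<1::real}"
  shows "measure lborel {x. 2 * x - t \<in> S} = measure lborel S / 2" "emeasure lborel {x. 2 * x - t \<in> S} < \<infinity>"
proof -
  have eq: "{x. 2 * x - t \<in> S} = (\<lambda>x. - t + 2 * x) -` S" by (auto simp: algebra_simps)
  have m: "(\<lambda>x. - t + 2 * x) -` S \<in> sets lborel"
    using measurable_sets[of "\<lambda>x. - t + 2 * x" borel borel S] assms by simp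
  have "emeasure lborel S = emeasure (density (distr lborel borel (\<lambda>x. - t + 2 * x)) (\<lambda>_. ennreal \<bar>2\<bar>)) S"
    using lborel_real_affine[of 2 "- t"] by simp
  also have "\<dots> = 2 * emeasure (distr lborel borel (\<lambda>x. - t + 2 * x)) S"
    using assms by (subst emeasure_density_const) auto
  also have "\<dots> = 2 * emeasure lborel {x. 2 * x - t \<in> S}"
    using assms m by (subst emeasure_distr) (auto simp: eq)
  finally have e: "emeasure lborel S = 2 * emeasure lborel {x. 2 * x - t \<in> S}" .
  have "emeasure lborel S \<le> emeasure lborel {0..<1::real}" by (rule emeasure_mono[OF assms(2)]) simp
  also have "\<dots> = 1" by simp
  finally have fS: "emeasure lborel S < \<infinity>" by (metis ennreal_one_less_top infinity_ennreal_def le_less_trans)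
  then show "emeasure lborel {x. 2 * x - t \<in> S} < \<infinity>"
    unfolding e by (metis ennreal_mult_eq_top_iff infinity_ennreal_def less_top zero_neq_numeral)
  have "measure lborel S = 2 * measure lborel {x. 2 * x - t \<in> S}"
    unfolding measure_def e by (simp add: enn2real_mult)
  then show "measure lborel {x. 2 * x - t \<in> S} = measure lborel S / 2" by simp
qed

text \<open>Induction through the doubling map: the first digit decides the half of the interval,
  and the remaining digits are those of \<open>2 x\<close> or \<open>2 x - 1\<close>.\<close>

lemma measure_digits:
  "measure lborel {x\<in>{0..<1}. \<forall>j<n. dig j x \<in> A j} = (\<Prod>j<n. measure coin (A j))"
proof (induction n arbitrary: A)
  case 0 have "{x. 0 \<le> x \<and> x < (1::real)} = {0..<1}" by auto
  then show ?case by simp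
next
  case (Suc n)
  define S where "S = {x\<in>{0..<1::real}. \<forall>j<n. dig j x \<in> A (Suc j)}"
  have S: "S \<in> sets borel" unfolding S_def by measurable
  have Ss: "S \<subseteq> {0..<1}" unfolding S_def by auto
  have all: "(\<forall>j<Suc n. P j) \<longleftrightarrow> P 0 \<and> (\<forall>j<n. P (Suc j))" for P by (metis less_Suc_eq_0_disj Suc_less_eq zero_less_Suc)
  have d: "dig j (2 * x - 1) = dig j (2 * x)" for j x using dig_shift[of j "2 * x - 1"] by simp
  define F where "F = (if False \<in> A 0 then {x. 2 * x - 0 \<in> S} else {})"
  define G where "G = (if True \<in> A 0 then {x. 2 * x - 1 \<in> S} else {})"
  have Sm: "{x. 2 * x - t \<in> S} \<in> sets borel" for t
    using measurable_sets[of "\<lambda>x. 2 * x - t" borel borel S] S by (simp add: vimage_def)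
  have "{x\<in>{0..<1}. \<forall>j<Suc n. dig j x \<in> A j} = F \<union> G"
  proof (intro set_eqI)
    fix x :: real
    have FG: "x \<in> F \<longleftrightarrow> False \<in> A 0 \<and> 2 * x \<in> S" "x \<in> G \<longleftrightarrow> True \<in> A 0 \<and> 2 * x - 1 \<in> S"
      by (auto simp: F_def G_def)
    consider "x \<in> {0..<1/2}" | "x \<in> {1/2..<1}" | "x < 0 \<or> 1 \<le> x" by fastforce
    then show "x \<in> {x\<in>{0..<1}. \<forall>j<Suc n. dig j x \<in> A j} \<longleftrightarrow> x \<in> F \<union> G"
    proof cases
      case 1 then show ?thesis using dig_0(1)[OF 1] unfolding FG Un_iff all dig_Suc S_def by (auto simp: d)
    next
      case 2 then show ?thesis using dig_0(2)[OF 2] unfolding FG Un_iff all dig_Suc S_def by (auto simp: d)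
    next
      case 3 then show ?thesis unfolding FG Un_iff S_def by auto
    qed
  qed
  moreover have d: "F \<inter> G = {}" unfolding F_def G_def S_def by auto
  have m: "F \<in> sets lborel" "G \<in> sets lborel" using Sm[of 0] Sm[of 1] by (auto simp: F_def G_def)
  have f: "emeasure lborel F \<noteq> \<infinity>" "emeasure lborel G \<noteq> \<infinity>"
    using measure_lborel_double(2)[OF S Ss, of 0] measure_lborel_double(2)[OF S Ss, of 1] by (auto simp: F_def G_def)
  ultimately have "measure lborel {x\<in>{0..<1}. \<forall>j<Suc n. dig j x \<in> A j} = measure lborel F + measure lborel G"
    using measure_Union[OF f m d] by (simp only:)
  also have "\<dots> = measure coin (A 0) * measure lborel S"
    using measure_lborel_double(1)[OF S Ss, of 0] measure_lborel_double(1)[OF S Ss, of 1]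
    unfolding coin_sum F_def G_def by (simp add: algebra_simps)
  also have "measure lborel S = (\<Prod>j<n. measure coin (A (Suc j)))" unfolding S_def by (rule Suc.IH)
  finally show ?case unfolding prod.lessThan_Suc_shift .
qed

lemma nu_borel_sets: "A \<in> sets borel \<Longrightarrow> A \<inter> {0..1} \<in> sets nu"
  unfolding nu_def by (auto simp: sets_restrict_space)

lemma measurable_nu_borel: "f \<in> borel \<rightarrow>\<^sub>M N \<Longrightarrow> f \<in> nu \<rightarrow>\<^sub>M N"
  unfolding nu_def by (intro measurable_restrict_space1 measurable_completion) simp

lemma emeasure_nu_borel: "A \<in> sets borel \<Longrightarrow> A \<subseteq> {0..1} \<Longrightarrow> emeasure nu A = emeasure lborel A"
  unfolding nu_def by (subst emeasure_restrict_space) auto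

lemma nu_countable_null: assumes "countable A" "A \<subseteq> {0..1}" shows "A \<in> null_sets nu"
proof -
  have A: "A \<in> null_sets lborel" using assms by (rule_tac countable_imp_null_set_lborel)
  then have "emeasure nu A = 0" using emeasure_nu_borel[of A] assms(2) by (auto simp: null_sets_def)
  moreover have "A \<in> sets nu" using nu_borel_sets[of A] A assms(2) by (auto simp: null_sets_def Int_absorb2)
  ultimately show ?thesis by (rule null_setsI)
qed

text \<open>Digit cylinders are computed in \<open>{0..<1}\<close>, while \<open>nu\<close> lives on
  the closed interval; the end point is null.\<close>

lemma measure_nu_eq_lborel:
  assumes B: "B \<in> sets nu" and A: "A \<in> sets borel" and eq: "B - {1} = A" and s: "A \<subseteq> {0..<1}"
  shows "measure nu B = measure lborel A"
proof -
  have "emeasure nu B = emeasure nu A"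
  proof (rule emeasure_eq_AE[OF _ B])
    have "A \<inter> {0..1} = A" using s by auto
    then show "A \<in> sets nu" using nu_borel_sets[OF A] by simp
    have "{1} \<in> null_sets nu" by (rule nu_countable_null) auto
    then show "AE x in nu. x \<in> B \<longleftrightarrow> x \<in> A" using eq by (auto dest!: AE_not_in elim: eventually_mono)
  qed
  also have "\<dots> = emeasure lborel A" using s by (intro emeasure_nu_borel[OF A]) auto
  finally show ?thesis by (simp add: measure_def)
qed

lemma distr_nu_digits: "distr nu coins (\<lambda>x n. dig n x) = coins"
  and measurable_digits: "(\<lambda>x n. dig n x) \<in> nu \<rightarrow>\<^sub>M coins"
proof -
  have "(\<lambda>x n. dig n x) \<in> borel \<rightarrow>\<^sub>M coins"
    by (rule measurable_PiM_single') (auto simp: space_PiM)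
  then show m: "(\<lambda>x n. dig n x) \<in> nu \<rightarrow>\<^sub>M coins" by (rule measurable_nu_borel)
  interpret product_prob_space "\<lambda>_. coin" "UNIV :: nat set" ..
  show "distr nu coins (\<lambda>x n. dig n x) = coins"
  proof (rule measure_eqI_PiM_infinite)
    show "finite_measure (distr nu coins (\<lambda>x n. dig n x))"
      using nu.prob_space_distr[OF m] by (rule prob_space.finite_measure)
    fix A :: "nat \<Rightarrow> bool set" and J :: "nat set" assume J: "finite J"
    then obtain n where n: "J \<subseteq> {..<n}" using finite_nat_iff_bounded by blast
    \<comment> \<open>Free coordinates below \<open>n\<close> get the whole space, which turns
      constraints on \<open>J\<close> into constraints on an initial segment as in
      \<open>measure_digits\<close>.\<close>
    define A' where "A' j = (if j \<in> J then A j else UNIV)" for j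
    let ?E = "prod_emb UNIV (\<lambda>_. coin) J (Pi\<^sub>E J A)"
    have E: "?E = {\<omega>. \<forall>j<n. \<omega> j \<in> A' j}"
      using n by (auto simp: prod_emb_def A'_def PiE_iff subset_eq)
    have Em: "?E \<in> sets coins" by (rule sets_PiM_I) (use J in auto)
    let ?B = "(\<lambda>x n. dig n x) -` ?E \<inter> space nu"
    let ?A = "{x\<in>{0..<1}. \<forall>j<n. dig j x \<in> A' j}"
    have "measure nu ?B = measure lborel ?A"
    proof (rule measure_nu_eq_lborel)
      show "?B \<in> sets nu" using m Em by (rule measurable_sets)
      show "?A \<in> sets borel" by measurable
      show "?B - {1} = ?A" unfolding E by (auto simp: space_nu)
    qed auto
    also have "\<dots> = (\<Prod>j<n. measure coin (A' j))" by (rule measure_digits)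
    also have "\<dots> = (\<Prod>j\<in>J. measure coin (A j))"
      by (rule prod.mono_neutral_cong_right) (use n in \<open>auto simp: A'_def measure_pmf.prob_space\<close>)
    finally have "measure nu ?B = (\<Prod>j\<in>J. measure coin (A j))" .
    then have "emeasure nu ?B = (\<Prod>j\<in>J. emeasure coin (A j))"
      by (simp add: nu.emeasure_eq_measure measure_pmf.emeasure_eq_measure prod_ennreal)
    also have "\<dots> = emeasure coins ?E" using J by (intro emeasure_PiM_emb[symmetric]) auto
    finally show "emeasure (distr nu coins (\<lambda>x n. dig n x)) ?E = emeasure coins ?E"
      using m Em by (simp add: emeasure_distr)
  qed simp_all
qed

section \<open>Recovering a point from its digits\<close>

definition bin_val :: "(nat \<Rightarrow> bool) \<Rightarrow> real" where
  "bin_val w = (\<Sum>n. of_bool (w n) / 2 ^ Suc n)"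

lemma bin_val_summable: "summable (\<lambda>n. of_bool (w n) / 2 ^ Suc n :: real)"
proof (rule summable_comparison_test)
  show "summable (\<lambda>n. (1/2) ^ Suc n :: real)" using summable_geometric[of "1/2::real"] by (subst summable_Suc_iff) simp
  show "\<exists>N. \<forall>n\<ge>N. norm (of_bool (w n) / 2 ^ Suc n :: real) \<le> (1/2) ^ Suc n"
    by (auto simp: power_divide)
qed

lemma bin_val_rec: "bin_val w = (of_bool (w 0) + bin_val (\<lambda>n. w (Suc n))) / 2"
proof -
  have "(\<lambda>n. of_bool (w (Suc n)) / 2 ^ Suc (Suc n)) = (\<lambda>n. (1/2) * (of_bool (w (Suc n)) / 2 ^ Suc n :: real))"
    by auto
  then have "(\<Sum>n. of_bool (w (Suc n)) / 2 ^ Suc (Suc n) :: real) = (1/2) * bin_val (\<lambda>n. w (Suc n))"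
    unfolding bin_val_def using suminf_mult[OF bin_val_summable, of "1/2"] by simp
  then show ?thesis
    unfolding bin_val_def[of w] using suminf_split_initial_segment[OF bin_val_summable[of w], of 1]
    by (simp add: add_divide_distrib)
qed

lemma bin_val_nonneg: "0 \<le> bin_val w"
  unfolding bin_val_def by (rule suminf_nonneg[OF bin_val_summable]) simp

lemma bin_val_le: "bin_val w \<le> 1"
proof -
  have "(\<lambda>n. (1/2) ^ Suc n :: real) sums 1" by (rule power_half_series)
  then have "bin_val w \<le> 1"
    unfolding bin_val_def using bin_val_summable[of w]
    by (intro sums_le[OF _ summable_sums[OF bin_val_summable[of w]]]) (auto simp: power_divide)
  then show ?thesis .
qed

lemma bin_val_less: "\<not> w n \<Longrightarrow> bin_val w < 1"
proof (induction n arbitrary: w)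
  case 0 then show ?case using bin_val_rec[of w] bin_val_le[of "\<lambda>n. w (Suc n)"] by simp
next
  case (Suc n)
  have "bin_val (\<lambda>n. w (Suc n)) < 1" by (rule Suc.IH) (use Suc.prems in simp)
  then show ?case unfolding bin_val_rec[of w] by (cases "w 0") auto
qed

text \<open>Infinitely many zeros keep every tail strictly below 1, so the floor reads off the
  leading digit; doubling then shifts to the next one.\<close>

lemma dig_bin_val: "\<exists>\<^sub>\<infinity>m. \<not> w m \<Longrightarrow> dig n (bin_val w) = w n"
proof (induction n arbitrary: w)
  case 0
  have "\<exists>\<^sub>\<infinity>m. \<not> w (Suc m)" using 0 by (simp add: INFM_nat Suc_le_eq) (metis Suc_lessE Suc_less_eq less_trans lessI)
  then obtain m where "\<not> w (Suc m)" by (auto dest: INFM_EX)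
  then have "bin_val (\<lambda>n. w (Suc n)) < 1" by (rule bin_val_less)
  then have "\<lfloor>bin_val w * 2\<rfloor> = of_bool (w 0)"
    using bin_val_nonneg[of "\<lambda>n. w (Suc n)"] by (intro floor_unique) (auto simp: bin_val_rec[of w])
  then show ?case by (simp add: dig_def)
next
  case (Suc n)
  have s: "\<exists>\<^sub>\<infinity>m. \<not> w (Suc m)" using Suc.prems by (simp add: INFM_nat Suc_le_eq) (metis Suc_lessE Suc_less_eq less_trans lessI)
  have "2 * bin_val w = bin_val (\<lambda>n. w (Suc n)) + of_bool (w 0)" by (simp add: bin_val_rec[of w])
  then have "dig (Suc n) (bin_val w) = dig n (bin_val (\<lambda>n. w (Suc n)))"
    unfolding dig_Suc using dig_shift by (cases "w 0") auto
  then show ?case using Suc.IH[OF s] by simp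
qed

text \<open>Truncation after \<open>n\<close> digits is rounding down to a multiple of
  \<open>1 / 2^n\<close>. This gives the convergence of the expansion and later shows that
  membership in a dyadic half-line depends on finitely many digits.\<close>

lemma dig_partial_sum:
  assumes "x \<in> {0..<1}"
  shows "(\<Sum>i<n. of_bool (dig i x) / 2 ^ Suc i) = of_int \<lfloor>x * 2 ^ n\<rfloor> / (2 ^ n :: real)"
proof (induction n)
  case 0
  have "\<lfloor>x\<rfloor> = 0" using assms by (intro floor_unique) auto
  then show ?case by simp
next
  case (Suc n)
  let ?k = "\<lfloor>x * 2 ^ n\<rfloor>"
  have "\<lfloor>x * 2 ^ Suc n\<rfloor> = 2 * ?k \<or> \<lfloor>x * 2 ^ Suc n\<rfloor> = 2 * ?k + 1"
  proof -
    have "of_int ?k \<le> x * 2 ^ n" "x * 2 ^ n < of_int ?k + 1" by linarith+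
    then have "2 * ?k \<le> \<lfloor>x * 2 ^ Suc n\<rfloor>" "\<lfloor>x * 2 ^ Suc n\<rfloor> < 2 * ?k + 2"
      by (simp_all add: le_floor_iff floor_less_iff algebra_simps)
    then show ?thesis by linarith
  qed
  then have "\<lfloor>x * 2 ^ Suc n\<rfloor> = 2 * ?k + of_bool (dig n x)" unfolding dig_def by auto
  then have "of_int \<lfloor>x * 2 ^ Suc n\<rfloor> / (2 ^ Suc n :: real) = of_int ?k / 2 ^ n + of_bool (dig n x) / 2 ^ Suc n"
    by (simp add: add_divide_distrib)
  then show ?case using Suc by simp
qed

lemma bin_val_dig:
  assumes "x \<in> {0..<1}" shows "bin_val (\<lambda>n. dig n x) = x"
proof -
  have "(\<lambda>n. of_int \<lfloor>x * 2 ^ n\<rfloor> / (2 ^ n :: real)) \<longlonglongrightarrow> x"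
  proof (rule tendsto_sandwich)
    show "\<forall>\<^sub>F n in sequentially. x - (1/2) ^ n \<le> of_int \<lfloor>x * 2 ^ n\<rfloor> / (2 ^ n :: real)"
    proof (intro always_eventually allI)
      fix n
      have "x * 2 ^ n - 1 \<le> of_int \<lfloor>x * 2 ^ n\<rfloor>" by linarith
      then have "(x * 2 ^ n - 1) / 2 ^ n \<le> of_int \<lfloor>x * 2 ^ n\<rfloor> / (2 ^ n :: real)"
        by (intro divide_right_mono) auto
      then show "x - (1/2) ^ n \<le> of_int \<lfloor>x * 2 ^ n\<rfloor> / (2 ^ n :: real)"
        by (simp add: diff_divide_distrib power_divide)
    qed
    show "\<forall>\<^sub>F n in sequentially. of_int \<lfloor>x * 2 ^ n\<rfloor> / (2 ^ n :: real) \<le> x"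
      by (intro always_eventually allI) (simp add: field_simps)
    show "(\<lambda>n. x - (1/2) ^ n) \<longlonglongrightarrow> x"
      using tendsto_diff[OF tendsto_const[of x] LIMSEQ_realpow_zero[of "1/2"]] by simp
  qed simp
  then have "(\<lambda>n. of_bool (dig n x) / 2 ^ Suc n :: real) sums x"
    unfolding sums_def dig_partial_sum[OF assms] .
  then show ?thesis unfolding bin_val_def by (rule sums_unique[symmetric])
qed


text \<open>Off the countable set of points with eventually constant digits, a permutation of the
  digits is a bijection.\<close>

definition two_digits :: "real set" where
  "two_digits = {x\<in>{0..<1}. (\<exists>\<^sub>\<infinity>n. dig n x) \<and> (\<exists>\<^sub>\<infinity>n. \<not> dig n x)}"

text \<open>All other points stay fixed, so that the map is a bijection of the whole interval and
  not only up to a null set.\<close>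

definition permute_digits :: "(nat \<Rightarrow> nat) \<Rightarrow> real \<Rightarrow> real" where
  "permute_digits s x = (if x \<in> two_digits then bin_val (\<lambda>n. dig (s n) x) else x)"

lemma INFM_bij: "bij s \<Longrightarrow> (\<exists>\<^sub>\<infinity>n. P (s n)) \<longleftrightarrow> (\<exists>\<^sub>\<infinity>n. P n)" for s :: "nat \<Rightarrow> nat"
proof -
  assume s: "bij s"
  have "{n. P (s n)} = s -` {n. P n}" by auto
  then show ?thesis unfolding INFM_iff_infinite using finite_vimage_iff[OF s, of "{n. P n}"] by simp
qed

lemma bin_val_two_digits:
  assumes "\<exists>\<^sub>\<infinity>n. w n" "\<exists>\<^sub>\<infinity>n. \<not> w n" shows "bin_val w \<in> two_digits"
proof -
  obtain n where "\<not> w n" using assms(2) by (auto dest: INFM_EX)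
  then have "bin_val w \<in> {0..<1}" using bin_val_less[of w n] bin_val_nonneg[of w] by simp
  then show ?thesis using assms dig_bin_val[OF assms(2)] unfolding two_digits_def by simp
qed

lemma
  assumes s: "bij s" and x: "x \<in> two_digits"
  shows permute_digits_two_digits: "permute_digits s x \<in> two_digits"
    and dig_permute_digits: "dig n (permute_digits s x) = dig (s n) x"
proof -
  have i: "\<exists>\<^sub>\<infinity>n. dig (s n) x" "\<exists>\<^sub>\<infinity>n. \<not> dig (s n) x"
    using x INFM_bij[OF s, of "\<lambda>n. dig n x"] INFM_bij[OF s, of "\<lambda>n. \<not> dig n x"] unfolding two_digits_def by auto
  show "permute_digits s x \<in> two_digits" using bin_val_two_digits[OF i] x by (simp add: permute_digits_def)
  show "dig n (permute_digits s x) = dig (s n) x" using dig_bin_val[OF i(2)] x by (simp add: permute_digits_def)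
qed

lemma permute_digits_inverse:
  assumes s: "bij s" and t: "bij t" and st: "\<And>n. s (t n) = n"
  shows "permute_digits t (permute_digits s x) = x"
proof (cases "x \<in> two_digits")
  case True
  have "permute_digits t (permute_digits s x) = bin_val (\<lambda>n. dig (t n) (permute_digits s x))"
    using permute_digits_two_digits[OF s True] by (simp add: permute_digits_def)
  also have "\<dots> = bin_val (\<lambda>n. dig n x)" by (simp add: dig_permute_digits[OF s True] st)
  also have "\<dots> = x" by (rule bin_val_dig) (use True in \<open>simp add: two_digits_def\<close>)
  finally show ?thesis .
qed (simp add: permute_digits_def)

lemma two_digits_01: "two_digits \<subseteq> {0..1}" unfolding two_digits_def by auto

lemma permute_digits_01: "bij s \<Longrightarrow> x \<in> {0..1} \<Longrightarrow> permute_digits s x \<in> {0..1}"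
  using permute_digits_two_digits[of s x] two_digits_01 by (cases "x \<in> two_digits") (auto simp: permute_digits_def)

text \<open>An exceptional point other than 1 is coded by the finite set of its ones or by the
  finite set of its zeros, so there are only countably many.\<close>

lemma AE_two_digits: "AE x in nu. x \<in> two_digits"
proof -
  let ?f = "\<lambda>A. bin_val (\<lambda>n. n \<in> A)" and ?g = "\<lambda>A. bin_val (\<lambda>n. n \<notin> A)"
  let ?C = "(?f ` {A. finite A} \<union> ?g ` {A. finite A} \<union> {1}) \<inter> {0..1}"
  have "countable ?C" using countable_Collect_finite by (intro countable_Int1 countable_Un countable_image) auto
  then have C: "?C \<in> null_sets nu" by (rule nu_countable_null) auto
  have "{x \<in> space nu. x \<notin> two_digits} \<subseteq> ?C"
  proof
    fix x assume x: "x \<in> {x \<in> space nu. x \<notin> two_digits}"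
    show "x \<in> ?C"
    proof (cases "x = 1")
      case False
      then have x1: "x \<in> {0..<1}" using x by (auto simp: space_nu)
      then have fin: "finite {n. dig n x} \<or> finite {n. \<not> dig n x}"
        using x unfolding two_digits_def INFM_iff_infinite by auto
      have eq: "x = ?f {n. dig n x}" "x = ?g {n. \<not> dig n x}" using bin_val_dig[OF x1] by simp_all
      from fin have "x \<in> ?f ` {A. finite A} \<union> ?g ` {A. finite A}"
      proof
        assume "finite {n. dig n x}"
        then have "x \<in> ?f ` {A. finite A}" using eq(1) by (intro image_eqI[of x ?f "{n. dig n x}"]) auto
        then show ?thesis ..
      next
        assume "finite {n. \<not> dig n x}"
        then have "x \<in> ?g ` {A. finite A}" using eq(2) by (intro image_eqI[of x ?g "{n. \<not> dig n x}"]) auto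
        then show ?thesis ..
      qed
      then show ?thesis using x1 by auto
    qed simp
  qed
  with C show ?thesis by (rule AE_I')
qed

lemma measurable_bin_val[measurable]: "bin_val \<in> borel_measurable coins"
  unfolding bin_val_def by measurable

lemma measurable_permute_digits[measurable]: "permute_digits s \<in> borel_measurable borel"
proof -
  have "two_digits = {x. 0 \<le> x \<and> x < 1 \<and> (\<forall>k. \<exists>n\<ge>k. dig n x) \<and> (\<forall>k. \<exists>n\<ge>k. \<not> dig n x)}"
    unfolding two_digits_def INFM_nat_le by auto
  also have "\<dots> \<in> sets borel" by measurable
  finally have [measurable]: "two_digits \<in> sets borel" .
  show ?thesis unfolding permute_digits_def bin_val_def by measurable
qed

text \<open>Independent identically distributed digits keep their joint law when their indices are
  permuted, and almost every point is recovered from its digits.\<close>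

lemma distr_permute_digits:
  assumes s: "bij s" shows "distr nu borel (permute_digits s) = distr nu borel (\<lambda>x. x)"
proof -
  let ?P = "\<lambda>w n. w (s n) :: bool"
  have P: "?P \<in> coins \<rightarrow>\<^sub>M coins"
    by (rule measurable_PiM_single') (auto simp: space_PiM)
  have dP: "distr coins coins ?P = coins"
    using distr_PiM_reindex[of UNIV "\<lambda>_. coin" s UNIV] s
    by (simp add: bij_is_inj measure_pmf.prob_space_axioms restrict_def)
  have m: "(\<lambda>x. bin_val (\<lambda>n. dig (s n) x)) \<in> nu \<rightarrow>\<^sub>M borel" "(\<lambda>x. bin_val (\<lambda>n. dig n x)) \<in> nu \<rightarrow>\<^sub>M borel"
    using measurable_compose[OF measurable_compose[OF measurable_digits P] measurable_bin_val]
      measurable_compose[OF measurable_digits measurable_bin_val] by simp_all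
  have "distr nu borel (permute_digits s) = distr nu borel (\<lambda>x. bin_val (\<lambda>n. dig (s n) x))"
    using AE_two_digits by (intro distr_cong_AE refl measurable_nu_borel measurable_permute_digits m)
      (auto simp: permute_digits_def elim: eventually_mono)
  also have "\<dots> = distr (distr (distr nu coins (\<lambda>x n. dig n x)) coins ?P) borel bin_val"
    using measurable_digits P by (simp add: distr_distr comp_def)
  also have "\<dots> = distr (distr nu coins (\<lambda>x n. dig n x)) borel bin_val"
    unfolding distr_nu_digits dP ..
  also have "\<dots> = distr nu borel (\<lambda>x. bin_val (\<lambda>n. dig n x))"
    using measurable_digits by (simp add: distr_distr comp_def)
  also have "\<dots> = distr nu borel (\<lambda>x. x)"
  proof (rule distr_cong_AE[OF refl refl _ m(2) measurable_nu_borel])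
    show "AE x in nu. bin_val (\<lambda>n. dig n x) = x"
      using AE_two_digits by eventually_elim (simp add: bin_val_dig two_digits_def)
  qed simp
  finally show ?thesis .
qed

text \<open>Restriction and completion commute here. This makes \<open>nu\<close> complete and lets
  measure preservation be tested on Borel sets.\<close>

lemma nu_completion: "nu = completion (restrict_space lborel {0..1})"
proof (rule measure_eqI)
  let ?L = "restrict_space lborel {0..1::real}"
  have nullL: "N \<in> null_sets ?L \<longleftrightarrow> N \<in> null_sets lborel \<and> N \<subseteq> {0..1}" for N
    by (simp add: null_sets_restrict_space conj_commute)
  have setsL: "S \<in> sets ?L \<longleftrightarrow> S \<in> sets lborel \<and> S \<subseteq> {0..1}" for S
    by (subst sets_restrict_space_iff) auto
  have setsn: "A \<in> sets nu \<longleftrightarrow> A \<in> sets lebesgue \<and> A \<subseteq> {0..1}" for A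
    unfolding nu_def by (subst sets_restrict_space_iff) auto
  show "sets nu = sets (completion ?L)"
  proof (intro set_eqI iffI)
    fix A assume "A \<in> sets nu"
    then have A: "A \<in> sets lebesgue" "A \<subseteq> {0..1}" using setsn by auto
    from A(1) obtain S N N' where d: "A = S \<union> N" "N \<subseteq> N'" "N' \<in> null_sets lborel" "S \<in> sets lborel"
      by (rule sets_completionE)
    show "A \<in> sets (completion ?L)"
    proof (rule sets_completionI)
      show "A = S \<union> N" by (rule d)
      show "N \<subseteq> N' \<inter> {0..1}" using d A by auto
      show "N' \<inter> {0..1} \<in> null_sets ?L" unfolding nullL using d(3) by (auto intro: null_set_Int2)
      show "S \<in> sets ?L" unfolding setsL using d A by auto
    qed
  next
    fix A assume "A \<in> sets (completion ?L)"
    then obtain S N N' where d: "A = S \<union> N" "N \<subseteq> N'" "N' \<in> null_sets ?L" "S \<in> sets ?L"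
      by (rule sets_completionE)
    have "A \<in> sets lebesgue" using d nullL setsL by (intro sets_completionI[OF d(1,2)]) auto
    moreover have "A \<subseteq> {0..1}" using d nullL setsL by blast
    ultimately show "A \<in> sets nu" using setsn by simp
  qed
  fix A assume "A \<in> sets nu"
  then have A: "A \<in> sets lebesgue" "A \<subseteq> {0..1}" using setsn by auto
  from A(1) obtain S N N' where d: "A = S \<union> N" "N \<subseteq> N'" "N' \<in> null_sets lborel" "S \<in> sets lborel"
    by (rule sets_completionE)
  have S: "S \<in> sets ?L" unfolding setsL using d A by auto
  have N: "N \<in> null_sets lebesgue" using d by (auto simp: null_sets_completion_iff2)
  have "N' \<inter> {0..1} \<in> null_sets ?L" unfolding nullL using d(3) by (auto intro: null_set_Int2)
  then have N2: "N \<in> null_sets (completion ?L)"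
    using d A unfolding null_sets_completion_iff2 by (intro bexI[of _ "N' \<inter> {0..1}"]) auto
  have "emeasure nu A = emeasure lebesgue A"
    unfolding nu_def using A by (subst emeasure_restrict_space) auto
  also have "\<dots> = emeasure lborel S" unfolding d(1) using emeasure_Un_null_set[OF _ N, of S] d(4) by simp
  also have "\<dots> = emeasure ?L S" using S setsL by (subst emeasure_restrict_space) auto
  also have "\<dots> = emeasure (completion ?L) A" unfolding d(1) using emeasure_Un_null_set[OF _ N2, of S] S by simp
  finally show "emeasure nu A = emeasure (completion ?L) A" .
qed

lemma complete_nu: "complete_measure nu"
  unfolding nu_completion by (rule completion.complete_measure_axioms)

lemma permute_digits_preserving:
  assumes s: "bij s"
  shows "permute_digits s \<in> nu \<rightarrow>\<^sub>M nu" "distr nu nu (permute_digits s) = nu"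
proof -
  interpret complete_measure nu by (rule complete_nu)
  let ?L = "restrict_space lborel {0..1::real}"
  have mb: "permute_digits s \<in> nu \<rightarrow>\<^sub>M borel" by (rule measurable_nu_borel) measurable
  then have "permute_digits s \<in> nu \<rightarrow>\<^sub>M lborel" by simp
  then have m: "permute_digits s \<in> nu \<rightarrow>\<^sub>M ?L"
    using permute_digits_01[OF s] by (intro measurable_restrict_space2) (auto simp: space_nu)
  have "distr nu ?L (permute_digits s) = ?L"
  proof (rule measure_eqI)
    fix A assume "A \<in> sets (distr nu ?L (permute_digits s))"
    then have AL: "A \<in> sets ?L" by simp
    then have A: "A \<in> sets borel" "A \<subseteq> {0..1}" by (simp_all add: sets_restrict_space_iff)
    have "emeasure (distr nu ?L (permute_digits s)) A = emeasure (distr nu borel (permute_digits s)) A"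
      using m mb A AL by (simp add: emeasure_distr)
    also have "\<dots> = emeasure nu A"
      unfolding distr_permute_digits[OF s] using A by (simp add: emeasure_distr measurable_nu_borel Int_absorb2 space_nu)
    also have "\<dots> = emeasure ?L A" using emeasure_nu_borel[OF A] A by (simp add: emeasure_restrict_space)
    finally show "emeasure (distr nu ?L (permute_digits s)) A = emeasure ?L A" .
  qed simp
  from measure_preserving_completion[OF m this]
  show "permute_digits s \<in> nu \<rightarrow>\<^sub>M nu" "distr nu nu (permute_digits s) = nu"
    using nu_completion by simp_all
qed

lemma permute_digits_mp: "bij s \<Longrightarrow> permute_digits s \<in> mp_bijections nu"
proof (rule mp_bijectionsI[where T' = "permute_digits (inv s)"])
  assume s: "bij s"
  then have i: "bij (inv s)" by (rule bij_imp_bij_inv)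
  have "s (inv s n) = n" "inv s (s n) = n" for n
    using s by (simp_all add: surj_f_inv_f bij_is_surj bij_is_inj)
  then show "permute_digits (inv s) (permute_digits s x) = x" "permute_digits s (permute_digits (inv s) x) = x" for x
    using permute_digits_inverse[OF s i] permute_digits_inverse[OF i s] by simp_all
  show "permute_digits s \<in> nu \<rightarrow>\<^sub>M nu" "distr nu nu (permute_digits s) = nu" "permute_digits (inv s) \<in> nu \<rightarrow>\<^sub>M nu"
    using permute_digits_preserving s i by auto
qed

section \<open>The digit shift and its mixing property\<close>

text \<open>Translation by 1 on the integers, transported to the naturals: a one-sided shift of the
  digits would not be invertible. The resulting \<open>beta\<close> is a two-sided Bernoulli
  shift.\<close>

definition digit_shift :: "nat \<Rightarrow> nat" where
  "digit_shift n = int_encode (int_decode n + 1)"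

lemma digit_shift_pow: "(digit_shift ^^ m) n = int_encode (int_decode n + int m)"
  by (induction m) (auto simp: digit_shift_def add_ac)

lemma bij_digit_shift: "bij digit_shift"
proof (rule bijI')
  show "digit_shift x = digit_shift y \<longleftrightarrow> x = y" for x y
    unfolding digit_shift_def by (metis add_right_cancel int_decode_inverse int_encode_inverse)
  show "\<exists>x. y = digit_shift x" for y
    by (rule exI[of _ "int_encode (int_decode y - 1)"]) (simp add: digit_shift_def)
qed

text \<open>If \<open>b\<close> bounds the absolute values of the integers coded below
  \<open>N\<close>, a translation by more than \<open>2 b\<close> moves all of them away from the
  whole set.\<close>

lemma digit_shift_leaves:
  obtains K where "\<And>m. m \<ge> K \<Longrightarrow> {..<N} \<inter> (digit_shift ^^ m) ` {..<N} = {}"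
proof -
  define b where "b = Max (insert 0 ((\<lambda>n. \<bar>int_decode n\<bar>) ` {..<N}))"
  have b: "\<bar>int_decode n\<bar> \<le> b" if "n < N" for n unfolding b_def using that by (intro Max_ge) auto
  show thesis
  proof (rule that[of "nat (2 * b + 1)"])
    fix m assume m: "nat (2 * b + 1) \<le> m"
    have "(digit_shift ^^ m) n \<noteq> k" if "n < N" "k < N" for n k
    proof
      assume "(digit_shift ^^ m) n = k"
      then have "int_decode k = int_decode n + int m" unfolding digit_shift_pow by auto
      then show False using b[OF that(1)] b[OF that(2)] m by linarith
    qed
    then show "{..<N} \<inter> (digit_shift ^^ m) ` {..<N} = {}" by auto
  qed
qed

abbreviation beta :: "real \<Rightarrow> real" where "beta \<equiv> permute_digits digit_shift"

lemma beta_pow: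
  assumes "x \<in> two_digits"
  shows "(beta ^^ m) x \<in> two_digits" "dig n ((beta ^^ m) x) = dig ((digit_shift ^^ m) n) x"
proof (induction m arbitrary: n)
  case (Suc m)
  { case 1 then show ?case using permute_digits_two_digits[OF bij_digit_shift Suc.IH(1)] by simp }
  { case 2 then show ?case
      using dig_permute_digits[OF bij_digit_shift Suc.IH(1), of n] Suc.IH(2)[of "digit_shift n"]
      by (simp add: funpow_swap1) }
qed (use assms in simp_all)

lemma indep_digits: "nu.indep_vars (\<lambda>_. coin) dig UNIV"
proof -
  have rv: "nu.random_variable coin (dig i)" for i
    using measurable_compose[OF measurable_digits measurable_component_singleton[of i UNIV "\<lambda>_. coin"]] by simp
  have "distr nu coin (dig i) = coin" for i
  proof -
    have "distr nu coin (dig i) = distr (distr nu coins (\<lambda>x n. dig n x)) coin (\<lambda>w. w i)"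
      using measurable_digits by (subst distr_distr) (auto simp: comp_def)
    also have "\<dots> = coin" unfolding distr_nu_digits
      by (rule distr_PiM_component) (auto intro: measure_pmf.prob_space_axioms)
    finally show ?thesis .
  qed
  then show ?thesis
    using distr_nu_digits by (subst nu.indep_vars_iff_distr_eq_PiM[OF _ rv]) (simp_all add: restrict_def)
qed

text \<open>A countable family that determines measures on the interval and whose members are, on
  \<open>two_digits\<close>, given by the first \<open>N\<close> digits.\<close>

definition dyadic :: "nat \<Rightarrow> nat \<Rightarrow> real set" where
  "dyadic N k = {real k / 2 ^ N .. 1}"

lemma dyadic_sets: "dyadic N k \<in> sets nu"
proof -
  have "dyadic N k = dyadic N k \<inter> {0..1}"
    unfolding dyadic_def by (auto intro: order_trans[rotated])
  then show ?thesis using nu_borel_sets[of "dyadic N k"] by (simp add: dyadic_def)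
qed

text \<open>\<open>dyadic N k\<close> depends on the first \<open>N\<close> digits and its preimage
  under \<open>beta^m\<close> on digits with other indices once \<open>m\<close> is large.
  Independence makes the correlation factor exactly, not merely in the limit.\<close>

lemma beta_mixing:
  obtains K where "\<And>m. m \<ge> K \<Longrightarrow>
    measure nu (dyadic N k \<inter> ((beta ^^ m) -` dyadic N k \<inter> space nu)) = measure nu (dyadic N k) ^ 2"
proof -
  let ?D = "dyadic N k"
  have bm: "beta \<in> mp_bijections nu" by (rule permute_digits_mp[OF bij_digit_shift])
  obtain K where K: "\<And>m. m \<ge> K \<Longrightarrow> {..<N} \<inter> (digit_shift ^^ m) ` {..<N} = {}"
    using digit_shift_leaves[of N] by blast
  have Dx: "x \<in> ?D \<longleftrightarrow> real k / 2 ^ N \<le> (\<Sum>i<N. of_bool (dig i x) / 2 ^ Suc i)" if "x \<in> two_digits" for x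
  proof -
    have x: "x \<in> {0..<1}" using that by (simp add: two_digits_def)
    have "x \<in> ?D \<longleftrightarrow> real k \<le> x * 2 ^ N" using x by (simp add: dyadic_def field_simps)
    also have "\<dots> \<longleftrightarrow> int k \<le> \<lfloor>x * 2 ^ N\<rfloor>" by (simp add: le_floor_iff)
    also have "\<dots> \<longleftrightarrow> real k \<le> of_int \<lfloor>x * 2 ^ N\<rfloor>" by linarith
    also have "\<dots> \<longleftrightarrow> real k / 2 ^ N \<le> of_int \<lfloor>x * 2 ^ N\<rfloor> / 2 ^ N" by (simp add: divide_le_cancel)
    finally show ?thesis unfolding dig_partial_sum[OF x] .
  qed
  have "measure nu (?D \<inter> ((beta ^^ m) -` ?D \<inter> space nu)) = measure nu ?D ^ 2" if m: "m \<ge> K" for m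
  proof -
    let ?A = "{..<N}" and ?s = "digit_shift ^^ m"
    let ?B = "?s ` ?A"
    let ?X = "\<lambda>I x. restrict (\<lambda>i. dig i x) I"
    note bmm = mp_pow[OF bm, of m]
    have bD: "(beta ^^ m) -` ?D \<inter> space nu \<in> sets nu"
      using mp_measurable[OF bmm] dyadic_sets by (rule measurable_sets)
    have ind: "nu.indep_var (PiM ?A (\<lambda>_. coin)) (?X ?A) (PiM ?B (\<lambda>_. coin)) (?X ?B)"
      by (rule nu.indep_var_restrict[OF indep_digits K[OF m]]) auto
    define UA where "UA = {w \<in> space (PiM ?A (\<lambda>_. coin)). real k / 2 ^ N \<le> (\<Sum>i<N. of_bool (w i) / 2 ^ Suc i)}"
    define UB where "UB = {w \<in> space (PiM ?B (\<lambda>_. coin)). real k / 2 ^ N \<le> (\<Sum>i<N. of_bool (w (?s i)) / 2 ^ Suc i)}"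
    have UA: "UA \<in> sets (PiM ?A (\<lambda>_. coin))" unfolding UA_def by measurable
    have UB: "UB \<in> sets (PiM ?B (\<lambda>_. coin))" unfolding UB_def by measurable
    have rv: "?X ?A \<in> nu \<rightarrow>\<^sub>M PiM ?A (\<lambda>_. coin)" "?X ?B \<in> nu \<rightarrow>\<^sub>M PiM ?B (\<lambda>_. coin)"
      using nu.indep_var_rv1[OF ind] nu.indep_var_rv2[OF ind] by auto
    have a: "x \<in> ?D \<longleftrightarrow> ?X ?A x \<in> UA" if "x \<in> two_digits" for x
      unfolding Dx[OF that] UA_def by (simp add: space_PiM)
    have b: "(beta ^^ m) x \<in> ?D \<longleftrightarrow> ?X ?B x \<in> UB" if "x \<in> two_digits" for x
      unfolding Dx[OF beta_pow(1)[OF that]] UB_def by (simp add: space_PiM beta_pow(2)[OF that])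
    have "measure nu (?D \<inter> ((beta ^^ m) -` ?D \<inter> space nu)) = measure nu ((\<lambda>x. (?X ?A x, ?X ?B x)) -` (UA \<times> UB) \<inter> space nu)"
    proof (rule measure_eq_AE)
      show "AE x in nu. x \<in> ?D \<inter> ((beta ^^ m) -` ?D \<inter> space nu) \<longleftrightarrow> x \<in> (\<lambda>x. (?X ?A x, ?X ?B x)) -` (UA \<times> UB) \<inter> space nu"
        using AE_two_digits AE_space by eventually_elim (simp add: a b)
      show "?D \<inter> ((beta ^^ m) -` ?D \<inter> space nu) \<in> sets nu" using dyadic_sets bD by auto
      show "(\<lambda>x. (?X ?A x, ?X ?B x)) -` (UA \<times> UB) \<inter> space nu \<in> sets nu"
        using UA UB by (intro measurable_sets[OF measurable_Pair[OF rv]]) auto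
    qed
    also have "\<dots> = measure nu (?X ?A -` UA \<inter> space nu) * measure nu (?X ?B -` UB \<inter> space nu)"
      by (rule nu.indep_varD[OF ind UA UB])
    also have "measure nu (?X ?A -` UA \<inter> space nu) = measure nu ?D"
    proof (rule measure_eq_AE)
      show "AE x in nu. x \<in> ?X ?A -` UA \<inter> space nu \<longleftrightarrow> x \<in> ?D"
        using AE_two_digits AE_space by eventually_elim (simp add: a)
    qed (use measurable_sets[OF rv(1) UA] dyadic_sets in auto)
    also have "measure nu (?X ?B -` UB \<inter> space nu) = measure nu ((beta ^^ m) -` ?D \<inter> space nu)"
    proof (rule measure_eq_AE)
      show "AE x in nu. x \<in> ?X ?B -` UB \<inter> space nu \<longleftrightarrow> x \<in> (beta ^^ m) -` ?D \<inter> space nu"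
        using AE_two_digits AE_space by eventually_elim (simp add: b)
    qed (use measurable_sets[OF rv(2) UB] bD in auto)
    also have "\<dots> = measure nu ?D" unfolding measure_def using mp_emeasure_vimage[OF bmm dyadic_sets] by simp
    finally show ?thesis by (simp add: power2_eq_square)
  qed
  then show thesis by (rule that)
qed

section \<open>A mean ergodic theorem for bounded observables\<close>

definition convex_weights :: "nat \<Rightarrow> (nat \<Rightarrow> real) \<Rightarrow> bool" where
  "convex_weights n p \<longleftrightarrow> (\<forall>a. 0 \<le> p a) \<and> (\<Sum>a<n. p a) = 1"

text \<open>Bounded measurable functions replace the Hilbert space \<open>L^2\<close>: all products
  are integrable, and limits are taken pointwise almost everywhere.\<close>

locale bounded_observable = prob_space +
  fixes \<tau> :: "'a \<Rightarrow> 'a" and f :: "'a \<Rightarrow> real"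
  assumes tau_measurable[measurable]: "\<tau> \<in> M \<rightarrow>\<^sub>M M" and tau_distr: "distr M M \<tau> = M"
    and f_measurable[measurable]: "f \<in> borel_measurable M" and f_bound: "\<bar>f x\<bar> \<le> 1"
begin

definition orbit_average :: "nat \<Rightarrow> (nat \<Rightarrow> real) \<Rightarrow> 'a \<Rightarrow> real" where
  "orbit_average n p x = (\<Sum>a<n. p a * f ((\<tau> ^^ a) x))"

lemma integrable_bounded:
  fixes g :: "'a \<Rightarrow> real"
  shows "g \<in> borel_measurable M \<Longrightarrow> (\<And>x. \<bar>g x\<bar> \<le> c) \<Longrightarrow> integrable M g"
  by (rule integrable_const_bound[where B = c]) auto

lemma tau_pow_measurable[measurable]: "(\<tau> ^^ a) \<in> M \<rightarrow>\<^sub>M M"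
  by (rule measurable_compose_n) measurable

lemma integral_tau:
  fixes g :: "'a \<Rightarrow> real"
  assumes "g \<in> borel_measurable M" shows "(\<integral>x. g (\<tau> x) \<partial>M) = (\<integral>x. g x \<partial>M)"
  using integral_distr[OF tau_measurable assms] by (simp add: tau_distr)

lemma AE_tau: "AE x in M. P x \<Longrightarrow> AE x in M. P (\<tau> x)"
  by (rule AE_distrD[OF tau_measurable]) (simp only: tau_distr)

text \<open>Nonnegativity of the variance, in the role of the Cauchy-Schwarz inequality.\<close>

lemma square_integral_le:
  fixes g :: "'a \<Rightarrow> real"
  assumes [measurable]: "g \<in> borel_measurable M" and b: "\<And>x. \<bar>g x\<bar> \<le> c"
  shows "(\<integral>x. g x \<partial>M)\<^sup>2 \<le> (\<integral>x. (g x)\<^sup>2 \<partial>M)"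
proof -
  have "integrable M g" by (rule integrable_bounded[of _ c]) (use b in auto)
  moreover have "integrable M (\<lambda>x. (g x)\<^sup>2)"
  proof (rule integrable_bounded[of _ "c\<^sup>2"])
    show "\<bar>(g x)\<^sup>2\<bar> \<le> c\<^sup>2" for x
      using abs_le_square_iff[of "g x" c] b[of x] by simp
  qed measurable
  ultimately show ?thesis using variance_eq[of g] variance_positive[of g] by simp
qed

lemma invariant_integral_shift:
  assumes E[measurable]: "E \<in> sets M" and inv: "AE x in M. \<tau> x \<in> E \<longleftrightarrow> x \<in> E"
  shows "(\<integral>x. indicator E x * f ((\<tau> ^^ a) x) \<partial>M) = (\<integral>x. indicator E x * f x \<partial>M)"
proof (induction a)
  case (Suc a)
  have "(\<integral>x. indicator E x * f ((\<tau> ^^ Suc a) x) \<partial>M) = (\<integral>x. indicator E (\<tau> x) * f ((\<tau> ^^ a) (\<tau> x)) \<partial>M)"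
  proof (rule integral_cong_AE)
    show "AE x in M. indicator E x * f ((\<tau> ^^ Suc a) x) = indicator E (\<tau> x) * f ((\<tau> ^^ a) (\<tau> x))"
      using inv by eventually_elim (simp add: indicator_def funpow_swap1)
  qed measurable
  also have "\<dots> = (\<integral>x. indicator E x * f ((\<tau> ^^ a) x) \<partial>M)" by (rule integral_tau) measurable
  finally show ?case using Suc by simp
qed simp

text \<open>Integrals over an invariant set do not see translations, so every average of translates
  has the same integral over \<open>E\<close> as \<open>f\<close>. The times \<open>s i\<close> are
  free because the ergodic theorem uses consecutive times and the mixing criterion sparse
  ones.\<close>

lemma invariant_integral_le:
  assumes E[measurable]: "E \<in> sets M" and inv: "AE x in M. \<tau> x \<in> E \<longleftrightarrow> x \<in> E"
    and p: "(\<Sum>i<n. p i) = (1::real)"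
  shows "(\<integral>x. indicator E x * f x \<partial>M)\<^sup>2 \<le> (\<integral>x. (\<Sum>i<n. p i * f ((\<tau> ^^ s i) x))\<^sup>2 \<partial>M)"
proof -
  let ?g = "\<lambda>x. \<Sum>i<n. p i * f ((\<tau> ^^ s i) x)"
  have gb: "\<bar>?g x\<bar> \<le> (\<Sum>i<n. \<bar>p i\<bar>)" for x
    by (rule order_trans[OF sum_abs]) (intro sum_mono, simp add: abs_mult mult_left_le f_bound)
  have [measurable]: "?g \<in> borel_measurable M" by measurable
  have i: "integrable M (\<lambda>x. indicator E x * f ((\<tau> ^^ s i) x))" for i
    by (rule integrable_bounded[of _ 1]) (auto simp: indicator_def f_bound)
  have "(\<integral>x. indicator E x * ?g x \<partial>M) = (\<integral>x. (\<Sum>i<n. p i * (indicator E x * f ((\<tau> ^^ s i) x))) \<partial>M)"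
    by (simp add: sum_distrib_left mult_ac)
  also have "\<dots> = (\<Sum>i<n. p i * (\<integral>x. indicator E x * f ((\<tau> ^^ s i) x) \<partial>M))"
    using i by (subst Bochner_Integration.integral_sum) auto
  also have "\<dots> = (\<integral>x. indicator E x * f x \<partial>M)"
    using p by (simp add: invariant_integral_shift[OF E inv] sum_distrib_right[symmetric])
  finally have "(\<integral>x. indicator E x * f x \<partial>M)\<^sup>2 = (\<integral>x. indicator E x * ?g x \<partial>M)\<^sup>2" by simp
  also have "\<dots> \<le> (\<integral>x. (indicator E x * ?g x)\<^sup>2 \<partial>M)"
    by (rule square_integral_le[of _ "\<Sum>i<n. \<bar>p i\<bar>"]) (use gb in \<open>auto simp: indicator_def intro: sum_nonneg\<close>)
  also have "\<dots> \<le> (\<integral>x. (?g x)\<^sup>2 \<partial>M)"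
  proof (rule integral_mono)
    have sb: "(?g x)\<^sup>2 \<le> (\<Sum>i<n. \<bar>p i\<bar>)\<^sup>2" for x using power_mono[OF gb[of x], of 2] by simp
    show "integrable M (\<lambda>x. (?g x)\<^sup>2)" "integrable M (\<lambda>x. (indicator E x * ?g x)\<^sup>2)"
      by (rule integrable_bounded[of _ "(\<Sum>i<n. \<bar>p i\<bar>)\<^sup>2"]; use sb in \<open>auto simp: indicator_def\<close>)+
  qed (auto simp: indicator_def)
  finally show ?thesis .
qed

section \<open>Elements of minimal norm in the convex hull of an orbit\<close>

text \<open>Closed under just the two operations of the minimal norm argument: midpoints for the
  parallelogram law and translation for the invariance of the limit.\<close>

inductive_set convex_orbit :: "('a \<Rightarrow> real) set" where
  base: "f \<in> convex_orbit"
| midpoint: "g \<in> convex_orbit \<Longrightarrow> h \<in> convex_orbit \<Longrightarrow> (\<lambda>x. (g x + h x) / 2) \<in> convex_orbit"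
| shift: "g \<in> convex_orbit \<Longrightarrow> (\<lambda>x. g (\<tau> x)) \<in> convex_orbit"

lemma convex_orbit_measurable: "g \<in> convex_orbit \<Longrightarrow> g \<in> borel_measurable M"
  by (induction rule: convex_orbit.induct) auto

lemma convex_orbit_bound: "g \<in> convex_orbit \<Longrightarrow> \<bar>g x\<bar> \<le> 1"
proof (induction arbitrary: x rule: convex_orbit.induct)
  case (midpoint g h) from midpoint.IH[of x] show ?case by auto
qed (auto simp: f_bound)

lemma convex_orbit_orthogonal:
  assumes E[measurable]: "E \<in> sets M" and inv: "AE x in M. \<tau> x \<in> E \<longleftrightarrow> x \<in> E"
    and f0: "(\<integral>x. indicator E x * f x \<partial>M) = 0" and g: "g \<in> convex_orbit"
  shows "(\<integral>x. indicator E x * g x \<partial>M) = 0"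
  using g
proof (induction rule: convex_orbit.induct)
  case base then show ?case by (rule f0)
next
  case (midpoint g h)
  have "integrable M (\<lambda>x. indicator E x * u x)" if "u \<in> convex_orbit" for u
    using convex_orbit_measurable[OF that] convex_orbit_bound[OF that]
    by (intro integrable_bounded[of _ 1]) (auto simp: indicator_def)
  then have "(\<integral>x. (indicator E x * g x + indicator E x * h x) / 2 \<partial>M) = 0"
    using midpoint by simp
  then show ?case by (simp add: algebra_simps)
next
  case (shift g)
  note [measurable] = convex_orbit_measurable[OF shift.hyps(1)]
  have "(\<integral>x. indicator E x * g (\<tau> x) \<partial>M) = (\<integral>x. indicator E (\<tau> x) * g (\<tau> x) \<partial>M)"
  proof (rule integral_cong_AE)
    show "AE x in M. indicator E x * g (\<tau> x) = indicator E (\<tau> x) * g (\<tau> x)"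
      using inv by eventually_elim (simp add: indicator_def)
  qed measurable
  also have "\<dots> = (\<integral>x. indicator E x * g x \<partial>M)" by (rule integral_tau) measurable
  finally show ?case using shift.IH by simp
qed

text \<open>Weights vanishing from \<open>n\<close> on let two averages be rewritten with the common
  length \<open>max n m\<close>; a translation moves every weight up by one index.\<close>

lemma convex_orbit_average:
  "g \<in> convex_orbit \<Longrightarrow> \<exists>n p. convex_weights n p \<and> (\<forall>a\<ge>n. p a = 0) \<and> g = orbit_average n p"
proof (induction rule: convex_orbit.induct)
  case base
  show ?case
    by (rule exI[of _ 1], rule exI[of _ "\<lambda>a. if a = 0 then 1 else 0"])
      (auto simp: convex_weights_def orbit_average_def fun_eq_iff)
next
  case (midpoint g h)
  then obtain n p m q where p: "convex_weights n p" "\<forall>a\<ge>n. p a = 0" "g = orbit_average n p"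
    and q: "convex_weights m q" "\<forall>a\<ge>m. q a = 0" "h = orbit_average m q" by blast
  let ?k = "max n m"
  have pk: "(\<Sum>a<n. p a * u a) = (\<Sum>a<?k. p a * u a)" for u :: "nat \<Rightarrow> real"
    by (rule sum.mono_neutral_left) (use p(2) in auto)
  have qk: "(\<Sum>a<m. q a * u a) = (\<Sum>a<?k. q a * u a)" for u :: "nat \<Rightarrow> real"
    by (rule sum.mono_neutral_left) (use q(2) in auto)
  have "convex_weights ?k (\<lambda>a. (p a + q a) / 2)"
    using p(1) q(1) pk[of "\<lambda>_. 1"] qk[of "\<lambda>_. 1"]
    by (auto simp: convex_weights_def sum_divide_distrib[symmetric] sum.distrib)
  moreover have "(\<lambda>x. (g x + h x) / 2) = orbit_average ?k (\<lambda>a. (p a + q a) / 2)"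
    unfolding p(3) q(3) orbit_average_def pk qk
    by (simp add: fun_eq_iff sum.distrib[symmetric] sum_divide_distrib add_divide_distrib algebra_simps)
  ultimately show ?case using p(2) q(2)
    by (intro exI[of _ ?k] exI[of _ "\<lambda>a. (p a + q a) / 2"]) auto
next
  case (shift g)
  then obtain n p where p: "convex_weights n p" "\<forall>a\<ge>n. p a = 0" "g = orbit_average n p" by blast
  let ?q = "\<lambda>a. case a of 0 \<Rightarrow> 0 | Suc b \<Rightarrow> p b"
  have "convex_weights (Suc n) ?q"
    using p(1) by (auto simp: convex_weights_def sum.lessThan_Suc_shift simp del: sum.lessThan_Suc split: nat.split)
  moreover have "(\<lambda>x. g (\<tau> x)) = orbit_average (Suc n) ?q"
    unfolding p(3) orbit_average_def
    by (simp add: fun_eq_iff sum.lessThan_Suc_shift funpow_swap1 del: sum.lessThan_Suc)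
  ultimately show ?case using p(2)
    by (intro exI[of _ "Suc n"] exI[of _ ?q]) (auto split: nat.split)
qed

text \<open>Norms bounded by \<open>(1/4)^i\<close> make the first moments summable, so the sum of
  the absolute values has finite integral and is finite almost everywhere. Pointwise limits thus
  replace the completeness of \<open>L^2\<close>.\<close>

lemma AE_summable_geometric:
  fixes u :: "nat \<Rightarrow> 'a \<Rightarrow> real"
  assumes [measurable]: "\<And>i. u i \<in> borel_measurable M" and b: "\<And>i x. \<bar>u i x\<bar> \<le> c"
    and s: "\<And>i. (\<integral>x. (u i x)\<^sup>2 \<partial>M) \<le> ((1/4) ^ i)\<^sup>2"
  shows "AE x in M. summable (\<lambda>i. \<bar>u i x\<bar>)"
proof -
  have "(\<integral>x. \<bar>u i x\<bar> \<partial>M) \<le> (1/4) ^ i" for i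
  proof -
    have "(\<integral>x. \<bar>u i x\<bar> \<partial>M)\<^sup>2 \<le> (\<integral>x. \<bar>u i x\<bar>\<^sup>2 \<partial>M)"
      by (rule square_integral_le[of _ c]) (use b in auto)
    also have "\<dots> \<le> ((1/4) ^ i)\<^sup>2" using s[of i] by simp
    finally show ?thesis by (rule power2_le_imp_le) simp
  qed
  moreover have "integrable M (\<lambda>x. \<bar>u i x\<bar>)" for i by (rule integrable_bounded[of _ c]) (use b in auto)
  ultimately have le: "(\<integral>\<^sup>+x. ennreal \<bar>u i x\<bar> \<partial>M) \<le> ennreal ((1/4) ^ i)" for i
    by (simp add: nn_integral_eq_integral ennreal_leI)
  have "(\<integral>\<^sup>+x. (\<Sum>i. ennreal \<bar>u i x\<bar>) \<partial>M) = (\<Sum>i. \<integral>\<^sup>+x. ennreal \<bar>u i x\<bar> \<partial>M)"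
    by (rule nn_integral_suminf) measurable
  also have "\<dots> \<le> (\<Sum>i. ennreal ((1/4) ^ i))" by (rule suminf_le[OF le summableI summableI])
  also have "\<dots> < \<infinity>"
    unfolding infinity_ennreal_def less_top[symmetric]
    by (rule ennreal_suminf_neq_top[OF summable_geometric]) auto
  finally have fin: "(\<integral>\<^sup>+x. (\<Sum>i. ennreal \<bar>u i x\<bar>) \<partial>M) \<noteq> \<infinity>" by (rule less_imp_neq)
  have "AE x in M. (\<Sum>i. ennreal \<bar>u i x\<bar>) \<noteq> \<infinity>"
    by (rule nn_integral_PInf_AE[OF _ fin]) measurable
  then show ?thesis
    by eventually_elim (rule summable_suminf_not_top, simp_all)
qed

text \<open>The functions of almost minimal norm in the convex hull of an orbit form a Cauchy sequence
  by the parallelogram law, and their limit is invariant. Its level sets are orthogonal to \<open>f\<close>.\<close>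

lemma convex_orbit_small:
  assumes orth: "\<And>E. E \<in> sets M \<Longrightarrow> AE x in M. \<tau> x \<in> E \<longleftrightarrow> x \<in> E \<Longrightarrow> (\<integral>x. indicator E x * f x \<partial>M) = 0"
    and e: "e > 0"
  shows "\<exists>g\<in>convex_orbit. (\<integral>x. (g x)\<^sup>2 \<partial>M) < e"
proof -
  define n2 where "n2 g = (\<integral>x. (g x)\<^sup>2 \<partial>M)" for g :: "'a \<Rightarrow> real"
  define a where "a = Inf (n2 ` convex_orbit)"
  have sq: "integrable M (\<lambda>x. g x * h x)" if "g \<in> convex_orbit" "h \<in> convex_orbit" for g h
    using convex_orbit_measurable[OF that(1)] convex_orbit_measurable[OF that(2)]
      mult_mono[OF convex_orbit_bound[OF that(1)] convex_orbit_bound[OF that(2)]]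
    by (intro integrable_bounded[of _ 1]) (auto simp: abs_mult)
  have bdd: "bdd_below (n2 ` convex_orbit)" unfolding n2_def by (rule bdd_belowI2[of _ 0]) simp
  have a_le: "a \<le> n2 g" if "g \<in> convex_orbit" for g
    unfolding a_def by (rule cInf_lower) (use that bdd in auto)
  have par: "n2 (\<lambda>x. g x - h x) = 2 * n2 g + 2 * n2 h - 4 * n2 (\<lambda>x. (g x + h x) / 2)"
    if g: "g \<in> convex_orbit" and h: "h \<in> convex_orbit" for g h
  proof -
    have "n2 (\<lambda>x. g x - h x) = (\<integral>x. (g x * g x - 2 * (g x * h x) + h x * h x) \<partial>M)"
      unfolding n2_def by (simp add: power2_eq_square algebra_simps)
    also have "\<dots> = n2 g - 2 * (\<integral>x. g x * h x \<partial>M) + n2 h"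
      using sq g h unfolding n2_def by (simp add: power2_eq_square)
    finally have 1: "n2 (\<lambda>x. g x - h x) = n2 g - 2 * (\<integral>x. g x * h x \<partial>M) + n2 h" .
    have "n2 (\<lambda>x. (g x + h x) / 2) = (\<integral>x. (g x * g x + 2 * (g x * h x) + h x * h x) / 4 \<partial>M)"
      unfolding n2_def by (simp add: power2_eq_square algebra_simps)
    also have "\<dots> = (n2 g + 2 * (\<integral>x. g x * h x \<partial>M) + n2 h) / 4"
      using sq g h unfolding n2_def by (simp add: power2_eq_square)
    finally show ?thesis using 1 by simp
  qed
  \<comment> \<open>By the parallelogram law two elements of squared norm at most
    \<open>a + d i\<close> have squared distance at most \<open>4 * d i\<close>, which is exactly
    the bound \<open>((1/4) ^ i)^2\<close> of \<open>AE_summable_geometric\<close>.\<close>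
  define d where "d i = ((1/4) ^ i)\<^sup>2 / (4::real)" for i :: nat
  have d0: "d i > 0" and dS: "d (Suc i) \<le> d i" for i by (simp_all add: d_def power2_eq_square)
  have "\<exists>g\<in>convex_orbit. n2 g < a + d i" for i
  proof -
    have "Inf (n2 ` convex_orbit) < a + d i" using d0[of i] by (simp add: a_def)
    then show ?thesis using cInf_lessD[of "n2 ` convex_orbit" "a + d i"] convex_orbit.base by auto
  qed
  then obtain g where g: "\<And>i. g i \<in> convex_orbit" and gn: "\<And>i. n2 (g i) < a + d i" by metis
  have near: "n2 (\<lambda>x. u x - v x) \<le> ((1/4) ^ i)\<^sup>2"
    if "u \<in> convex_orbit" "v \<in> convex_orbit" "n2 u \<le> a + d i" "n2 v \<le> a + d i" for u v i
  proof -
    have "n2 (\<lambda>x. u x - v x) \<le> 4 * d i"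
      using par[OF that(1,2)] a_le[OF convex_orbit.midpoint[OF that(1,2)]] that(3,4) by linarith
    then show ?thesis by (simp add: d_def)
  qed
  note gm[measurable] = convex_orbit_measurable[OF g]
  have gb: "\<bar>g i x\<bar> \<le> 1" for i x by (rule convex_orbit_bound[OF g])
  have "AE x in M. summable (\<lambda>i. \<bar>g (Suc i) x - g i x\<bar>)"
  proof (rule AE_summable_geometric[of _ 2])
    show "(\<integral>x. (g (Suc i) x - g i x)\<^sup>2 \<partial>M) \<le> ((1/4) ^ i)\<^sup>2" for i
      using near[OF g g, of "Suc i" i i] gn[of i] gn[of "Suc i"] dS[of i] by (simp add: n2_def)
    show "\<bar>g (Suc i) x - g i x\<bar> \<le> 2" for i x using gb[of "Suc i" x] gb[of i x] by linarith
  qed measurable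
  then have conv: "AE x in M. convergent (\<lambda>i. g i x)"
  proof eventually_elim
    case (elim x)
    have "summable (\<lambda>i. g (Suc i) x - g i x)" by (rule summable_rabs_cancel[OF elim])
    then have "convergent (\<lambda>n. \<Sum>i<n. g (Suc i) x - g i x)" by (simp add: summable_iff_convergent)
    then have "convergent (\<lambda>n. g n x - g 0 x)" by (simp add: sum_lessThan_telescope[of "\<lambda>i. g i x"])
    then have "convergent (\<lambda>n. (g n x - g 0 x) + g 0 x)" by (intro convergent_add convergent_const)
    then show ?case by simp
  qed
  \<comment> \<open>The translate of \<open>g i\<close> lies in the hull and has the same norm,
    hence is equally close to minimal. So \<open>g i\<close> is close to its own translate, and the
    limit is invariant.\<close>
  have "AE x in M. summable (\<lambda>i. \<bar>g i x - g i (\<tau> x)\<bar>)"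
  proof (rule AE_summable_geometric[of _ 2])
    fix i
    have "n2 (\<lambda>x. g i (\<tau> x)) = n2 (g i)" unfolding n2_def
      using integral_tau[of "\<lambda>x. (g i x)\<^sup>2"] by measurable
    then show "(\<integral>x. (g i x - g i (\<tau> x))\<^sup>2 \<partial>M) \<le> ((1/4) ^ i)\<^sup>2"
      using near[OF g convex_orbit.shift[OF g], of i i i] gn[of i] by (simp add: n2_def)
    show "\<bar>g i x - g i (\<tau> x)\<bar> \<le> 2" for x using gb[of i x] gb[of i "\<tau> x"] by linarith
  qed measurable
  then have inv: "AE x in M. (\<lambda>i. g i x - g i (\<tau> x)) \<longlonglongrightarrow> 0"
    by eventually_elim (auto dest: summable_rabs_cancel summable_LIMSEQ_zero)
  define h where "h x = lim (\<lambda>i. g i x)" for x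
  have [measurable]: "h \<in> borel_measurable M" unfolding h_def by measurable
  have lim: "AE x in M. (\<lambda>i. g i x) \<longlonglongrightarrow> h x"
    using conv by eventually_elim (simp add: h_def convergent_LIMSEQ_iff)
  have hinv: "AE x in M. h (\<tau> x) = h x"
    using lim AE_tau[OF lim] inv
  proof eventually_elim
    case (elim x)
    have "(\<lambda>i. g i x - (g i x - g i (\<tau> x))) \<longlonglongrightarrow> h x - 0" by (intro tendsto_diff elim)
    then have "(\<lambda>i. g i (\<tau> x)) \<longlonglongrightarrow> h x" by simp
    then show ?case using elim(2) LIMSEQ_unique by blast
  qed
  have h1: "AE x in M. \<bar>h x\<bar> \<le> 1"
    using lim by eventually_elim (rule LIMSEQ_le_const2[OF tendsto_rabs], auto simp: gb)
  have "(\<integral>x. indicator E x * h x \<partial>M) = 0"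
    if E[measurable]: "E \<in> sets M" and Einv: "AE x in M. \<tau> x \<in> E \<longleftrightarrow> x \<in> E" for E
  proof -
    have "(\<lambda>i. \<integral>x. indicator E x * g i x \<partial>M) \<longlonglongrightarrow> (\<integral>x. indicator E x * h x \<partial>M)"
    proof (rule integral_dominated_convergence[where w = "\<lambda>_. 1"])
      show "AE x in M. (\<lambda>i. indicator E x * g i x) \<longlonglongrightarrow> indicator E x * h x"
        using lim by eventually_elim (intro tendsto_mult tendsto_const)
    qed (auto simp: indicator_def gb)
    then show ?thesis
      using convex_orbit_orthogonal[OF E Einv orth[OF E Einv] g] by (simp add: LIMSEQ_const_iff)
  qed
  note h_orth = this
  \<comment> \<open>For \<open>u = 1\<close> and \<open>u = -1\<close> the sets where
    \<open>h\<close> is positive or negative are invariant, and \<open>h\<close> integrates to zero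
    over each.\<close>
  have h0: "AE x in M. u * h x \<le> 0" for u :: real
  proof -
    let ?E = "{x \<in> space M. 0 < u * h x}"
    have E: "?E \<in> sets M" by measurable
    have Einv: "AE x in M. \<tau> x \<in> ?E \<longleftrightarrow> x \<in> ?E"
      using hinv AE_space by eventually_elim (simp add: measurable_space[OF tau_measurable])
    have "integrable M (\<lambda>x. indicator ?E x * h x)"
      using h1 by (intro integrable_const_bound[where B = 1]) (auto simp: indicator_def elim: eventually_mono)
    then have I: "integrable M (\<lambda>x. u * (indicator ?E x * h x))" by simp
    have "(\<integral>x. u * (indicator ?E x * h x) \<partial>M) = 0" using h_orth[OF E Einv] by simp
    then have "AE x in M. u * (indicator ?E x * h x) = 0"
      using integral_nonneg_eq_0_iff_AE[OF I] by (auto simp: indicator_def)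
    then show ?thesis using AE_space by eventually_elim (auto simp: indicator_def split: if_splits)
  qed
  have "AE x in M. h x = 0" using h0[of 1] h0[of "-1"] by eventually_elim auto
  with lim have lim0: "AE x in M. (\<lambda>i. g i x) \<longlonglongrightarrow> 0" by eventually_elim simp
  have "(\<lambda>i. n2 (g i)) \<longlonglongrightarrow> (\<integral>x. 0 \<partial>M)"
    unfolding n2_def
  proof (rule integral_dominated_convergence[where w = "\<lambda>_. 1"])
    show "AE x in M. (\<lambda>i. (g i x)\<^sup>2) \<longlonglongrightarrow> 0"
      using lim0 by eventually_elim (use tendsto_power[of _ "0::real" sequentially 2] in auto)
    show "AE x in M. norm ((g i x)\<^sup>2) \<le> 1" for i
      using gb[of i] by (auto simp: abs_square_le_1)
  qed auto
  then have "\<forall>\<^sub>F i in sequentially. n2 (g i) < e" using e by (intro order_tendstoD(2)[where y = 0]) simp_all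
  then obtain i where "n2 (g i) < e" unfolding eventually_sequentially by blast
  then show ?thesis using g unfolding n2_def by blast
qed

text \<open>The right-hand side no longer mentions invariant sets. For a fixed choice of weights it
  bounds one integral, and in the application this integral varies continuously with the
  automorphism.\<close>

lemma mean_ergodic:
  "(\<forall>E\<in>sets M. (AE x in M. \<tau> x \<in> E \<longleftrightarrow> x \<in> E) \<longrightarrow> (\<integral>x. indicator E x * f x \<partial>M) = 0) \<longleftrightarrow>
   (\<forall>e>0. \<exists>n p. convex_weights n p \<and> (\<integral>x. (orbit_average n p x)\<^sup>2 \<partial>M) < e)" (is "?L \<longleftrightarrow> ?R")
proof
  assume L: ?L
  show ?R
  proof (intro allI impI)
    fix e :: real assume "e > 0"
    then obtain g where "g \<in> convex_orbit" "(\<integral>x. (g x)\<^sup>2 \<partial>M) < e" using convex_orbit_small L by blast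
    then show "\<exists>n p. convex_weights n p \<and> (\<integral>x. (orbit_average n p x)\<^sup>2 \<partial>M) < e"
      using convex_orbit_average by blast
  qed
next
  assume R: ?R
  show ?L
  proof (intro ballI impI)
    fix E assume E: "E \<in> sets M" "AE x in M. \<tau> x \<in> E \<longleftrightarrow> x \<in> E"
    have "(\<integral>x. indicator E x * f x \<partial>M)\<^sup>2 \<le> 0"
    proof (rule field_le_epsilon)
      fix e :: real assume "e > 0"
      then obtain n p where p: "convex_weights n p" "(\<integral>x. (orbit_average n p x)\<^sup>2 \<partial>M) < e" using R by blast
      then have "(\<integral>x. indicator E x * f x \<partial>M)\<^sup>2 \<le> (\<integral>x. (orbit_average n p x)\<^sup>2 \<partial>M)"
        unfolding orbit_average_def by (intro invariant_integral_le[OF E]) (simp add: convex_weights_def)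
      then show "(\<integral>x. indicator E x * f x \<partial>M)\<^sup>2 \<le> 0 + e" using p(2) by simp
    qed
    then show "(\<integral>x. indicator E x * f x \<partial>M) = 0" by simp
  qed
qed

text \<open>Translates of \<open>f\<close> at different multiples of \<open>Suc K\<close> are
  orthogonal, so the uniform average of \<open>N\<close> of them has squared norm at most
  \<open>1 / N\<close>, which bounds the squared integral over \<open>E\<close>.\<close>

lemma orthogonal_invariant:
  assumes E: "E \<in> sets M" "AE x in M. \<tau> x \<in> E \<longleftrightarrow> x \<in> E"
    and mix: "\<And>m. m \<ge> K \<Longrightarrow> (\<integral>x. f x * f ((\<tau> ^^ m) x) \<partial>M) = 0"
  shows "(\<integral>x. indicator E x * f x \<partial>M) = 0"
proof -
  let ?s = "\<lambda>i. Suc K * i" and ?f = "\<lambda>i x. f ((\<tau> ^^ (Suc K * i)) x)"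
  have fi: "integrable M (\<lambda>x. ?f i x * ?f j x)" for i j
    by (rule integrable_bounded[of _ 1])
      (use mult_mono[OF f_bound f_bound] in \<open>auto simp: abs_mult\<close>)
  have shift: "(\<integral>x. g ((\<tau> ^^ k) x) \<partial>M) = (\<integral>x. g x \<partial>M)"
    if g[measurable]: "g \<in> borel_measurable M" for g :: "'a \<Rightarrow> real" and k
  proof (induction k)
    case (Suc k)
    have "(\<integral>x. g ((\<tau> ^^ Suc k) x) \<partial>M) = (\<integral>x. g ((\<tau> ^^ k) (\<tau> x)) \<partial>M)" by (simp add: funpow_swap1)
    also have "\<dots> = (\<integral>x. g ((\<tau> ^^ k) x) \<partial>M)" by (rule integral_tau) measurable
    finally show ?case using Suc by simp
  qed simp
  have off: "(\<integral>x. ?f i x * ?f j x \<partial>M) = 0" if "i < j" for i j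
  proof -
    have j: "Suc K * j = Suc K * (j - i) + Suc K * i"
      using that by (metis add_mult_distrib2 le_add_diff_inverse2 less_imp_le)
    have "(\<integral>x. ?f i x * ?f j x \<partial>M) = (\<integral>x. (\<lambda>y. f y * f ((\<tau> ^^ (Suc K * (j - i))) y)) ((\<tau> ^^ (Suc K * i)) x) \<partial>M)"
      unfolding j funpow_add by simp
    also have "\<dots> = (\<integral>x. f x * f ((\<tau> ^^ (Suc K * (j - i))) x) \<partial>M)" by (rule shift) measurable
    also have "\<dots> = 0"
    proof (rule mix)
      have "Suc K * 1 \<le> Suc K * (j - i)" using that by (intro mult_le_mono2) simp
      then show "K \<le> Suc K * (j - i)" by simp
    qed
    finally show ?thesis .
  qed
  have "(\<integral>x. indicator E x * f x \<partial>M)\<^sup>2 \<le> 1 / real (Suc n)" for n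
  proof -
    let ?N = "Suc n"
    have "(\<integral>x. indicator E x * f x \<partial>M)\<^sup>2 \<le> (\<integral>x. (\<Sum>i<?N. (1 / real ?N) * ?f i x)\<^sup>2 \<partial>M)"
      by (rule invariant_integral_le[OF E]) simp
    also have "\<dots> = (\<integral>x. (\<Sum>i<?N. \<Sum>j<?N. (1 / real ?N)\<^sup>2 * (?f i x * ?f j x)) \<partial>M)"
      unfolding power2_eq_square sum_product by (simp only: mult_ac)
    also have "\<dots> = (\<Sum>i<?N. \<Sum>j<?N. (1 / real ?N)\<^sup>2 * (\<integral>x. ?f i x * ?f j x \<partial>M))"
      using fi by (simp only: Bochner_Integration.integral_sum Bochner_Integration.integrable_sum
          integrable_mult_right integral_mult_right_zero)
    also have "\<dots> \<le> (\<Sum>i<?N. \<Sum>j<?N. (1 / real ?N)\<^sup>2 * (if i = j then 1 else 0))"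
    proof (intro sum_mono mult_left_mono)
      fix i j
      have "(\<integral>x. ?f i x * ?f i x \<partial>M) \<le> (\<integral>x. 1 \<partial>M)"
        by (rule integral_mono[OF fi]) (use f_bound in \<open>auto simp: abs_square_le_1 simp flip: power2_eq_square\<close>)
      moreover have "(\<integral>x. ?f i x * ?f j x \<partial>M) = (\<integral>x. ?f j x * ?f i x \<partial>M)" by (simp only: mult.commute)
      ultimately show "(\<integral>x. ?f i x * ?f j x \<partial>M) \<le> (if i = j then 1 else 0)"
        using off[of i j] off[of j i] by (cases i j rule: linorder_cases) (simp_all add: prob_space)
    qed simp
    also have "\<dots> = (\<Sum>i<?N. (1 / real ?N)\<^sup>2)"
      by (intro sum.cong refl) (simp add: sum_distrib_left[symmetric] del: sum.lessThan_Suc)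
    also have "\<dots> = 1 / real ?N" by (simp add: power2_eq_square del: sum.lessThan_Suc)
    finally show ?thesis .
  qed
  then have "(\<integral>x. indicator E x * f x \<partial>M)\<^sup>2 \<le> 0"
    by (intro LIMSEQ_le_const[OF LIMSEQ_Suc[OF lim_1_over_n]]) auto
  then show ?thesis by simp
qed

end

section \<open>Sets determined by the base coordinate\<close>

lemma nu_set_borel_AE:
  assumes "A \<in> sets nu"
  obtains B where "B \<in> sets borel" "B \<subseteq> {0..1}" "AE x in nu. x \<in> A \<longleftrightarrow> x \<in> B"
proof -
  let ?L = "restrict_space lborel {0..1::real}"
  have A: "A \<in> sets (completion ?L)" using assms nu_completion by simp
  have "AE x in nu. x \<in> A \<longleftrightarrow> x \<in> main_part ?L A"
    using AE_completion[OF AE_notin_null_part[OF A]] unfolding nu_completion[symmetric]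
    by eventually_elim (use main_part_null_part_Un[OF A] in blast)
  moreover have "main_part ?L A \<in> sets borel" "main_part ?L A \<subseteq> {0..1}"
    using main_part_sets[OF A] by (simp_all add: sets_restrict_space_iff)
  ultimately show thesis using that by blast
qed

text \<open>Adding 1 to the floor gives the first multiple of \<open>1 / 2^n\<close> strictly beyond
  \<open>x\<close>; these points decrease to \<open>x\<close> as \<open>n\<close> grows.\<close>

lemma greaterThan_dyadic:
  assumes x: "0 \<le> x"
  shows "{x<..} \<inter> {0..1} = (\<Union>n. dyadic n (nat (\<lfloor>x * 2 ^ n\<rfloor> + 1)))"
    and "incseq (\<lambda>n. dyadic n (nat (\<lfloor>x * 2 ^ n\<rfloor> + 1)))"
proof -
  have k: "real (nat (\<lfloor>x * 2 ^ n\<rfloor> + 1)) = of_int \<lfloor>x * 2 ^ n\<rfloor> + 1" for n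
    using x by (simp add: of_nat_nat)
  show "{x<..} \<inter> {0..1} = (\<Union>n. dyadic n (nat (\<lfloor>x * 2 ^ n\<rfloor> + 1)))"
  proof (intro set_eqI iffI)
    fix y assume y: "y \<in> {x<..} \<inter> {0..1}"
    then obtain n where n: "(1/2) ^ n < y - x" using real_arch_pow_inv[of "y - x" "1/2"] by auto
    have "of_int \<lfloor>x * 2 ^ n\<rfloor> + 1 \<le> x * 2 ^ n + 1" by simp
    also have "\<dots> = (x + (1/2) ^ n) * 2 ^ n" by (simp add: algebra_simps power_divide)
    also have "\<dots> \<le> y * 2 ^ n" using n by (intro mult_right_mono) auto
    finally have "y \<in> dyadic n (nat (\<lfloor>x * 2 ^ n\<rfloor> + 1))"
      using y unfolding dyadic_def k by (simp add: divide_le_eq)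
    then show "y \<in> (\<Union>n. dyadic n (nat (\<lfloor>x * 2 ^ n\<rfloor> + 1)))" by blast
  next
    fix y assume "y \<in> (\<Union>n. dyadic n (nat (\<lfloor>x * 2 ^ n\<rfloor> + 1)))"
    then obtain n where n: "of_int \<lfloor>x * 2 ^ n\<rfloor> + 1 \<le> y * 2 ^ n" "y \<le> 1"
      unfolding dyadic_def k by (auto simp: divide_le_eq)
    have "x * 2 ^ n < of_int \<lfloor>x * 2 ^ n\<rfloor> + 1" by linarith
    then have "x * 2 ^ n < y * 2 ^ n" using n(1) by linarith
    then show "y \<in> {x<..} \<inter> {0..1}" using n x by simp
  qed
  show "incseq (\<lambda>n. dyadic n (nat (\<lfloor>x * 2 ^ n\<rfloor> + 1)))"
  proof (rule incseq_SucI)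
    fix n
    have "x * 2 ^ Suc n < 2 * (of_int \<lfloor>x * 2 ^ n\<rfloor> + 1)"
    proof -
      have "x * 2 ^ n < of_int \<lfloor>x * 2 ^ n\<rfloor> + 1" by linarith
      then have "2 * (x * 2 ^ n) < 2 * (of_int \<lfloor>x * 2 ^ n\<rfloor> + 1)" by (rule mult_strict_left_mono) simp
      moreover have "x * 2 ^ Suc n = 2 * (x * 2 ^ n)" by simp
      ultimately show ?thesis by (simp only:)
    qed
    then have "\<lfloor>x * 2 ^ Suc n\<rfloor> < 2 * (\<lfloor>x * 2 ^ n\<rfloor> + 1)" by (simp add: floor_less_iff)
    then have "\<lfloor>x * 2 ^ Suc n\<rfloor> + 1 \<le> 2 * (\<lfloor>x * 2 ^ n\<rfloor> + 1)" by linarith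
    then have "of_int (\<lfloor>x * 2 ^ Suc n\<rfloor> + 1) \<le> (of_int (2 * (\<lfloor>x * 2 ^ n\<rfloor> + 1)) :: real)" by (simp only: of_int_le_iff)
    then have "(of_int \<lfloor>x * 2 ^ Suc n\<rfloor> + 1) / 2 ^ Suc n \<le> (2 * (of_int \<lfloor>x * 2 ^ n\<rfloor> + 1)) / (2 ^ Suc n :: real)"
      by (intro divide_right_mono) simp_all
    also have "(2 * (of_int \<lfloor>x * 2 ^ n\<rfloor> + 1)) / (2 ^ Suc n :: real) = (of_int \<lfloor>x * 2 ^ n\<rfloor> + 1) / 2 ^ n"
      unfolding power_Suc by (rule mult_divide_mult_cancel_left) simp
    finally have "(of_int \<lfloor>x * 2 ^ Suc n\<rfloor> + 1) / 2 ^ Suc n \<le> (of_int \<lfloor>x * 2 ^ n\<rfloor> + 1) / (2 ^ n :: real)" .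
    then show "dyadic n (nat (\<lfloor>x * 2 ^ n\<rfloor> + 1)) \<subseteq> dyadic (Suc n) (nat (\<lfloor>x * 2 ^ Suc n\<rfloor> + 1))"
      unfolding dyadic_def k by auto
  qed
qed

text \<open>As functions of \<open>A\<close>, both sides are finite measures on the line, images
  under \<open>\<pi>\<close> of weighted restrictions of \<open>\<Theta>\<close>. They agree on open
  half-lines by monotone limits of dyadic ones, hence on Borel sets, and every set of
  \<open>nu\<close> is Borel up to a null set.\<close>

lemma dyadic_determined:
  assumes fin: "finite_measure \<Theta>" and pr: "\<pi> \<in> \<Theta> \<rightarrow>\<^sub>M nu" "distr \<Theta> nu \<pi> = nu"
    and G: "G1 \<in> sets \<Theta>" "G2 \<in> sets \<Theta>" and c: "0 \<le> c1" "0 \<le> c2"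
    and eq: "\<And>N k. c1 * measure \<Theta> (G1 \<inter> \<pi> -` dyadic N k) = c2 * measure \<Theta> (G2 \<inter> \<pi> -` dyadic N k)"
    and A: "A \<in> sets nu"
  shows "c1 * measure \<Theta> (G1 \<inter> \<pi> -` A) = c2 * measure \<Theta> (G2 \<inter> \<pi> -` A)"
proof -
  interpret \<Theta>: finite_measure \<Theta> by fact
  have sp: "\<pi> w \<in> {0..1}" if "w \<in> space \<Theta>" for w using measurable_space[OF pr(1) that] by (simp add: space_nu)
  have pb[measurable]: "\<pi> \<in> borel_measurable \<Theta>"
    using measurable_compose[OF pr(1) measurable_nu_borel[of "\<lambda>x. x" borel]] by simp
  have Gm: "G \<inter> \<pi> -` B = G \<inter> (\<pi> -` B \<inter> space \<Theta>)" if "G \<in> sets \<Theta>" for G B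
    using sets.sets_into_space[OF that] by blast
  have Gs: "G \<inter> \<pi> -` B \<in> sets \<Theta>" if "G \<in> sets \<Theta>" "B \<in> sets borel" for G B
    unfolding Gm[OF that(1)] using that measurable_sets[OF pb that(2)] by auto
  have Gn: "G \<inter> \<pi> -` B \<in> sets \<Theta>" if "G \<in> sets \<Theta>" "B \<in> sets nu" for G B
    unfolding Gm[OF that(1)] using that measurable_sets[OF pr(1) that(2)] by auto
  define m where "m c G = distr (density \<Theta> (\<lambda>w. ennreal c * indicator G w)) borel \<pi>" for c G
  have em: "emeasure (m c G) B = ennreal (c * measure \<Theta> (G \<inter> \<pi> -` B))"
    if G[measurable]: "G \<in> sets \<Theta>" and c: "0 \<le> c" and B: "B \<in> sets borel" for c G B
  proof -
    let ?B = "\<pi> -` B \<inter> space \<Theta>"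
    have B'[measurable]: "?B \<in> sets \<Theta>" using measurable_sets[OF pb B] .
    have "emeasure (m c G) B = emeasure (density \<Theta> (\<lambda>w. ennreal c * indicator G w)) ?B"
      unfolding m_def using B by (subst emeasure_distr) auto
    also have "\<dots> = (\<integral>\<^sup>+w. ennreal c * (indicator G w * indicator ?B w) \<partial>\<Theta>)"
      by (subst emeasure_density) (auto simp: mult.assoc)
    also have "\<dots> = (\<integral>\<^sup>+w. ennreal c * indicator (G \<inter> ?B) w \<partial>\<Theta>)"
      by (simp add: indicator_inter_arith)
    also have "\<dots> = ennreal c * emeasure \<Theta> (G \<inter> ?B)" by (subst nn_integral_cmult_indicator) auto
    also have "\<dots> = ennreal (c * measure \<Theta> (G \<inter> ?B))"
      using c by (simp add: \<Theta>.emeasure_eq_measure ennreal_mult)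
    finally show ?thesis unfolding Gm[OF G] .
  qed
  have dy: "dyadic n k \<in> sets borel" for n k by (simp add: dyadic_def)
  have eq_gt: "c1 * measure \<Theta> (G1 \<inter> \<pi> -` {x<..}) = c2 * measure \<Theta> (G2 \<inter> \<pi> -` {x<..})" for x
  proof (cases "0 \<le> x")
    case True
    let ?d = "\<lambda>n. dyadic n (nat (\<lfloor>x * 2 ^ n\<rfloor> + 1))"
    have lim: "(\<lambda>n. measure \<Theta> (G \<inter> \<pi> -` ?d n)) \<longlonglongrightarrow> measure \<Theta> (G \<inter> \<pi> -` {x<..})" if G: "G \<in> sets \<Theta>" for G
    proof -
      have "(\<lambda>n. measure \<Theta> (G \<inter> \<pi> -` ?d n)) \<longlonglongrightarrow> measure \<Theta> (\<Union>n. G \<inter> \<pi> -` ?d n)"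
      proof (rule \<Theta>.finite_Lim_measure_incseq)
        show "range (\<lambda>n. G \<inter> \<pi> -` ?d n) \<subseteq> sets \<Theta>" using Gs[OF G dy] by blast
        show "incseq (\<lambda>n. G \<inter> \<pi> -` ?d n)"
          using greaterThan_dyadic(2)[OF True] unfolding incseq_def by blast
      qed
      moreover have "(\<Union>n. G \<inter> \<pi> -` ?d n) = G \<inter> \<pi> -` ({x<..} \<inter> {0..1})"
        unfolding greaterThan_dyadic(1)[OF True] by blast
      moreover have "\<dots> = G \<inter> \<pi> -` {x<..}" using sets.sets_into_space[OF G] sp by blast
      ultimately show ?thesis by simp
    qed
    have "(\<lambda>n. c1 * measure \<Theta> (G1 \<inter> \<pi> -` ?d n)) \<longlonglongrightarrow> c1 * measure \<Theta> (G1 \<inter> \<pi> -` {x<..})"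
      by (intro tendsto_mult tendsto_const lim G)
    moreover have "(\<lambda>n. c1 * measure \<Theta> (G1 \<inter> \<pi> -` ?d n)) \<longlonglongrightarrow> c2 * measure \<Theta> (G2 \<inter> \<pi> -` {x<..})"
      unfolding eq by (intro tendsto_mult tendsto_const lim G)
    ultimately show ?thesis by (rule LIMSEQ_unique)
  next
    case False
    \<comment> \<open>A half-line starting below 0 contains the whole interval, which is
      \<open>dyadic 0 0\<close>.\<close>
    have "G \<inter> \<pi> -` {x<..} = G \<inter> \<pi> -` dyadic 0 0" if G: "G \<in> sets \<Theta>" for G
      using sets.sets_into_space[OF G] sp False by (force simp: dyadic_def)
    then show ?thesis using eq[of 0 0] G by simp
  qed
  have "m c1 G1 = m c2 G2"
  proof (rule measure_eqI_lessThan)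
    show "sets (m c1 G1) = sets borel" "sets (m c2 G2) = sets borel" by (simp_all add: m_def)
    show "emeasure (m c1 G1) {x<..} < \<infinity>" for x using em[OF G(1) c(1), of "{x<..}"] by simp
    show "emeasure (m c1 G1) {x<..} = emeasure (m c2 G2) {x<..}" for x
      using em[OF G(1) c(1), of "{x<..}"] em[OF G(2) c(2), of "{x<..}"] eq_gt by simp
  qed
  obtain B where B: "B \<in> sets borel" "AE x in nu. x \<in> A \<longleftrightarrow> x \<in> B" using nu_set_borel_AE[OF A] by blast
  have "AE x in distr \<Theta> nu \<pi>. x \<in> A \<longleftrightarrow> x \<in> B" unfolding pr(2) by (rule B(2))
  then have "AE w in \<Theta>. \<pi> w \<in> A \<longleftrightarrow> \<pi> w \<in> B" by (rule AE_distrD[OF pr(1)])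
  then have AB: "measure \<Theta> (G \<inter> \<pi> -` A) = measure \<Theta> (G \<inter> \<pi> -` B)" if "G \<in> sets \<Theta>" for G
    by (intro \<Theta>.finite_measure_eq_AE Gn[OF that A] Gs[OF that B(1)]) auto
  have "ennreal (c1 * measure \<Theta> (G1 \<inter> \<pi> -` B)) = ennreal (c2 * measure \<Theta> (G2 \<inter> \<pi> -` B))"
    using em[OF G(1) c(1) B(1)] em[OF G(2) c(2) B(1)] \<open>m c1 G1 = m c2 G2\<close> by simp
  then show ?thesis using c AB[OF G(1)] AB[OF G(2)] by (simp add: ennreal_inj)
qed

section \<open>The fibre product in three coordinates\<close>

abbreviation triple :: "(real \<times> real \<times> real) measure" where
  "triple \<equiv> nu \<Otimes>\<^sub>M (nu \<Otimes>\<^sub>M nu)"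

text \<open>Parametrises the fibre product by \<open>(z, y, y')\<close>. In these coordinates the
  relative product is the ordinary product of three copies of \<open>nu\<close>, so Fubini's theorem
  applies.\<close>

definition share_base :: "real \<times> real \<times> real \<Rightarrow> (real \<times> real) \<times> (real \<times> real)" where
  "share_base w = ((fst w, fst (snd w)), (fst w, snd (snd w)))"

lemma prob_space_triple: "prob_space triple"
  by (intro prob_space_pair nu.prob_space_axioms nn.prob_space_axioms)

lemma share_base_measurable: "share_base \<in> triple \<rightarrow>\<^sub>M rel_product0"
proof -
  have "share_base \<in> triple \<rightarrow>\<^sub>M (nu \<Otimes>\<^sub>M nu) \<Otimes>\<^sub>M (nu \<Otimes>\<^sub>M nu)"
    unfolding share_base_def by measurable
  then show ?thesis by (simp add: measurable_cong_sets[OF refl sets_rel_product0])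
qed

lemma share_base_distr: "distr triple rel_product0 share_base = rel_product0"
proof (rule rel_product0_eqI)
  fix P Q assume P: "P \<in> sets (nu \<Otimes>\<^sub>M nu)" and Q: "Q \<in> sets (nu \<Otimes>\<^sub>M nu)"
  have PQ: "P \<times> Q \<in> sets rel_product0" using P Q by (simp add: sets_rel_product0)
  let ?X = "share_base -` (P \<times> Q) \<inter> space triple"
  have X: "?X \<in> sets triple" using share_base_measurable PQ by (rule measurable_sets)
  have "emeasure (distr triple rel_product0 share_base) (P \<times> Q) = emeasure triple ?X"
    using share_base_measurable PQ by (rule emeasure_distr)
  also have "\<dots> = (\<integral>\<^sup>+z. emeasure (nu \<Otimes>\<^sub>M nu) (Pair z -` ?X) \<partial>nu)"
    by (rule sigma_finite_measure.emeasure_pair_measure_alt[OF nn.sigma_finite_measure_axioms X])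
  also have "\<dots> = (\<integral>\<^sup>+z. emeasure nu (Pair z -` P) * emeasure nu (Pair z -` Q) \<partial>nu)"
  proof (rule nn_integral_cong)
    fix z assume z: "z \<in> space nu"
    have "Pair z -` ?X = (Pair z -` P) \<times> (Pair z -` Q)"
      using z sets.sets_into_space[OF P] sets.sets_into_space[OF Q]
      by (auto simp: share_base_def space_pair_measure)
    then show "emeasure (nu \<Otimes>\<^sub>M nu) (Pair z -` ?X) = emeasure nu (Pair z -` P) * emeasure nu (Pair z -` Q)"
      using nu.emeasure_pair_measure_Times[OF sets_Pair1[OF P] sets_Pair1[OF Q]] by simp
  qed
  finally show "emeasure (distr triple rel_product0 share_base) (P \<times> Q) =
      (\<integral>\<^sup>+z. emeasure nu (Pair z -` P) * emeasure nu (Pair z -` Q) \<partial>nu)" .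
qed simp

lemma distr_pair_snd:
  assumes N: "prob_space N" and M: "prob_space M" shows "distr (N \<Otimes>\<^sub>M M) M snd = M"
proof (rule measure_eqI)
  fix A assume "A \<in> sets (distr (N \<Otimes>\<^sub>M M) M snd)"
  then have A: "A \<in> sets M" by simp
  interpret M: prob_space M by fact
  have "snd -` A \<inter> space (N \<Otimes>\<^sub>M M) = space N \<times> A"
    using sets.sets_into_space[OF A] by (auto simp: space_pair_measure)
  then show "emeasure (distr (N \<Otimes>\<^sub>M M) M snd) A = emeasure M A"
    using A M.emeasure_pair_measure_Times[of "space N" N A] prob_space.emeasure_space_1[OF N]
    by (simp add: emeasure_distr)
qed simp

lemma measure_rel_product_rectangle:
  assumes "A \<in> sets nu" "D \<in> sets nu" "A' \<in> sets nu" "D' \<in> sets nu"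
  shows "measure rel_product ((A \<times> D) \<times> (A' \<times> D')) = measure nu (A \<inter> A') * measure nu D * measure nu D'"
proof -
  have "emeasure rel_product ((A \<times> D) \<times> (A' \<times> D')) =
      (\<integral>\<^sup>+z. emeasure nu (Pair z -` (A \<times> D)) * emeasure nu (Pair z -` (A' \<times> D')) \<partial>nu)"
    using assms by (intro emeasure_rel_product) auto
  also have "\<dots> = (\<integral>\<^sup>+z. (emeasure nu D * emeasure nu D') * indicator (A \<inter> A') z \<partial>nu)"
    by (intro nn_integral_cong) (auto simp: indicator_def)
  also have "\<dots> = (emeasure nu D * emeasure nu D') * emeasure nu (A \<inter> A')"
    using assms by (intro nn_integral_cmult_indicator) auto
  finally show ?thesis by (simp add: measure_def enn2real_mult mult_ac)
qed

text \<open>The hypothesis says that on generating sets \<open>E\<close> is independent of the fibre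
  coordinates given the base. Then the indicator of \<open>E\<close> and a function of
  \<open>z\<close> alone are densities of the same measure, hence equal almost everywhere.\<close>

lemma base_determined:
  assumes E: "E \<in> sets rel_product"
    and dy: "\<And>N k N1 k1 N2 k2. measure rel_product (E \<inter> ((dyadic N k \<times> dyadic N1 k1) \<times> ({0..1} \<times> dyadic N2 k2))) =
      measure nu (dyadic N1 k1) * measure nu (dyadic N2 k2) *
      measure rel_product (E \<inter> ((dyadic N k \<times> {0..1}) \<times> ({0..1} \<times> {0..1})))"
  shows "\<exists>b\<in>sets nu. AE p in rel_product. p \<in> E \<longleftrightarrow> fst (fst p) \<in> b"
proof -
  interpret t: prob_space triple by (rule prob_space_triple)
  let ?I = "{0..1::real}" and ?nn = "nu \<Otimes>\<^sub>M nu"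
  have I: "?I \<in> sets nu" using sets.top[of nu] by (simp add: space_nu)
  have Ec: "E \<in> sets (completion rel_product0)" using E by (simp add: rel_product_def)
  \<comment> \<open>\<open>E\<close> belongs only to the completion; its main part has a measurable
    preimage in \<open>triple\<close>.\<close>
  define E0 where "E0 = main_part rel_product0 E"
  have E0: "E0 \<in> sets rel_product0" unfolding E0_def by (rule main_part_sets[OF Ec])
  have EE0: "AE p in rel_product. p \<in> E \<longleftrightarrow> p \<in> E0"
    using AE_completion[OF AE_notin_null_part[OF Ec]] unfolding rel_product_def E0_def
    by eventually_elim (use main_part_null_part_Un[OF Ec] in blast)
  define E' where "E' = share_base -` E0 \<inter> space triple"
  have E'[measurable]: "E' \<in> sets triple" unfolding E'_def by (rule measurable_sets[OF share_base_measurable E0])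
  have E's: "w \<in> space triple" if "w \<in> E'" for w using that unfolding E'_def by simp
  have transfer: "measure rel_product (E \<inter> ((A \<times> D) \<times> (?I \<times> D'))) = measure triple (E' \<inter> (A \<times> (D \<times> D')))"
    if A: "A \<in> sets nu" and D: "D \<in> sets nu" and D': "D' \<in> sets nu" for A D D'
  proof -
    let ?X = "(A \<times> D) \<times> (?I \<times> D')"
    have X: "?X \<in> sets rel_product0" using A D D' I by (simp add: sets_rel_product0)
    have "measure rel_product (E \<inter> ?X) = measure rel_product (E0 \<inter> ?X)"
    proof (rule measure_eq_AE)
      show "AE x in rel_product. x \<in> E \<inter> ?X \<longleftrightarrow> x \<in> E0 \<inter> ?X" using EE0 by eventually_elim simp
      show "E \<inter> ?X \<in> sets rel_product" "E0 \<inter> ?X \<in> sets rel_product"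
        using E E0 X by (auto simp: rel_product_def)
    qed
    also have "\<dots> = measure rel_product0 (E0 \<inter> ?X)" using E0 X unfolding rel_product_def by (intro measure_completion) auto
    also have "\<dots> = measure (distr triple rel_product0 share_base) (E0 \<inter> ?X)" by (simp only: share_base_distr)
    also have "\<dots> = measure triple (share_base -` (E0 \<inter> ?X) \<inter> space triple)"
      by (rule measure_distr[OF share_base_measurable]) (use E0 X in auto)
    also have "share_base -` (E0 \<inter> ?X) \<inter> space triple = E' \<inter> (A \<times> (D \<times> D'))"
      unfolding E'_def share_base_def by (auto simp: space_pair_measure space_nu)
    finally show ?thesis .
  qed
  have p1: "fst \<in> triple \<rightarrow>\<^sub>M nu" "distr triple nu fst = nu"
    using prob_space.distr_pair_fst[OF nn.prob_space_axioms, of nu] by simp_all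
  have p2: "(\<lambda>w. fst (snd w)) \<in> triple \<rightarrow>\<^sub>M nu" "distr triple nu (\<lambda>w. fst (snd w)) = nu"
  proof -
    show "(\<lambda>w. fst (snd w)) \<in> triple \<rightarrow>\<^sub>M nu" by measurable
    have "distr triple nu (\<lambda>w. fst (snd w)) = distr (distr triple ?nn snd) nu fst"
      by (subst distr_distr) (auto simp: comp_def)
    then show "distr triple nu (\<lambda>w. fst (snd w)) = nu"
      unfolding distr_pair_snd[OF nu.prob_space_axioms nn.prob_space_axioms] by (simp add: nu.distr_pair_fst)
  qed
  have p3: "(\<lambda>w. snd (snd w)) \<in> triple \<rightarrow>\<^sub>M nu" "distr triple nu (\<lambda>w. snd (snd w)) = nu"
  proof -
    show "(\<lambda>w. snd (snd w)) \<in> triple \<rightarrow>\<^sub>M nu" by measurable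
    have "distr triple nu (\<lambda>w. snd (snd w)) = distr (distr triple ?nn snd) nu snd"
      by (subst distr_distr) (auto simp: comp_def)
    then show "distr triple nu (\<lambda>w. snd (snd w)) = nu"
      unfolding distr_pair_snd[OF nu.prob_space_axioms nn.prob_space_axioms]
      by (simp add: distr_pair_snd[OF nu.prob_space_axioms nu.prob_space_axioms])
  qed
  have pm: "measure triple (space triple \<inter> \<pi> -` A) = measure nu A"
    if "\<pi> \<in> triple \<rightarrow>\<^sub>M nu" "distr triple nu \<pi> = nu" "A \<in> sets nu" for \<pi> A
    using measure_distr[OF that(1,3)] that(2) by (simp add: Int_commute)
  define m where "m A D D' = measure triple (E' \<inter> (A \<times> (D \<times> D')))" for A D D'
  have rect: "A \<times> (D \<times> D') \<in> sets triple" if "A \<in> sets nu" "D \<in> sets nu" "D' \<in> sets nu" for A D D'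
    using that by auto
  have s1: "E' \<inter> (A \<times> (D \<times> D')) = (E' \<inter> (?I \<times> (D \<times> D'))) \<inter> fst -` A" for A D D'
    using E's by (auto simp: space_pair_measure space_nu)
  have s2: "E' \<inter> (A \<times> (D \<times> D')) = (E' \<inter> (A \<times> (?I \<times> D'))) \<inter> (\<lambda>w. fst (snd w)) -` D" for A D D'
    using E's by (auto simp: space_pair_measure space_nu)
  have s3: "E' \<inter> (A \<times> (D \<times> D')) = (E' \<inter> (A \<times> (D \<times> ?I))) \<inter> (\<lambda>w. snd (snd w)) -` D'" for A D D'
    using E's by (auto simp: space_pair_measure space_nu)
  note dyS = dyadic_sets
  have h0: "m (dyadic N k) (dyadic N1 k1) (dyadic N2 k2) =
      measure nu (dyadic N1 k1) * measure nu (dyadic N2 k2) * m (dyadic N k) ?I ?I" for N k N1 k1 N2 k2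
    using dy[of N k N1 k1 N2 k2] transfer[OF dyS dyS dyS] transfer[OF dyS I I] by (simp add: m_def)
  \<comment> \<open>Dyadic sets are now replaced by arbitrary ones in one coordinate at a time,
    first in the base and then in the two fibres.\<close>
  have h1: "m A (dyadic N1 k1) (dyadic N2 k2) =
      measure nu (dyadic N1 k1) * measure nu (dyadic N2 k2) * m A ?I ?I" if A: "A \<in> sets nu" for A N1 k1 N2 k2
  proof -
    have "1 * measure triple ((E' \<inter> (?I \<times> (dyadic N1 k1 \<times> dyadic N2 k2))) \<inter> fst -` A) =
      (measure nu (dyadic N1 k1) * measure nu (dyadic N2 k2)) * measure triple ((E' \<inter> (?I \<times> (?I \<times> ?I))) \<inter> fst -` A)"
    proof (rule dyadic_determined[OF t.finite_measure_axioms p1 _ _ _ _ _ A])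
      show "1 * measure triple ((E' \<inter> (?I \<times> (dyadic N1 k1 \<times> dyadic N2 k2))) \<inter> fst -` dyadic N k) =
        (measure nu (dyadic N1 k1) * measure nu (dyadic N2 k2)) * measure triple ((E' \<inter> (?I \<times> (?I \<times> ?I))) \<inter> fst -` dyadic N k)" for N k
        using h0[of N k N1 k1 N2 k2] unfolding m_def s1[of "dyadic N k"] by simp
    qed (use rect[OF I dyS dyS] rect[OF I I I] E' in auto)
    then show ?thesis unfolding m_def s1[of A] by simp
  qed
  have h2: "m A D (dyadic N2 k2) = measure nu D * measure nu (dyadic N2 k2) * m A ?I ?I"
    if A: "A \<in> sets nu" and D: "D \<in> sets nu" for A D N2 k2
  proof -
    have "1 * measure triple ((E' \<inter> (A \<times> (?I \<times> dyadic N2 k2))) \<inter> (\<lambda>w. fst (snd w)) -` D) =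
      (measure nu (dyadic N2 k2) * m A ?I ?I) * measure triple (space triple \<inter> (\<lambda>w. fst (snd w)) -` D)"
    proof (rule dyadic_determined[OF t.finite_measure_axioms p2 _ _ _ _ _ D])
      show "1 * measure triple ((E' \<inter> (A \<times> (?I \<times> dyadic N2 k2))) \<inter> (\<lambda>w. fst (snd w)) -` dyadic N k) =
        (measure nu (dyadic N2 k2) * m A ?I ?I) * measure triple (space triple \<inter> (\<lambda>w. fst (snd w)) -` dyadic N k)" for N k
        using h1[OF A, of N k N2 k2] pm[OF p2 dyS, of N k] unfolding m_def s2[of A "dyadic N k"] by simp
    qed (use rect[OF A I dyS] E' in \<open>auto simp: m_def\<close>)
    then show ?thesis unfolding m_def s2[of A D] using pm[OF p2 D] by simp
  qed
  have h3: "m A D D' = measure nu D * measure nu D' * m A ?I ?I"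
    if A: "A \<in> sets nu" and D: "D \<in> sets nu" and D': "D' \<in> sets nu" for A D D'
  proof -
    have "1 * measure triple ((E' \<inter> (A \<times> (D \<times> ?I))) \<inter> (\<lambda>w. snd (snd w)) -` D') =
      (measure nu D * m A ?I ?I) * measure triple (space triple \<inter> (\<lambda>w. snd (snd w)) -` D')"
    proof (rule dyadic_determined[OF t.finite_measure_axioms p3 _ _ _ _ _ D'])
      show "1 * measure triple ((E' \<inter> (A \<times> (D \<times> ?I))) \<inter> (\<lambda>w. snd (snd w)) -` dyadic N k) =
        (measure nu D * m A ?I ?I) * measure triple (space triple \<inter> (\<lambda>w. snd (snd w)) -` dyadic N k)" for N k
        using h2[OF A D, of N k] pm[OF p3 dyS, of N k] unfolding m_def s3[of A D "dyadic N k"] by simp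
    qed (use rect[OF A D I] E' in \<open>auto simp: m_def\<close>)
    then show ?thesis unfolding m_def s3[of A D D'] using pm[OF p3 D'] by simp
  qed
  have II: "?I \<times> ?I = space ?nn" by (simp add: space_pair_measure space_nu)
  \<comment> \<open>For fixed \<open>A\<close> both sides are measures in \<open>B\<close>;
    \<open>h3\<close> compares them on rectangles, which suffices.\<close>
  have h4: "emeasure triple (E' \<inter> A \<times> B) = emeasure triple (E' \<inter> A \<times> space ?nn) * emeasure ?nn B"
    if A: "A \<in> sets nu" and B: "B \<in> sets ?nn" for A B
  proof -
    define G where "G = E' \<inter> A \<times> space ?nn"
    have G[measurable]: "G \<in> sets triple" unfolding G_def using A by auto
    let ?m1 = "distr (density triple (indicator G)) ?nn snd"
    let ?m2 = "density ?nn (\<lambda>_. emeasure triple G)"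
    have e1: "emeasure ?m1 B = emeasure triple (E' \<inter> A \<times> B)" if B: "B \<in> sets ?nn" for B
    proof -
      have "emeasure ?m1 B = emeasure triple (G \<inter> (snd -` B \<inter> space triple))"
        using B by (simp add: emeasure_distr emeasure_density indicator_inter_arith[symmetric] measurable_sets[OF measurable_snd])
      also have "G \<inter> (snd -` B \<inter> space triple) = E' \<inter> A \<times> B"
        using sets.sets_into_space[OF B] E's unfolding G_def by auto
      finally show ?thesis .
    qed
    have "?m1 = ?m2"
    proof (rule rectangle_measure_eqI)
      have "emeasure ?m1 (space ?m1) \<noteq> \<infinity>" using e1[of "space ?nn"] t.emeasure_finite by simp
      then show "finite_measure ?m1" by (rule finite_measureI)
      fix D D' assume D: "D \<in> sets nu" and D': "D' \<in> sets nu"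
      have "emeasure ?m1 (D \<times> D') = ennreal (measure nu D * measure nu D' * m A ?I ?I)"
        using e1[of "D \<times> D'"] D D' h3[OF A D D'] by (simp add: t.emeasure_eq_measure m_def)
      also have "\<dots> = emeasure triple G * (emeasure nu D * emeasure nu D')"
        unfolding m_def II G_def t.emeasure_eq_measure nu.emeasure_eq_measure by (simp add: ennreal_mult mult_ac)
      also have "\<dots> = emeasure ?m2 (D \<times> D')"
        using D D' by (simp add: emeasure_density_const nu.emeasure_pair_measure_Times)
      finally show "emeasure ?m1 (D \<times> D') = emeasure ?m2 (D \<times> D')" .
    qed simp_all
    then show ?thesis using e1[OF B] B by (simp add: emeasure_density_const G_def)
  qed
  \<comment> \<open>The conditional measure of \<open>E'\<close> given the base point
    \<open>z\<close>.\<close>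
  define e where "e z = emeasure ?nn (Pair z -` E')" for z
  have e[measurable]: "e \<in> borel_measurable nu"
    unfolding e_def by (rule sigma_finite_measure.measurable_emeasure_Pair[OF nn.sigma_finite_measure_axioms E'])
  have e_int: "(\<integral>\<^sup>+z. e z * indicator A z \<partial>nu) = emeasure triple (E' \<inter> A \<times> space ?nn)" if A: "A \<in> sets nu" for A
  proof -
    have X: "E' \<inter> A \<times> space ?nn \<in> sets triple" using A by auto
    have "emeasure triple (E' \<inter> A \<times> space ?nn) = (\<integral>\<^sup>+z. emeasure ?nn (Pair z -` (E' \<inter> A \<times> space ?nn)) \<partial>nu)"
      by (rule sigma_finite_measure.emeasure_pair_measure_alt[OF nn.sigma_finite_measure_axioms X])
    also have "\<dots> = (\<integral>\<^sup>+z. e z * indicator A z \<partial>nu)"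
    proof (rule nn_integral_cong)
      fix z
      have "Pair z -` (E' \<inter> A \<times> space ?nn) = (if z \<in> A then Pair z -` E' else {})"
        using E's by (auto simp: space_pair_measure)
      then show "emeasure ?nn (Pair z -` (E' \<inter> A \<times> space ?nn)) = e z * indicator A z" by (simp add: e_def)
    qed
    finally show ?thesis by simp
  qed
  have dens: "density triple (indicator E') = density triple (\<lambda>w. e (fst w))"
  proof (rule rectangle_measure_eqI)
    have "emeasure (density triple (indicator E')) (space (density triple (indicator E'))) = emeasure triple E'"
      by (simp add: emeasure_density indicator_inter_arith[symmetric] E's Int_absorb2 subsetI)
    then show "finite_measure (density triple (indicator E'))"
      using t.emeasure_finite by (intro finite_measureI) simp
    fix A B assume A: "A \<in> sets nu" and B: "B \<in> sets ?nn"
    have AB: "A \<times> B \<in> sets triple" using A B by auto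
    have "emeasure (density triple (indicator E')) (A \<times> B) = emeasure triple (E' \<inter> A \<times> B)"
      using AB by (simp add: emeasure_density indicator_inter_arith[symmetric])
    also have "\<dots> = (\<integral>\<^sup>+z. e z * indicator A z \<partial>nu) * emeasure ?nn B" by (simp add: h4[OF A B] e_int[OF A])
    also have "\<dots> = (\<integral>\<^sup>+z. (e z * indicator A z) * emeasure ?nn B \<partial>nu)"
      using A by (intro nn_integral_multc[symmetric]) auto
    also have "\<dots> = (\<integral>\<^sup>+z. \<integral>\<^sup>+v. (e z * indicator A z) * indicator B v \<partial>?nn \<partial>nu)"
      using B by (simp add: nn_integral_cmult_indicator)
    also have "\<dots> = (\<integral>\<^sup>+z. \<integral>\<^sup>+v. e (fst (z, v)) * indicator (A \<times> B) (z, v) \<partial>?nn \<partial>nu)"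
      by (intro nn_integral_cong) (simp add: indicator_times mult.assoc)
    also have "\<dots> = (\<integral>\<^sup>+w. e (fst w) * indicator (A \<times> B) w \<partial>triple)"
    proof (rule sigma_finite_measure.nn_integral_fst[OF nn.sigma_finite_measure_axioms])
      note AB[measurable] measurable_compose[OF measurable_fst e, measurable]
      show "(\<lambda>w. e (fst w) * indicator (A \<times> B) w) \<in> borel_measurable triple" by measurable
    qed
    also have "\<dots> = emeasure (density triple (\<lambda>w. e (fst w))) (A \<times> B)"
      using AB by (subst emeasure_density) auto
    finally show "emeasure (density triple (indicator E')) (A \<times> B) = emeasure (density triple (\<lambda>w. e (fst w))) (A \<times> B)" .
  qed simp_all
  have ae: "AE w in triple. (indicator E' w :: ennreal) = e (fst w)"
    by (rule t.density_unique[OF _ _ dens]) measurable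
  \<comment> \<open>An indicator equal to \<open>e (fst w)\<close> forces the value 0 or 1 almost
    everywhere, so \<open>E'\<close> is the part over \<open>e z = 1\<close>.\<close>
  define b where "b = {z \<in> space nu. e z = 1}"
  have b[measurable]: "b \<in> sets nu" unfolding b_def by measurable
  have "AE w in triple. share_base w \<in> E0 \<longleftrightarrow> fst (fst (share_base w)) \<in> b"
    using ae AE_space
  proof eventually_elim
    case (elim w)
    then have "fst w \<in> space nu" by (auto simp: space_pair_measure)
    then show ?case using elim unfolding b_def E'_def share_base_def
      by (auto simp: indicator_def split: if_splits)
  qed
  moreover have "{p \<in> space rel_product0. p \<in> E0 \<longleftrightarrow> fst (fst p) \<in> b} \<in> sets rel_product0"
  proof -
    have "(\<lambda>p. fst (fst p)) \<in> rel_product0 \<rightarrow>\<^sub>M nu"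
      by (simp add: measurable_cong_sets[OF sets_rel_product0 refl])
    then have [measurable]: "Measurable.pred rel_product0 (\<lambda>p. fst (fst p) \<in> b)" using b by measurable
    note E0[measurable]
    show ?thesis by measurable
  qed
  ultimately have "AE p in distr triple rel_product0 share_base. p \<in> E0 \<longleftrightarrow> fst (fst p) \<in> b"
    by (subst AE_distr_iff[OF share_base_measurable])
  then have "AE p in rel_product. p \<in> E0 \<longleftrightarrow> fst (fst p) \<in> b"
    unfolding share_base_distr rel_product_def by (rule AE_completion)
  with EE0 have "AE p in rel_product. p \<in> E \<longleftrightarrow> fst (fst p) \<in> b" by eventually_elim simp
  then show ?thesis using b by blast
qed

section \<open>Relative weak mixing is a \<open>G\<^sub>\<delta>\<close> condition\<close>

text \<open>The observable has conditional expectation zero over the base.\<close>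

definition obs :: "real set \<Rightarrow> real set \<Rightarrow> real set \<Rightarrow> (real \<times> real) \<times> (real \<times> real) \<Rightarrow> real" where
  "obs A D D' p = indicator ((A \<times> D) \<times> ({0..1} \<times> D')) p -
     measure nu D * measure nu D' * indicator ((A \<times> {0..1}) \<times> ({0..1} \<times> {0..1})) p"

lemma unit_sets: "{0..1} \<in> sets nu" and measure_unit: "measure nu {0..1} = 1"
  using sets.top[of nu] nu.prob_space by (simp_all add: space_nu)

lemma rectangle_sets:
  assumes "A \<in> sets nu" "D \<in> sets nu" "A' \<in> sets nu" "D' \<in> sets nu"
  shows "(A \<times> D) \<times> (A' \<times> D') \<in> sets rel_product" "A \<times> D \<in> sets mu"
proof -
  have m: "A \<times> D \<in> sets mu" if "A \<in> sets nu" "D \<in> sets nu" for A D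
    using that sets_nn_subset_mu by auto
  show "(A \<times> D) \<times> (A' \<times> D') \<in> sets rel_product" "A \<times> D \<in> sets mu"
    using rel_product_times[OF m m] m assms by auto
qed

lemma obs_measurable:
  assumes "A \<in> sets nu" "D \<in> sets nu" "D' \<in> sets nu"
  shows "obs A D D' \<in> borel_measurable rel_product"
proof -
  note [measurable] = rectangle_sets(1)[OF assms(1,2) unit_sets assms(3)]
    rectangle_sets(1)[OF assms(1) unit_sets unit_sets unit_sets]
  show ?thesis unfolding obs_def[abs_def] by measurable
qed

lemma obs_bound: "\<bar>obs A D D' p\<bar> \<le> 1"
proof -
  have "measure nu D * measure nu D' \<le> 1" "0 \<le> measure nu D * measure nu D'"
    by (auto intro: mult_le_one)
  then show ?thesis unfolding obs_def by (auto simp: indicator_def)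
qed

lemma bounded_observable_obs:
  assumes "extends T T0" "A \<in> sets nu" "D \<in> sets nu" "D' \<in> sets nu"
  shows "bounded_observable rel_product (map_prod T T) (obs A D D')"
  using prob_space_rel_product extends_map_prod[OF assms(1)] obs_measurable[OF assms(2-4)] obs_bound
  by (simp add: bounded_observable_def bounded_observable_axioms_def)

lemma obs_integral:
  assumes E: "E \<in> sets rel_product" and A: "A \<in> sets nu" "D \<in> sets nu" "D' \<in> sets nu"
  shows "(\<integral>p. indicator E p * obs A D D' p \<partial>rel_product) =
     measure rel_product (E \<inter> ((A \<times> D) \<times> ({0..1} \<times> D'))) -
     measure nu D * measure nu D' * measure rel_product (E \<inter> ((A \<times> {0..1}) \<times> ({0..1} \<times> {0..1})))"
proof -
  interpret prob_space rel_product by (rule prob_space_rel_product)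
  let ?X = "(A \<times> D) \<times> ({0..1} \<times> D')" and ?Y = "(A \<times> {0..1}) \<times> ({0..1} \<times> {0..1})"
  have m: "E \<inter> ?X \<in> sets rel_product" "E \<inter> ?Y \<in> sets rel_product"
    using E rectangle_sets(1)[OF A(1,2) unit_sets A(3)] rectangle_sets(1)[OF A(1) unit_sets unit_sets unit_sets] by auto
  have "(\<integral>p. indicator E p * obs A D D' p \<partial>rel_product) =
     (\<integral>p. indicator (E \<inter> ?X) p - measure nu D * measure nu D' * indicator (E \<inter> ?Y) p \<partial>rel_product)"
    by (intro Bochner_Integration.integral_cong refl) (auto simp: obs_def indicator_def)
  also have "\<dots> = measure rel_product (E \<inter> ?X) - measure nu D * measure nu D' * measure rel_product (E \<inter> ?Y)"
    using m by (subst Bochner_Integration.integral_diff) (auto simp: emeasure_eq_measure)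
  finally show ?thesis .
qed

text \<open>A set from the base is orthogonal to functions with mean zero on the fibres. Conversely,
  orthogonality to the dyadic observables is the hypothesis of
  \<open>base_determined\<close>.\<close>

lemma rel_weak_mixing_iff_orthogonal:
  assumes ext: "extends T T0"
  shows "rel_weak_mixing T \<longleftrightarrow> (\<forall>N k N1 k1 N2 k2. \<forall>E\<in>sets rel_product.
    (AE p in rel_product. map_prod T T p \<in> E \<longleftrightarrow> p \<in> E) \<longrightarrow>
    (\<integral>p. indicator E p * obs (dyadic N k) (dyadic N1 k1) (dyadic N2 k2) p \<partial>rel_product) = 0)"
    (is "_ \<longleftrightarrow> ?R")
proof
  assume wm: "rel_weak_mixing T"
  show ?R
  proof (intro allI ballI impI)
    fix N k N1 k1 N2 k2 E
    assume E: "E \<in> sets rel_product" and inv: "AE p in rel_product. map_prod T T p \<in> E \<longleftrightarrow> p \<in> E"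
    obtain b where b: "b \<in> sets nu" and Eb: "AE p in rel_product. p \<in> E \<longleftrightarrow> fst (fst p) \<in> b"
      using wm E inv unfolding rel_weak_mixing_def by blast
    let ?A = "dyadic N k"
    have Ab: "?A \<inter> b \<in> sets nu" using b dyadic_sets by auto
    have sub: "?A \<inter> b \<inter> {0..1} = ?A \<inter> b" using sets.sets_into_space[OF b] by (auto simp: space_nu)
    have *: "measure rel_product (E \<inter> ((?A \<times> D) \<times> ({0..1} \<times> D'))) = measure nu (?A \<inter> b) * measure nu D * measure nu D'"
      if D: "D \<in> sets nu" "D' \<in> sets nu" for D D'
    proof -
      have "measure rel_product (E \<inter> ((?A \<times> D) \<times> ({0..1} \<times> D'))) =
          measure rel_product (((?A \<inter> b) \<times> D) \<times> ({0..1} \<times> D'))"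
      proof (rule measure_eq_AE)
        show "AE p in rel_product. p \<in> E \<inter> ((?A \<times> D) \<times> ({0..1} \<times> D')) \<longleftrightarrow> p \<in> ((?A \<inter> b) \<times> D) \<times> ({0..1} \<times> D')"
          using Eb by eventually_elim (auto simp: mem_Times_iff)
        show "E \<inter> ((?A \<times> D) \<times> ({0..1} \<times> D')) \<in> sets rel_product" "((?A \<inter> b) \<times> D) \<times> ({0..1} \<times> D') \<in> sets rel_product"
          using E rectangle_sets(1)[OF dyadic_sets D(1) unit_sets D(2)] rectangle_sets(1)[OF Ab D(1) unit_sets D(2)] by auto
      qed
      also have "\<dots> = measure nu (?A \<inter> b \<inter> {0..1}) * measure nu D * measure nu D'"
        by (rule measure_rel_product_rectangle[OF Ab D(1) unit_sets D(2)])
      finally show ?thesis unfolding sub .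
    qed
    show "(\<integral>p. indicator E p * obs ?A (dyadic N1 k1) (dyadic N2 k2) p \<partial>rel_product) = 0"
      unfolding obs_integral[OF E dyadic_sets dyadic_sets dyadic_sets] *[OF dyadic_sets dyadic_sets]
        *[OF unit_sets unit_sets] by (simp add: measure_unit)
  qed
next
  assume R: ?R
  show "rel_weak_mixing T"
    unfolding rel_weak_mixing_def
  proof (intro ballI impI)
    fix E assume E: "E \<in> sets rel_product" "AE p in rel_product. map_prod T T p \<in> E \<longleftrightarrow> p \<in> E"
    show "\<exists>b\<in>sets nu. AE p in rel_product. p \<in> E \<longleftrightarrow> fst (fst p) \<in> b"
    proof (rule base_determined[OF E(1)])
      fix N k N1 k1 N2 k2
      have "(\<integral>p. indicator E p * obs (dyadic N k) (dyadic N1 k1) (dyadic N2 k2) p \<partial>rel_product) = 0"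
        using R E by blast
      then show "measure rel_product (E \<inter> ((dyadic N k \<times> dyadic N1 k1) \<times> ({0..1} \<times> dyadic N2 k2))) =
        measure nu (dyadic N1 k1) * measure nu (dyadic N2 k2) *
        measure rel_product (E \<inter> ((dyadic N k \<times> {0..1}) \<times> ({0..1} \<times> {0..1})))"
        unfolding obs_integral[OF E(1) dyadic_sets dyadic_sets dyadic_sets] by simp
    qed
  qed
qed

section \<open>Continuity of the averages in the weak topology\<close>

text \<open>The squared norm of an orbit average, with \<open>T\<close> as an explicit argument
  because it is now \<open>T\<close> that varies.\<close>

definition square_average ::
    "(real \<times> real \<Rightarrow> real \<times> real) \<Rightarrow> ((real \<times> real) \<times> (real \<times> real) \<Rightarrow> real) \<Rightarrow> nat \<Rightarrow> (nat \<Rightarrow> real) \<Rightarrow> real" where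
  "square_average T f n p = (\<integral>x. (\<Sum>a<n. p a * f ((map_prod T T ^^ a) x))\<^sup>2 \<partial>rel_product)"

lemma rel_weak_mixing_iff_average:
  assumes ext: "extends T T0"
  shows "rel_weak_mixing T \<longleftrightarrow> (\<forall>N k N1 k1 N2 k2. \<forall>e>0. \<exists>n p. convex_weights n p \<and>
    square_average T (obs (dyadic N k) (dyadic N1 k1) (dyadic N2 k2)) n p < e)"
proof -
  have "(\<forall>E\<in>sets rel_product. (AE p in rel_product. map_prod T T p \<in> E \<longleftrightarrow> p \<in> E) \<longrightarrow>
      (\<integral>p. indicator E p * obs (dyadic N k) (dyadic N1 k1) (dyadic N2 k2) p \<partial>rel_product) = 0) \<longleftrightarrow>
    (\<forall>e>0. \<exists>n p. convex_weights n p \<and>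
      square_average T (obs (dyadic N k) (dyadic N1 k1) (dyadic N2 k2)) n p < e)" for N k N1 k1 N2 k2
  proof -
    interpret bounded_observable rel_product "map_prod T T" "obs (dyadic N k) (dyadic N1 k1) (dyadic N2 k2)"
      by (rule bounded_observable_obs[OF ext dyadic_sets dyadic_sets dyadic_sets])
    show ?thesis using mean_ergodic unfolding orbit_average_def square_average_def .
  qed
  then show ?thesis unfolding rel_weak_mixing_iff_orthogonal[OF ext] by simp
qed

text \<open>Induction on the exponent: first the outer \<open>T^a\<close> is replaced by
  \<open>S^a\<close>, at a cost that composition with the measure preserving \<open>T\<close> does
  not change, and then the innermost \<open>T\<close> by \<open>S\<close>, which is a single basic
  neighbourhood condition.\<close>

lemma power_close:
  assumes fin: "finite_measure M" and C: "C \<in> Aut M" and S: "S \<in> C" and P: "P \<in> sets M" and e: "e > 0"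
  shows "\<exists>V. openin (weak_topology M) V \<and> C \<in> V \<and>
    (\<forall>D\<in>V. \<forall>T\<in>D. (\<integral>x. \<bar>indicator P ((T ^^ a) x) - indicator P ((S ^^ a) x)\<bar> \<partial>M) < (e::real))"
  using P e
proof (induction a arbitrary: P e)
  case 0
  have "openin (weak_topology M) (Aut M)" using openin_topspace[of "weak_topology M"] by (simp add: topspace_weak_topology)
  then show ?case using C 0 by (intro exI[of _ "Aut M"]) simp
next
  case (Suc a)
  interpret finite_measure M by (rule fin)
  have Sm: "S \<in> mp_bijections M" by (rule Aut_rep[OF C S])
  note P[measurable] = Suc.prems(1)
  have e2: "e / 2 > 0" using Suc.prems by simp
  obtain V1 where V1: "openin (weak_topology M) V1" "C \<in> V1"
    "\<And>D T. D \<in> V1 \<Longrightarrow> T \<in> D \<Longrightarrow> (\<integral>x. \<bar>indicator P ((T ^^ a) x) - indicator P ((S ^^ a) x)\<bar> \<partial>M) < e / 2"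
    using Suc.IH[OF P e2] by blast
  define B where "B = (S ^^ a) -` P \<inter> space M"
  have B[measurable]: "B \<in> sets M" unfolding B_def by (rule measurable_sets[OF mp_measurable[OF mp_pow[OF Sm]] P])
  \<comment> \<open>\<open>S\<close> maps this set onto \<open>B\<close>. So the mismatch between
    the preimages of \<open>B\<close> under \<open>T\<close> and \<open>S\<close> has the measure of
    the symmetric difference of the images of \<open>A\<close>, which the weak topology
    controls.\<close>
  define A where "A = S -` B \<inter> space M"
  have A[measurable]: "A \<in> sets M" unfolding A_def by (rule measurable_sets[OF mp_measurable[OF Sm] B])
  have As: "A \<subseteq> space M" using A by (rule sets.sets_into_space)
  define V2 where "V2 = {D \<in> Aut M. \<forall>T\<in>D. \<forall>S\<in>C. measure M (sym_diff (T ` A) (S ` A)) < e / 2}"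
  have V2: "openin (weak_topology M) V2"
    unfolding weak_topology_def V2_def by (rule topology_generated_by_Basis) (use A C e2 in blast)
  have CV2: "C \<in> V2"
    using aut_ball_iff[OF fin C C A S S, of "e / 2"] C e2 by (simp add: V2_def)
  have "(\<integral>x. \<bar>indicator P ((T ^^ Suc a) x) - indicator P ((S ^^ Suc a) x)\<bar> \<partial>M) < e"
    if D: "D \<in> V1 \<inter> V2" and T: "T \<in> D" for D T
  proof -
    have DA: "D \<in> Aut M" using D by (simp add: V2_def)
    have Tm: "T \<in> mp_bijections M" by (rule Aut_rep[OF DA T])
    note [measurable] = mp_measurable[OF Sm] mp_measurable[OF Tm] mp_measurable[OF mp_pow[OF Sm]] mp_measurable[OF mp_pow[OF Tm]]
    let ?u = "\<lambda>y. \<bar>indicator P ((T ^^ a) y) - indicator P ((S ^^ a) y)\<bar> :: real"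
    let ?v = "\<lambda>x. \<bar>indicator B (T x) - indicator B (S x)\<bar> :: real"
    have um[measurable]: "?u \<in> borel_measurable M" by measurable
    have ui: "integrable M (\<lambda>x. ?u (T x))" by (rule integrable_const_bound[where B = 1]) (auto simp: indicator_def)
    have vi: "integrable M ?v" by (rule integrable_const_bound[where B = 1]) (auto simp: indicator_def)
    have "(\<integral>x. \<bar>indicator P ((T ^^ Suc a) x) - indicator P ((S ^^ Suc a) x)\<bar> \<partial>M) \<le> (\<integral>x. ?u (T x) + ?v x \<partial>M)"
    proof (rule integral_mono_AE)
      show "integrable M (\<lambda>x. \<bar>indicator P ((T ^^ Suc a) x) - indicator P ((S ^^ Suc a) x)\<bar> :: real)"
        by (rule integrable_const_bound[where B = 1]) (auto simp: indicator_def)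
      show "integrable M (\<lambda>x. ?u (T x) + ?v x)" using ui vi by simp
      show "AE x in M. \<bar>indicator P ((T ^^ Suc a) x) - indicator P ((S ^^ Suc a) x)\<bar> \<le> ?u (T x) + ?v x"
        using AE_space
      proof eventually_elim
        case (elim x)
        have "(indicator B (T x) :: real) = indicator P ((S ^^ a) (T x))" "(indicator B (S x) :: real) = indicator P ((S ^^ a) (S x))"
          using mp_space[OF Tm elim] mp_space[OF Sm elim] by (simp_all add: B_def indicator_def)
        then show ?case by (simp add: funpow_swap1)
      qed
    qed
    also have "\<dots> = (\<integral>x. ?u (T x) \<partial>M) + (\<integral>x. ?v x \<partial>M)" using ui vi by simp
    also have "(\<integral>x. ?u (T x) \<partial>M) = (\<integral>x. ?u x \<partial>M)"
      using integral_distr[OF mp_measurable[OF Tm] um] by (simp add: mp_distr[OF Tm])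
    also have "(\<integral>x. ?v x \<partial>M) = measure M (sym_diff (T ` A) (S ` A))"
    proof -
      let ?X = "sym_diff (T -` B \<inter> space M) A"
      have X: "?X \<in> sets M" using measurable_sets[OF mp_measurable[OF Tm] B] A by auto
      have "(\<integral>x. ?v x \<partial>M) = (\<integral>x. indicator ?X x \<partial>M)"
        by (rule Bochner_Integration.integral_cong) (auto simp: indicator_def A_def)
      also have "\<dots> = measure M ?X" using X sets.sets_into_space[OF X] by (simp add: Int_absorb2)
      also have "\<dots> = measure M (T ` ?X)" using mp_bijections_image(2)[OF Tm X] by (simp add: measure_def)
      also have "T ` ?X = sym_diff (T ` A) (S ` A)"
      proof -
        have Xs: "?X \<subseteq> space M" using X by (rule sets.sets_into_space)
        have "y \<in> T ` ?X \<longleftrightarrow> y \<in> sym_diff (T ` A) (S ` A)" if y: "y \<in> space M" for y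
        proof -
          have "y \<in> S ` A \<longleftrightarrow> y \<in> B"
            using y mp_inv_space[OF Sm y] mp_inv_right[OF Sm y] unfolding mp_image_eq_vimage[OF Sm As] by (simp add: A_def)
          moreover have "y \<in> T ` A \<longleftrightarrow> mp_inv M T y \<in> A" using y unfolding mp_image_eq_vimage[OF Tm As] by simp
          moreover have "y \<in> T ` ?X \<longleftrightarrow> mp_inv M T y \<in> ?X" using y unfolding mp_image_eq_vimage[OF Tm Xs] by simp
          moreover have "mp_inv M T y \<in> T -` B \<inter> space M \<longleftrightarrow> y \<in> B"
            using mp_inv_space[OF Tm y] mp_inv_right[OF Tm y] by simp
          ultimately show ?thesis by blast
        qed
        moreover have "T ` ?X \<subseteq> space M" "T ` A \<subseteq> space M" "S ` A \<subseteq> space M"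
          using Xs As mp_space[OF Tm] mp_space[OF Sm] by auto
        ultimately show ?thesis by blast
      qed
      finally show ?thesis .
    qed
    also have "(\<integral>x. ?u x \<partial>M) + measure M (sym_diff (T ` A) (S ` A)) < e / 2 + e / 2"
      using V1(3)[of D T] D T S by (intro add_strict_mono) (auto simp: V2_def)
    finally show ?thesis by simp
  qed
  then show ?case using V1 V2 CV2 by (intro exI[of _ "V1 \<inter> V2"]) auto
qed

lemma map_prod_pow:
  fixes S :: "'a \<Rightarrow> 'a" and T :: "'b \<Rightarrow> 'b"
  shows "map_prod S T ^^ n = map_prod (S ^^ n) (T ^^ n)"
  by (induction n) (auto simp: fun_eq_iff)

lemma indicator_times_diff:
  "\<bar>indicator (P \<times> Q) u - indicator (P \<times> Q) v\<bar> \<le>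
    \<bar>indicator P (fst u) - indicator P (fst v)\<bar> + \<bar>indicator Q (snd u) - indicator Q (snd v) :: real\<bar>"
  by (auto simp: indicator_def mem_Times_iff)

text \<open>Reduces closeness on the fibre product to closeness in single coordinates, where
  \<open>power_close\<close> applies to \<open>mu\<close>.\<close>

lemma obs_diff_le:
  "\<bar>obs A D D' u - obs A D D' v\<bar> \<le>
     \<bar>indicator (A \<times> D) (fst u) - indicator (A \<times> D) (fst v)\<bar> +
     \<bar>indicator ({0..1} \<times> D') (snd u) - indicator ({0..1} \<times> D') (snd v)\<bar> +
     (\<bar>indicator (A \<times> {0..1}) (fst u) - indicator (A \<times> {0..1}) (fst v)\<bar> +
      \<bar>indicator ({0..1} \<times> {0..1}) (snd u) - indicator ({0..1} \<times> {0..1}) (snd v)\<bar>)"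
proof -
  have scaled: "\<bar>(a - c * b) - (a' - c * b')\<bar> \<le> \<bar>a - a'\<bar> + \<bar>b - b'\<bar>" if "0 \<le> c" "c \<le> 1" for a a' b b' c :: real
  proof -
    have "(a - c * b) - (a' - c * b') = (a - a') - c * (b - b')" by (simp add: right_diff_distrib)
    also have "\<bar>\<dots>\<bar> \<le> \<bar>a - a'\<bar> + \<bar>c * (b - b')\<bar>" by (rule abs_triangle_ineq4)
    also have "\<bar>c * (b - b')\<bar> \<le> 1 * \<bar>b - b'\<bar>"
      unfolding abs_mult using that by (intro mult_right_mono) auto
    finally show ?thesis by simp
  qed
  have "0 \<le> measure nu D * measure nu D'" "measure nu D * measure nu D' \<le> 1"
    by (auto intro: mult_le_one)
  then have "\<bar>obs A D D' u - obs A D D' v\<bar> \<le>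
     \<bar>indicator ((A \<times> D) \<times> ({0..1} \<times> D')) u - indicator ((A \<times> D) \<times> ({0..1} \<times> D')) v\<bar> +
     \<bar>indicator ((A \<times> {0..1}) \<times> ({0..1} \<times> {0..1})) u - indicator ((A \<times> {0..1}) \<times> ({0..1} \<times> {0..1})) v\<bar>"
    unfolding obs_def by (rule scaled)
  then show ?thesis
    by (rule order_trans) (intro add_mono indicator_times_diff)
qed

text \<open>An average involves finitely many powers and four sets, so finitely many neighbourhoods
  from \<open>power_close\<close> suffice. Measurability of \<open>T \<times> T\<close> is a premise
  because \<open>V\<close> is open in all of \<open>Aut mu\<close> and contains more than
  extensions.\<close>

lemma square_average_close:
  assumes C: "C \<in> Aut mu" "S \<in> C" and p: "convex_weights n p"
    and A: "A \<in> sets nu" "D \<in> sets nu" "D' \<in> sets nu"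
    and lt: "square_average S (obs A D D') n p < e"
    and SS: "map_prod S S \<in> rel_product \<rightarrow>\<^sub>M rel_product"
  shows "\<exists>V. openin (weak_topology mu) V \<and> C \<in> V \<and> (\<forall>K\<in>V. \<forall>T\<in>K.
     map_prod T T \<in> rel_product \<rightarrow>\<^sub>M rel_product \<longrightarrow> square_average T (obs A D D') n p < e)"
proof -
  interpret L: prob_space rel_product by (rule prob_space_rel_product)
  let ?f = "obs A D D'"
  \<comment> \<open>Each of the four indicators contributes \<open>d\<close>, the difference of
    squares of averages bounded by 1 doubles this, and the resulting \<open>8 * d\<close> stays
    below the gap \<open>9 * d\<close>.\<close>
  define d where "d = (e - square_average S ?f n p) / 9"
  have d: "d > 0" using lt by (simp add: d_def)
  let ?\<W> = "{A \<times> D, {0..1} \<times> D', A \<times> {0..1}, {0..1} \<times> {0..1}}"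
  have W: "P \<in> sets mu" if "P \<in> ?\<W>" for P
    using that rectangle_sets(2) A unit_sets by blast
  define close where "close P a T \<longleftrightarrow> (\<integral>x. \<bar>indicator P ((T ^^ a) x) - indicator P ((S ^^ a) x)\<bar> \<partial>mu) < d" for P a T
  define V where "V P a = (SOME V. openin (weak_topology mu) V \<and> C \<in> V \<and> (\<forall>K\<in>V. \<forall>T\<in>K. close P a T))" for P a
  have VV: "openin (weak_topology mu) (V P a) \<and> C \<in> V P a \<and> (\<forall>K\<in>V P a. \<forall>T\<in>K. close P a T)" if "P \<in> ?\<W>" for P a
    unfolding V_def close_def
    by (rule someI_ex) (rule power_close[OF prob_space.finite_measure[OF prob_space_mu] C W[OF that] d])
  have V: "openin (weak_topology mu) (V P a)" "C \<in> V P a" "K \<in> V P a \<Longrightarrow> T \<in> K \<Longrightarrow> close P a T"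
    if "P \<in> ?\<W>" for P a K T
    using VV[OF that] by blast+
  let ?V = "\<Inter>((\<lambda>(P, a). V P a) ` (?\<W> \<times> {..n}))"
  have V_open: "openin (weak_topology mu) ?V"
    by (rule openin_Inter) (use V(1) in auto)
  have CV: "C \<in> ?V" using V(2) by auto
  have bound: "square_average T ?f n p < e"
    if K: "K \<in> ?V" and T: "T \<in> K" and TT: "map_prod T T \<in> rel_product \<rightarrow>\<^sub>M rel_product" for K T
  proof -
    let ?s = "map_prod S S" and ?t = "map_prod T T"
    note fm[measurable] = obs_measurable[OF A]
    have tm[measurable]: "(?t ^^ a) \<in> rel_product \<rightarrow>\<^sub>M rel_product" "(?s ^^ a) \<in> rel_product \<rightarrow>\<^sub>M rel_product" for a
      using measurable_compose_n[OF TT] measurable_compose_n[OF SS] by auto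
    have cl: "close P a T" if "P \<in> ?\<W>" "a < n" for P a
    proof -
      have "K \<in> V P a" using K that by fastforce
      then show ?thesis by (rule V(3)[OF that(1) _ T])
    qed
    let ?g = "\<lambda>R x. \<Sum>a<n. p a * ?f ((R ^^ a) x)"
    have p0: "0 \<le> p a" and p1: "(\<Sum>a<n. p a) = 1" for a using p by (auto simp: convex_weights_def)
    have gb: "\<bar>?g R x\<bar> \<le> 1" for R x
    proof -
      have "\<bar>?g R x\<bar> \<le> (\<Sum>a<n. \<bar>p a * ?f ((R ^^ a) x)\<bar>)" by (rule sum_abs)
      also have "\<dots> \<le> (\<Sum>a<n. p a)" by (intro sum_mono) (simp add: abs_mult p0 mult_left_le obs_bound)
      finally show ?thesis by (simp add: p1)
    qed
    have gm[measurable]: "?g ?t \<in> borel_measurable rel_product" "?g ?s \<in> borel_measurable rel_product" by measurable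
    have bi: "integrable rel_product u" if "u \<in> borel_measurable rel_product" "\<And>x. \<bar>u x\<bar> \<le> c" for u :: "_ \<Rightarrow> real" and c
      using that by (intro L.integrable_const_bound[where B = c]) auto
    have diff_int: "integrable rel_product (\<lambda>x. \<bar>?f ((?t ^^ a) x) - ?f ((?s ^^ a) x)\<bar>)" for a
    proof (rule bi[of _ 2])
      show "\<bar>\<bar>?f ((?t ^^ a) x) - ?f ((?s ^^ a) x)\<bar>\<bar> \<le> 2" for x
        using obs_bound[of A D D' "(?t ^^ a) x"] obs_bound[of A D D' "(?s ^^ a) x"] by linarith
    qed measurable
    have close1: "(\<integral>x. \<bar>?f ((?t ^^ a) x) - ?f ((?s ^^ a) x)\<bar> \<partial>rel_product) \<le> 4 * d" if a: "a < n" for a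
    proof -
      define h where "h P x = (\<bar>indicator P ((T ^^ a) x) - indicator P ((S ^^ a) x)\<bar> :: real)" for P x
      have Taf: "(T ^^ a) (fst x) = fst ((?t ^^ a) x)" "(T ^^ a) (snd x) = snd ((?t ^^ a) x)"
         "(S ^^ a) (fst x) = fst ((?s ^^ a) x)" "(S ^^ a) (snd x) = snd ((?s ^^ a) x)" for x
        by (simp_all add: map_prod_pow)
      note [measurable] = fst_rel(1) snd_rel(1)
      have hm: "(\<lambda>x. h P (fst x)) \<in> borel_measurable rel_product" "(\<lambda>x. h P (snd x)) \<in> borel_measurable rel_product"
        if "P \<in> ?\<W>" for P
      proof -
        note [measurable] = W[OF that]
        show "(\<lambda>x. h P (fst x)) \<in> borel_measurable rel_product" "(\<lambda>x. h P (snd x)) \<in> borel_measurable rel_product"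
          unfolding h_def Taf by measurable
      qed
      have hi: "integrable rel_product (\<lambda>x. h P (fst x))" "integrable rel_product (\<lambda>x. h P (snd x))" if "P \<in> ?\<W>" for P
        using hm[OF that] by (intro bi[of _ 1]; simp add: h_def indicator_def)+
      have hint: "(\<integral>x. h P (fst x) \<partial>rel_product) < d" "(\<integral>x. h P (snd x) \<partial>rel_product) < d"
        if P: "P \<in> ?\<W>" and hP: "h P \<in> borel_measurable mu" for P
        using integral_distr[OF fst_rel(1) hP] integral_distr[OF snd_rel(1) hP] cl[OF P a]
        unfolding close_def h_def[symmetric] fst_rel(2) snd_rel(2) by simp_all
      have KA: "K \<in> Aut mu"
      proof -
        have "K \<in> V (A \<times> D) 0" using K by fastforce
        then show ?thesis using openin_subset[OF V(1)[of "A \<times> D" 0]] by (auto simp: topspace_weak_topology)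
      qed
      have hP: "h P \<in> borel_measurable mu" if "P \<in> ?\<W>" for P
      proof -
        note [measurable] = W[OF that] mp_measurable[OF mp_pow[OF Aut_rep[OF KA T]]] mp_measurable[OF mp_pow[OF Aut_rep[OF C]]]
        show ?thesis unfolding h_def by measurable
      qed
      have pw: "\<bar>?f ((?t ^^ a) x) - ?f ((?s ^^ a) x)\<bar> \<le>
         h (A \<times> D) (fst x) + h ({0..1} \<times> D') (snd x) + (h (A \<times> {0..1}) (fst x) + h ({0..1} \<times> {0..1}) (snd x))" for x
        unfolding h_def Taf by (rule obs_diff_le)
      have "(\<integral>x. \<bar>?f ((?t ^^ a) x) - ?f ((?s ^^ a) x)\<bar> \<partial>rel_product) \<le>
         (\<integral>x. h (A \<times> D) (fst x) + h ({0..1} \<times> D') (snd x) + (h (A \<times> {0..1}) (fst x) + h ({0..1} \<times> {0..1}) (snd x)) \<partial>rel_product)"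
      proof (rule integral_mono[OF _ _ pw])
        show "integrable rel_product (\<lambda>x. \<bar>?f ((?t ^^ a) x) - ?f ((?s ^^ a) x)\<bar>)" by (rule diff_int)
      qed (intro Bochner_Integration.integrable_add hi; simp)
      also have "\<dots> = (\<integral>x. h (A \<times> D) (fst x) \<partial>rel_product) + (\<integral>x. h ({0..1} \<times> D') (snd x) \<partial>rel_product) +
          ((\<integral>x. h (A \<times> {0..1}) (fst x) \<partial>rel_product) + (\<integral>x. h ({0..1} \<times> {0..1}) (snd x) \<partial>rel_product))"
        using hi by (simp add: Bochner_Integration.integral_add)
      also have "\<dots> \<le> d + d + (d + d)"
        using hint hP by (intro add_mono less_imp_le) auto
      finally show ?thesis by simp
    qed
    have "square_average T ?f n p - square_average S ?f n p = (\<integral>x. (?g ?t x)\<^sup>2 - (?g ?s x)\<^sup>2 \<partial>rel_product)"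
      unfolding square_average_def
      by (rule Bochner_Integration.integral_diff[symmetric]; rule bi[of _ 1]; use gb in \<open>simp add: abs_square_le_1\<close>)
    also have "\<dots> \<le> (\<integral>x. 2 * (\<Sum>a<n. p a * \<bar>?f ((?t ^^ a) x) - ?f ((?s ^^ a) x)\<bar>) \<partial>rel_product)"
    proof (rule integral_mono)
      have s2: "\<bar>(?g ?t x)\<^sup>2 - (?g ?s x)\<^sup>2\<bar> \<le> 2 * (\<Sum>a<n. p a * \<bar>?f ((?t ^^ a) x) - ?f ((?s ^^ a) x)\<bar>)" for x
      proof -
        have "\<bar>(?g ?t x)\<^sup>2 - (?g ?s x)\<^sup>2\<bar> = \<bar>?g ?t x + ?g ?s x\<bar> * \<bar>?g ?t x - ?g ?s x\<bar>"
          by (simp add: power2_eq_square algebra_simps flip: abs_mult)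
        also have "\<dots> \<le> 2 * \<bar>?g ?t x - ?g ?s x\<bar>"
          using gb[of ?t x] gb[of ?s x] by (intro mult_right_mono) linarith+
        also have "?g ?t x - ?g ?s x = (\<Sum>a<n. p a * (?f ((?t ^^ a) x) - ?f ((?s ^^ a) x)))"
          by (simp add: right_diff_distrib sum_subtractf)
        also have "\<bar>\<dots>\<bar> \<le> (\<Sum>a<n. \<bar>p a * (?f ((?t ^^ a) x) - ?f ((?s ^^ a) x))\<bar>)" by (rule sum_abs)
        also have "\<dots> = (\<Sum>a<n. p a * \<bar>?f ((?t ^^ a) x) - ?f ((?s ^^ a) x)\<bar>)" by (simp add: abs_mult p0)
        finally show ?thesis by simp
      qed
      then show "(?g ?t x)\<^sup>2 - (?g ?s x)\<^sup>2 \<le> 2 * (\<Sum>a<n. p a * \<bar>?f ((?t ^^ a) x) - ?f ((?s ^^ a) x)\<bar>)" for x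
        using abs_le_D1 by blast
      have sb: "\<bar>(?g R x)\<^sup>2\<bar> \<le> 1" for R x using gb[of R x] by (simp add: abs_square_le_1)
      show "integrable rel_product (\<lambda>x. (?g ?t x)\<^sup>2 - (?g ?s x)\<^sup>2)"
        by (intro Bochner_Integration.integrable_diff bi[of _ 1] sb) measurable
      show "integrable rel_product (\<lambda>x. 2 * (\<Sum>a<n. p a * \<bar>?f ((?t ^^ a) x) - ?f ((?s ^^ a) x)\<bar>))"
        by (intro integrable_mult_right Bochner_Integration.integrable_sum diff_int)
    qed
    also have "\<dots> = 2 * (\<Sum>a<n. p a * (\<integral>x. \<bar>?f ((?t ^^ a) x) - ?f ((?s ^^ a) x)\<bar> \<partial>rel_product))"
      using diff_int by (simp add: Bochner_Integration.integral_sum)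
    also have "\<dots> \<le> 2 * (\<Sum>a<n. p a * (4 * d))"
      using close1 p0 by (intro mult_left_mono sum_mono) auto
    also have "\<dots> = 2 * (4 * d)" by (simp only: sum_distrib_right[symmetric] p1 mult_1)
    finally have le: "square_average T ?f n p - square_average S ?f n p \<le> 8 * d" by simp
    have "9 * d = e - square_average S ?f n p" by (simp add: d_def)
    then show ?thesis using le d by linarith
  qed
  show ?thesis
    by (rule exI[of _ ?V], intro conjI ballI impI, rule V_open, rule CV, rule bound)
qed

text \<open>For a given observable and tolerance, the classes admitting some small average form an
  open set, because an average that is small for one class stays small nearby. Observables and
  tolerances are countably many.\<close>

lemma relative_W_gdelta:
  assumes C0: "C0 \<in> Aut nu" "T0 \<in> C0"
  shows "gdelta_in (extension_topology C0) (relative_W C0)"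
proof -
  let ?f = "\<lambda>(N, k, N1, k1, N2, k2, j :: nat). obs (dyadic N k) (dyadic N1 k1) (dyadic N2 k2)"
  let ?e = "\<lambda>(N :: nat, k :: nat, N1 :: nat, k1 :: nat, N2 :: nat, k2 :: nat, j). 1 / real (Suc j)"
  \<comment> \<open>An index encodes three dyadic sets and the tolerance \<open>1 / (j + 1)\<close>;
    as a tuple of naturals it ranges over a countable type.\<close>
  define O' where "O' i = {C \<in> extensions C0. \<forall>T\<in>C. \<exists>n p. convex_weights n p \<and> square_average T (?f i) n p < ?e i}" for i
  have ext: "extends T T0" if "C \<in> extensions C0" "T \<in> C" for C T
    using that extensions_iff[OF C0, of C T] by (simp add: extensions_def)
  have "openin (extension_topology C0) (O' i)" for i
    unfolding openin_subopen[of _ "O' i"]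
  proof
    fix C assume C: "C \<in> O' i"
    then have CE: "C \<in> extensions C0" and CA: "C \<in> Aut mu" by (auto simp: O'_def extensions_def)
    obtain S where S: "S \<in> C" using Aut_nonempty[OF CA] by blast
    obtain n p where p: "convex_weights n p" "square_average S (?f i) n p < ?e i" using C S unfolding O'_def by blast
    obtain N k N1 k1 N2 k2 j where i: "i = (N, k, N1, k1, N2, k2, j)" by (cases i)
    obtain V where V: "openin (weak_topology mu) V" "C \<in> V"
      "\<And>K T. K \<in> V \<Longrightarrow> T \<in> K \<Longrightarrow> map_prod T T \<in> rel_product \<rightarrow>\<^sub>M rel_product \<Longrightarrow> square_average T (?f i) n p < ?e i"
      using square_average_close[OF CA S p(1) dyadic_sets dyadic_sets dyadic_sets, of N k N1 k1 N2 k2 "?e i"]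
        p(2) extends_map_prod(1)[OF ext[OF CE S]] unfolding i by auto
    have "openin (extension_topology C0) (V \<inter> extensions C0)"
      unfolding extension_topology_def openin_subtopology using V(1) by blast
    moreover have "V \<inter> extensions C0 \<subseteq> O' i"
    proof
      fix K assume K: "K \<in> V \<inter> extensions C0"
      have "\<exists>n p. convex_weights n p \<and> square_average T (?f i) n p < ?e i" if T: "T \<in> K" for T
        using V(3)[of K T] K T extends_map_prod(1)[OF ext[of K T]] p(1) by blast
      then show "K \<in> O' i" using K by (simp add: O'_def)
    qed
    ultimately show "\<exists>U. openin (extension_topology C0) U \<and> C \<in> U \<and> U \<subseteq> O' i"
      using V(2) CE by blast
  qed
  then have g: "gdelta_in (extension_topology C0) (O' i)" for i by (rule open_imp_gdelta_in)
  have "gdelta_in (extension_topology C0) (\<Inter>(range O'))"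
    by (rule gdelta_in_Inter) (use g in auto)
  moreover have "\<Inter>(range O') = relative_W C0"
  proof (intro set_eqI iffI)
    fix C assume C: "C \<in> \<Inter>(range O')"
    have C': "C \<in> O' (N, k, N1, k1, N2, k2, j)" for N k N1 k1 N2 k2 j using C by blast
    have CE: "C \<in> extensions C0" using C'[of 0 0 0 0 0 0 0] by (simp add: O'_def)
    obtain T where T: "T \<in> C" using Aut_nonempty[of C mu] CE by (auto simp: extensions_def)
    have "rel_weak_mixing T"
      unfolding rel_weak_mixing_iff_average[OF ext[OF CE T]]
    proof (intro allI impI)
      fix N k N1 k1 N2 k2 and e :: real assume "e > 0"
      then obtain j where j: "1 / real (Suc j) < e" using nat_approx_posE by blast
      have "\<exists>n p. convex_weights n p \<and> square_average T (obs (dyadic N k) (dyadic N1 k1) (dyadic N2 k2)) n p < 1 / real (Suc j)"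
        using C'[of N k N1 k1 N2 k2 j] T by (simp add: O'_def)
      then show "\<exists>n p. convex_weights n p \<and> square_average T (obs (dyadic N k) (dyadic N1 k1) (dyadic N2 k2)) n p < e"
        using j by (meson less_trans)
    qed
    then show "C \<in> relative_W C0" using relative_W_iff[OF C0 CE T] by simp
  next
    fix C assume C: "C \<in> relative_W C0"
    then have CE: "C \<in> extensions C0" by (simp add: relative_W_def)
    have "\<exists>n p. convex_weights n p \<and> square_average T (?f i) n p < ?e i" if T: "T \<in> C" for T i
    proof -
      obtain N k N1 k1 N2 k2 j where i: "i = (N, k, N1, k1, N2, k2, j)" by (cases i)
      have "rel_weak_mixing T" using relative_W_iff[OF C0 CE T] C by simp
      then have "\<forall>e>0. \<exists>n p. convex_weights n p \<and> square_average T (obs (dyadic N k) (dyadic N1 k1) (dyadic N2 k2)) n p < e"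
        unfolding rel_weak_mixing_iff_average[OF ext[OF CE T]] by blast
      then show ?thesis unfolding i by simp
    qed
    then show "C \<in> \<Inter>(range O')" using CE by (auto simp: O'_def)
  qed
  ultimately show ?thesis by simp
qed

section \<open>A relatively weakly mixing extension\<close>

lemma map_prod_mp:
  assumes S: "S \<in> mp_bijections nu" and T: "T \<in> mp_bijections nu"
  shows "map_prod S T \<in> mp_bijections mu"
proof -
  interpret complete_measure mu by (rule complete_mu)
  let ?nn = "nu \<Otimes>\<^sub>M nu"
  have pres: "map_prod S T \<in> mu \<rightarrow>\<^sub>M mu" "distr mu mu (map_prod S T) = mu"
    if S: "S \<in> mp_bijections nu" and T: "T \<in> mp_bijections nu" for S T
  proof -
    note [measurable] = mp_measurable[OF S] mp_measurable[OF T]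
    have eq: "map_prod S T = (\<lambda>x. (S (fst x), T (snd x)))" by (auto simp: fun_eq_iff)
    have m: "map_prod S T \<in> ?nn \<rightarrow>\<^sub>M ?nn" unfolding eq by measurable
    have d: "distr ?nn ?nn (map_prod S T) = ?nn"
    proof (rule rectangle_measure_eqI)
      show "finite_measure (distr ?nn ?nn (map_prod S T))"
        using nn.prob_space_distr[OF m] by (rule prob_space.finite_measure)
      fix a b assume a: "a \<in> sets nu" and b: "b \<in> sets nu"
      have "map_prod S T -` (a \<times> b) \<inter> space ?nn = (S -` a \<inter> space nu) \<times> (T -` b \<inter> space nu)"
        by (auto simp: space_pair_measure)
      then show "emeasure (distr ?nn ?nn (map_prod S T)) (a \<times> b) = emeasure ?nn (a \<times> b)"
        using m a b measurable_sets[OF mp_measurable[OF S] a] measurable_sets[OF mp_measurable[OF T] b]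
        by (simp add: emeasure_distr nu.emeasure_pair_measure_Times mp_emeasure_vimage[OF S] mp_emeasure_vimage[OF T])
    qed simp_all
    have m': "map_prod S T \<in> mu \<rightarrow>\<^sub>M ?nn" unfolding mu_def by (rule measurable_completion[OF m])
    have d': "distr mu ?nn (map_prod S T) = ?nn" unfolding mu_def using distr_completion[OF m] d by simp
    show "map_prod S T \<in> mu \<rightarrow>\<^sub>M mu" "distr mu mu (map_prod S T) = mu"
      using measure_preserving_completion[OF m' d'] unfolding mu_def[symmetric] by simp_all
  qed
  show ?thesis
  proof (rule mp_bijectionsI[where T' = "map_prod (mp_inv nu S) (mp_inv nu T)"])
    fix x assume "x \<in> space mu"
    then have x: "fst x \<in> space nu" "snd x \<in> space nu" by (auto simp: space_mu space_nu)
    then show "map_prod (mp_inv nu S) (mp_inv nu T) (map_prod S T x) = x"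
      using mp_inv_left[OF S x(1)] mp_inv_left[OF T x(2)] by (cases x) simp
    show "map_prod S T (map_prod (mp_inv nu S) (mp_inv nu T) x) = x"
      using mp_inv_right[OF S x(1)] mp_inv_right[OF T x(2)] by (cases x) simp
  qed (rule pres[OF S T] pres(1)[OF mp_inv_mp[OF S] mp_inv_mp[OF T]])+
qed

text \<open>In the correlation of an observable with its \<open>m\<close>-th translate,
  \<open>T0\<close> enters only through the base set \<open>A'\<close>, whatever its dynamics. In
  the fibres \<open>beta\<close> makes the sets exactly independent for large \<open>m\<close>, and
  mean zero then yields correlation 0.\<close>

lemma rel_weak_mixing_product:
  assumes T0: "T0 \<in> mp_bijections nu"
  shows "extends (map_prod T0 beta) T0" "rel_weak_mixing (map_prod T0 beta)"
proof -
  let ?S = "map_prod T0 beta"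
  have bm: "beta \<in> mp_bijections nu" by (rule permute_digits_mp[OF bij_digit_shift])
  show ext: "extends ?S T0" using map_prod_mp[OF T0 bm] T0 by (simp add: extends_def)
  show "rel_weak_mixing ?S"
    unfolding rel_weak_mixing_iff_orthogonal[OF ext]
  proof (intro allI ballI impI)
    fix N k N1 k1 N2 k2 E
    assume E: "E \<in> sets rel_product" "AE p in rel_product. map_prod ?S ?S p \<in> E \<longleftrightarrow> p \<in> E"
    define A where "A = dyadic N k"
    define D where "D = dyadic N1 k1"
    define D' where "D' = dyadic N2 k2"
    have A: "A \<in> sets nu" and D: "D \<in> sets nu" and D': "D' \<in> sets nu"
      unfolding A_def D_def D'_def by (rule dyadic_sets)+
    interpret bounded_observable rel_product "map_prod ?S ?S" "obs A D D'"
      by (rule bounded_observable_obs[OF ext A D D'])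
    obtain K1 where K1: "\<And>m. m \<ge> K1 \<Longrightarrow> measure nu (D \<inter> ((beta ^^ m) -` D \<inter> space nu)) = measure nu D ^ 2"
      using beta_mixing[of N1 k1] unfolding D_def by metis
    obtain K2 where K2: "\<And>m. m \<ge> K2 \<Longrightarrow> measure nu (D' \<inter> ((beta ^^ m) -` D' \<inter> space nu)) = measure nu D' ^ 2"
      using beta_mixing[of N2 k2] unfolding D'_def by metis
    have "(\<integral>p. indicator E p * obs A D D' p \<partial>rel_product) = 0"
    proof (rule orthogonal_invariant[OF E, of "max K1 K2"])
      fix m assume m: "max K1 K2 \<le> m"
      let ?b = "\<lambda>B. (beta ^^ m) -` B \<inter> space nu"
      define A' where "A' = A \<inter> ((T0 ^^ m) -` A \<inter> space nu)"
      have vm: "(U ^^ m) -` B \<inter> space nu \<in> sets nu" if "U \<in> mp_bijections nu" "B \<in> sets nu" for U B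
        using measurable_sets[OF mp_measurable[OF mp_pow[OF that(1)]] that(2)] .
      have A': "A' \<in> sets nu" unfolding A'_def using A vm[OF T0 A] by auto
      have A's: "A' \<inter> {0..1} = A'" using sets.sets_into_space[OF A'] by (auto simp: space_nu)
      have bmeas: "measure nu (?b B) = measure nu B" if "B \<in> sets nu" for B
        using mp_emeasure_vimage[OF mp_pow[OF bm] that] by (simp add: measure_def)
      let ?c = "measure nu D * measure nu D'"
      let ?R = "\<lambda>B B'. (A' \<times> B) \<times> ({0..1} \<times> B')"
      let ?X = "(A \<times> D) \<times> ({0..1} \<times> D')" and ?Y = "(A \<times> {0..1}) \<times> ({0..1} \<times> {0..1})"
      have R: "?R B B' \<in> sets rel_product" "measure rel_product (?R B B') = measure nu A' * measure nu B * measure nu B'"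
        if "B \<in> sets nu" "B' \<in> sets nu" for B B'
        using rectangle_sets(1)[OF A' that(1) unit_sets that(2)] measure_rel_product_rectangle[OF A' that(1) unit_sets that(2)]
        by (simp_all add: A's)
      have RI: "integrable rel_product (indicator (?R B B') :: _ \<Rightarrow> real)" "(\<integral>p. indicator (?R B B') p \<partial>rel_product) = measure nu A' * measure nu B * measure nu B'"
        if "B \<in> sets nu" "B' \<in> sets nu" for B B'
        using R[OF that] sets.sets_into_space[OF R(1)[OF that]] by (simp_all add: emeasure_eq_measure Int_absorb2)
      have DD: "D \<inter> ?b D \<in> sets nu" "D' \<inter> ?b D' \<in> sets nu" "?b D \<in> sets nu" "?b D' \<in> sets nu"
        using D D' vm[OF bm D] vm[OF bm D'] by auto
      \<comment> \<open>Expanding the product of the two differences gives four rectangle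
        indicators, all over \<open>A'\<close>; the second base coordinate is unconstrained.\<close>
      have "(\<integral>p. obs A D D' p * obs A D D' ((map_prod ?S ?S ^^ m) p) \<partial>rel_product) =
        (\<integral>p. indicator (?R (D \<inter> ?b D) (D' \<inter> ?b D')) p - ?c * indicator (?R D D') p
           - ?c * indicator (?R (?b D) (?b D')) p + ?c * ?c * indicator (?R {0..1} {0..1}) p \<partial>rel_product)"
      proof (rule Bochner_Integration.integral_cong[OF refl])
        fix p assume p: "p \<in> space rel_product"
        obtain z y z' y' where pz: "p = ((z, y), (z', y'))" by (metis prod.exhaust)
        have sp: "z \<in> {0..1}" "y \<in> {0..1}" "z' \<in> {0..1}" "y' \<in> {0..1}"
          using p unfolding pz by (auto simp: space_rel_product)
        have sp': "(T0 ^^ m) z' \<in> {0..1}" "(beta ^^ m) y \<in> {0..1}" "(beta ^^ m) y' \<in> {0..1}"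
          using sp mp_space[OF mp_pow[OF T0, of m], of z'] mp_space[OF mp_pow[OF bm, of m], of y]
            mp_space[OF mp_pow[OF bm, of m], of y'] by (simp_all add: space_nu)
        have tp: "(map_prod ?S ?S ^^ m) p = (((T0 ^^ m) z, (beta ^^ m) y), ((T0 ^^ m) z', (beta ^^ m) y'))"
          unfolding pz map_prod_pow by simp
        let ?iX = "of_bool (z \<in> A \<and> y \<in> D \<and> y' \<in> D') :: real" and ?iY = "of_bool (z \<in> A) :: real"
        let ?jX = "of_bool ((T0 ^^ m) z \<in> A \<and> (beta ^^ m) y \<in> D \<and> (beta ^^ m) y' \<in> D') :: real"
          and ?jY = "of_bool ((T0 ^^ m) z \<in> A) :: real"
        have "obs A D D' p = ?iX - ?c * ?iY" unfolding obs_def pz using sp by (simp add: indicator_def)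
        moreover have "obs A D D' ((map_prod ?S ?S ^^ m) p) = ?jX - ?c * ?jY"
          unfolding obs_def tp using sp' by (simp add: indicator_def)
        moreover have "indicator (?R (D \<inter> ?b D) (D' \<inter> ?b D')) p = ?iX * ?jX" "indicator (?R D D') p = ?iX * ?jY"
          "indicator (?R (?b D) (?b D')) p = ?iY * ?jX" "indicator (?R {0..1} {0..1}) p = ?iY * ?jY"
          unfolding pz A'_def using sp by (auto simp: indicator_def space_nu)
        ultimately show "obs A D D' p * obs A D D' ((map_prod ?S ?S ^^ m) p) =
           indicator (?R (D \<inter> ?b D) (D' \<inter> ?b D')) p - ?c * indicator (?R D D') p
           - ?c * indicator (?R (?b D) (?b D')) p + ?c * ?c * indicator (?R {0..1} {0..1}) p"
          by (simp only:) (simp add: algebra_simps)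
      qed
      also have "\<dots> = measure nu A' * measure nu (D \<inter> ?b D) * measure nu (D' \<inter> ?b D') - ?c * (measure nu A' * measure nu D * measure nu D')
         - ?c * (measure nu A' * measure nu (?b D) * measure nu (?b D')) + ?c * ?c * (measure nu A' * measure nu {0..1::real} * measure nu {0..1::real})"
        using RI[OF DD(1,2)] RI[OF D D'] RI[OF DD(3,4)] RI[OF unit_sets unit_sets] by simp
      \<comment> \<open>With \<open>c = nu D * nu D'\<close> the four terms are \<open>nu A'\<close>
        times \<open>c^2 - c^2 - c^2 + c^2\<close>.\<close>
      also have "\<dots> = 0"
        using K1[of m] K2[of m] m by (simp add: bmeas[OF D] bmeas[OF D'] measure_unit power2_eq_square)
      finally show "(\<integral>p. obs A D D' p * obs A D D' ((map_prod ?S ?S ^^ m) p) \<partial>rel_product) = 0" .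
    qed
    then show "(\<integral>p. indicator E p * obs (dyadic N k) (dyadic N1 k1) (dyadic N2 k2) p \<partial>rel_product) = 0"
      unfolding A_def D_def D'_def .
  qed
qed

text \<open>The relative form holds over every aperiodic base. Over an ergodic one
  \<open>absolute_W_eq_relative_W\<close> identifies the two sets, so the absolute form follows at
  once.\<close>

theorem theorem0p3:
  assumes "C0 \<in> Aut nu" and "aperiodic nu C0"
  shows "dense_gdelta_in (extension_topology C0) (relative_W C0) \<and>
    ((\<forall>T0\<in>C0. ergodic nu T0) \<longrightarrow> dense_gdelta_in (extension_topology C0) (absolute_W C0))"
proof -
  obtain T0 where T0: "T0 \<in> C0" using Aut_nonempty[OF assms(1)] by blast
  have "T0 \<in> mp_bijections nu" by (rule Aut_rep[OF assms(1) T0])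
  note S = rel_weak_mixing_product[OF this]
  have "dense_gdelta_in (extension_topology C0) (relative_W C0)"
    unfolding dense_gdelta_in_def
    using relative_W_gdelta[OF assms(1) T0] relative_W_dense[OF assms(1) T0 assms(2) S] by blast
  then show ?thesis using absolute_W_eq_relative_W[OF assms(1) T0] T0 by auto
qed

end
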